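(* Let $\theta,\gamma\in\mathbf{R}$, let $d\in\mathbf{Z}$, and let $f\colon S^1\to\mathbf{R}$ be a continuous function. Let $k,l\in\mathbf{Z}$. Set $g(\zeta)=f\left(e^{2\pi i l\theta}\zeta\right)+(ld-k)\theta$ for $\zeta\in S^1$. Then $$\mathrm{Ad}(u^kv^l)\circ\alpha_{\theta,\gamma,d,f}=\alpha_{\theta,\gamma+l\theta,d,g}.$$ Moreover, the crossed products $C^*(\mathbf{Z},A_\theta,\alpha_{\theta,\gamma,d,f})$ and $C^*(\mathbf{Z},A_\theta,\alpha_{\theta,\gamma+l\theta,d,g})$ are isomorphic.
   Context: For $\theta \in \mathbf{R}$, $A_\theta$ denotes the rotation algebra, the universal C*-algebra generated by unitaries $u$ and $v$ satisfying $vu = e^{2\pi i\theta}uv$. For $\theta,\gamma\in\mathbf{R}$, $d\in\mathbf{Z}$ and $f\colon S^1\to\mathbf{R}$ continuous, $\alpha_{\theta,\gamma,d,f}$ is the (unique) automorphism of $A_\theta$ such that $\alpha_{\theta,\gamma,d,f}(u) = e^{2\pi i\gamma}u$ and $\alpha_{\theta,\gamma,d,f}(v) = \exp(2\pi i f(u))u^d v$. For a unitary $w$, $\mathrm{Ad}(w)(a)=waw^*$. $C^*(\mathbf{Z},A,\alpha)$ denotes the crossed product of $A$ by the action of $\mathbf{Z}$ generated by $\alpha$. *)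

theory Defs
  imports "HOL-Analysis.Analysis" "HOL-Algebra.Module" "HOL-Algebra.Bij"
begin

section \<open>Unital complex *-algebras, *-homomorphisms and C*-seminorms\<close>

record 'a star_algebra = "(complex, 'a) module" +
  star :: "'a \<Rightarrow> 'a"

record 'a normed_star_algebra = "'a star_algebra" +
  cnorm :: "'a \<Rightarrow> real"

text \<open>Homomorphisms are unital, since members of \<^const>\<open>ring_hom\<close> preserve the unit.\<close>

definition star_hom ::
  "('a, 'm) star_algebra_scheme \<Rightarrow> ('b, 'n) star_algebra_scheme \<Rightarrow> ('a \<Rightarrow> 'b) \<Rightarrow> bool" where
  "star_hom A B \<phi> \<longleftrightarrow>
     \<phi> \<in> ring_hom A B \<and>
     (\<forall>c. \<forall>x\<in>carrier A. \<phi> (c \<odot>\<^bsub>A\<^esub> x) = c \<odot>\<^bsub>B\<^esub> \<phi> x) \<and>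
     (\<forall>x\<in>carrier A. \<phi> (star A x) = star B (\<phi> x))"

definition star_isomorphic ::
  "('a, 'm) star_algebra_scheme \<Rightarrow> ('b, 'n) star_algebra_scheme \<Rightarrow> bool" where
  "star_isomorphic A B \<longleftrightarrow> (\<exists>\<phi>. star_hom A B \<phi> \<and> bij_betw \<phi> (carrier A) (carrier B))"

text \<open>As in \<^const>\<open>BijGroup\<close>, automorphisms are extensional functions, so that equality of
  automorphisms is equality on the carrier.\<close>

definition star_aut :: "('a, 'm) star_algebra_scheme \<Rightarrow> ('a \<Rightarrow> 'a) set" where
  "star_aut A = {\<phi> \<in> Bij (carrier A). star_hom A A \<phi>}"

definition Ad :: "('a, 'm) star_algebra_scheme \<Rightarrow> 'a \<Rightarrow> 'a \<Rightarrow> 'a" where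
  "Ad A w a = w \<otimes>\<^bsub>A\<^esub> a \<otimes>\<^bsub>A\<^esub> star A w"

definition cstar_seminorm :: "('a, 'm) star_algebra_scheme \<Rightarrow> ('a \<Rightarrow> real) \<Rightarrow> bool" where
  "cstar_seminorm D p \<longleftrightarrow>
     (\<forall>x\<in>carrier D. 0 \<le> p x) \<and>
     (\<forall>x\<in>carrier D. \<forall>y\<in>carrier D. p (x \<oplus>\<^bsub>D\<^esub> y) \<le> p x + p y) \<and>
     (\<forall>c. \<forall>x\<in>carrier D. p (c \<odot>\<^bsub>D\<^esub> x) = cmod c * p x) \<and>
     (\<forall>x\<in>carrier D. \<forall>y\<in>carrier D. p (x \<otimes>\<^bsub>D\<^esub> y) \<le> p x * p y) \<and>
     (\<forall>x\<in>carrier D. p (star D x \<otimes>\<^bsub>D\<^esub> x) = (p x)\<^sup>2)"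

section \<open>Universal C*-algebras\<close>

text \<open>The Hausdorff completion of a *-algebra \<open>D\<close> with respect to a seminorm \<open>q\<close>: Cauchy
  sequences modulo null sequences.\<close>

definition cauchy_seqs :: "('a, 'm) star_algebra_scheme \<Rightarrow> ('a \<Rightarrow> real) \<Rightarrow> (nat \<Rightarrow> 'a) set" where
  "cauchy_seqs D q =
     {x. (\<forall>n. x n \<in> carrier D) \<and>
         (\<forall>e>0. \<exists>N. \<forall>m\<ge>N. \<forall>n\<ge>N. q (x m \<ominus>\<^bsub>D\<^esub> x n) < e)}"

definition null_rel ::
  "('a, 'm) star_algebra_scheme \<Rightarrow> ('a \<Rightarrow> real) \<Rightarrow> ((nat \<Rightarrow> 'a) \<times> (nat \<Rightarrow> 'a)) set" where
  "null_rel D q =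
     {(x, y). x \<in> cauchy_seqs D q \<and> y \<in> cauchy_seqs D q \<and>
              (\<lambda>n. q (x n \<ominus>\<^bsub>D\<^esub> y n)) \<longlonglongrightarrow> 0}"

definition seq_class ::
  "('a, 'm) star_algebra_scheme \<Rightarrow> ('a \<Rightarrow> real) \<Rightarrow> (nat \<Rightarrow> 'a) \<Rightarrow> (nat \<Rightarrow> 'a) set" where
  "seq_class D q x = null_rel D q `` {x}"

definition completion ::
  "('a, 'm) star_algebra_scheme \<Rightarrow> ('a \<Rightarrow> real) \<Rightarrow> (nat \<Rightarrow> 'a) set normed_star_algebra" where
  "completion D q =
     \<lparr>carrier = cauchy_seqs D q // null_rel D q,
      mult = (\<lambda>X Y. \<Union>x\<in>X. \<Union>y\<in>Y. seq_class D q (\<lambda>n. x n \<otimes>\<^bsub>D\<^esub> y n)),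
      one = seq_class D q (\<lambda>n. \<one>\<^bsub>D\<^esub>),
      zero = seq_class D q (\<lambda>n. \<zero>\<^bsub>D\<^esub>),
      add = (\<lambda>X Y. \<Union>x\<in>X. \<Union>y\<in>Y. seq_class D q (\<lambda>n. x n \<oplus>\<^bsub>D\<^esub> y n)),
      smult = (\<lambda>c X. \<Union>x\<in>X. seq_class D q (\<lambda>n. c \<odot>\<^bsub>D\<^esub> x n)),
      star = (\<lambda>X. \<Union>x\<in>X. seq_class D q (\<lambda>n. star D (x n))),
      cnorm = (\<lambda>X. THE r. \<exists>x\<in>X. (\<lambda>n. q (x n)) \<longlonglongrightarrow> r)\<rparr>"

text \<open>A *-homomorphism from \<open>D\<close> to a C*-algebra yields a C*-seminorm on \<open>D\<close>, and every
  C*-seminorm arises in this way (from the completion it defines). Hence for a set \<open>S\<close> of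
  C*-seminorms, bounded at each point, the completion in the supremum of \<open>S\<close> is the universal
  C*-algebra for the *-homomorphisms whose C*-seminorms belong to \<open>S\<close>. Working with seminorms
  avoids quantifying over C*-algebras of all types.\<close>

definition sup_seminorm :: "('a \<Rightarrow> real) set \<Rightarrow> 'a \<Rightarrow> real" where
  "sup_seminorm S x = (SUP p\<in>S. p x)"

definition universal_cstar ::
  "('a, 'm) star_algebra_scheme \<Rightarrow> ('a \<Rightarrow> real) set \<Rightarrow> (nat \<Rightarrow> 'a) set normed_star_algebra" where
  "universal_cstar D S = completion D (sup_seminorm S)"

section \<open>The rotation algebra\<close>

text \<open>The free unital *-algebra on \<open>'g\<close>: finitely supported functions on words in the letters
  \<open>(g, False)\<close>, standing for \<open>g\<close>, and \<open>(g, True)\<close>, standing for the adjoint of \<open>g\<close>.\<close>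

type_synonym 'g star_poly = "('g \<times> bool) list \<Rightarrow> complex"

definition free_star_algebra :: "'g star_poly star_algebra" where
  "free_star_algebra =
     \<lparr>carrier = {x. finite {w. x w \<noteq> 0}},
      mult = (\<lambda>x y w. \<Sum>i\<le>length w. x (take i w) * y (drop i w)),
      one = (\<lambda>w. if w = [] then 1 else 0),
      zero = (\<lambda>w. 0),
      add = (\<lambda>x y w. x w + y w),
      smult = (\<lambda>c x w. c * x w),
      star = (\<lambda>x w. cnj (x (rev (map (apsnd Not) w))))\<rparr>"

definition free_gen :: "'g \<Rightarrow> 'g star_poly" where
  "free_gen g = (\<lambda>w. if w = [(g, False)] then 1 else 0)"

datatype rot_gen = Gen_u | Gen_v

text \<open>The C*-seminorms in whose completions the images of the generators are unitaries with
  \<open>vu = e\<^bsup>2\<pi>i\<theta>\<^esup>uv\<close>.\<close>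

definition rot_seminorms :: "real \<Rightarrow> (rot_gen star_poly \<Rightarrow> real) set" where
  "rot_seminorms \<theta> =
     (let F = free_star_algebra; u = free_gen Gen_u; v = free_gen Gen_v in
      {p. cstar_seminorm F p \<and>
          p (star F u \<otimes>\<^bsub>F\<^esub> u \<ominus>\<^bsub>F\<^esub> \<one>\<^bsub>F\<^esub>) = 0 \<and>
          p (u \<otimes>\<^bsub>F\<^esub> star F u \<ominus>\<^bsub>F\<^esub> \<one>\<^bsub>F\<^esub>) = 0 \<and>
          p (star F v \<otimes>\<^bsub>F\<^esub> v \<ominus>\<^bsub>F\<^esub> \<one>\<^bsub>F\<^esub>) = 0 \<and>
          p (v \<otimes>\<^bsub>F\<^esub> star F v \<ominus>\<^bsub>F\<^esub> \<one>\<^bsub>F\<^esub>) = 0 \<and>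
          p (v \<otimes>\<^bsub>F\<^esub> u \<ominus>\<^bsub>F\<^esub> cis (2 * pi * \<theta>) \<odot>\<^bsub>F\<^esub> (u \<otimes>\<^bsub>F\<^esub> v)) = 0})"

type_synonym rot_elem = "(nat \<Rightarrow> rot_gen star_poly) set"

definition rotation_algebra :: "real \<Rightarrow> rot_elem normed_star_algebra" where
  "rotation_algebra \<theta> = universal_cstar free_star_algebra (rot_seminorms \<theta>)"

definition rot_u :: "real \<Rightarrow> rot_elem" where
  "rot_u \<theta> = seq_class free_star_algebra (sup_seminorm (rot_seminorms \<theta>)) (\<lambda>n. free_gen Gen_u)"

definition rot_v :: "real \<Rightarrow> rot_elem" where
  "rot_v \<theta> = seq_class free_star_algebra (sup_seminorm (rot_seminorms \<theta>)) (\<lambda>n. free_gen Gen_v)"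

section \<open>Continuous functional calculus of a unitary\<close>

abbreviation unit_circle :: "complex set" where
  "unit_circle \<equiv> sphere 0 1"

definition circle_algebra :: "(complex \<Rightarrow> complex) star_algebra" where
  "circle_algebra =
     \<lparr>carrier = {h \<in> extensional unit_circle. continuous_on unit_circle h},
      mult = (\<lambda>h k. \<lambda>z\<in>unit_circle. h z * k z),
      one = (\<lambda>z\<in>unit_circle. 1),
      zero = (\<lambda>z\<in>unit_circle. 0),
      add = (\<lambda>h k. \<lambda>z\<in>unit_circle. h z + k z),
      smult = (\<lambda>c h. \<lambda>z\<in>unit_circle. c * h z),
      star = (\<lambda>h. \<lambda>z\<in>unit_circle. cnj (h z))\<rparr>"

text \<open>\<open>h(w)\<close> for a unitary \<open>w\<close> and \<open>h\<close> continuous on the unit circle: the image of \<open>h\<close> under the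
  unique unital *-homomorphism on the continuous functions that maps the identity function
  to \<open>w\<close>.\<close>

definition fun_calc :: "('a, 'm) star_algebra_scheme \<Rightarrow> (complex \<Rightarrow> complex) \<Rightarrow> 'a \<Rightarrow> 'a" where
  "fun_calc A h w =
     (THE a. \<exists>\<Phi>. star_hom circle_algebra A \<Phi> \<and> \<Phi> (\<lambda>z\<in>unit_circle. z) = w \<and>
                 a = \<Phi> (restrict h unit_circle))"

section \<open>The automorphisms\<close>

definition rot_aut :: "real \<Rightarrow> real \<Rightarrow> int \<Rightarrow> (complex \<Rightarrow> real) \<Rightarrow> rot_elem \<Rightarrow> rot_elem" where
  "rot_aut \<theta> \<gamma> d f =
     (let A = rotation_algebra \<theta>; u = rot_u \<theta>; v = rot_v \<theta> in
      THE \<alpha>. \<alpha> \<in> star_aut A \<and>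
          \<alpha> u = cis (2 * pi * \<gamma>) \<odot>\<^bsub>A\<^esub> u \<and>
          \<alpha> v = fun_calc A (\<lambda>z. exp (2 * pi * \<i> * f z)) u \<otimes>\<^bsub>A\<^esub> (u [^]\<^bsub>A\<^esub> d) \<otimes>\<^bsub>A\<^esub> v)"

section \<open>Crossed products by the integers\<close>

definition aut_power :: "('a, 'm) star_algebra_scheme \<Rightarrow> ('a \<Rightarrow> 'a) \<Rightarrow> int \<Rightarrow> 'a \<Rightarrow> 'a" where
  "aut_power A \<alpha> n = \<alpha> [^]\<^bsub>BijGroup (carrier A)\<^esub> n"

text \<open>The finitely supported functions from the integers to \<open>A\<close> with twisted convolution.\<close>

definition Cc_algebra ::
  "('a, 'm) star_algebra_scheme \<Rightarrow> ('a \<Rightarrow> 'a) \<Rightarrow> (int \<Rightarrow> 'a) star_algebra" where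
  "Cc_algebra A \<alpha> =
     \<lparr>carrier = {x. (\<forall>n. x n \<in> carrier A) \<and> finite {n. x n \<noteq> \<zero>\<^bsub>A\<^esub>}},
      mult = (\<lambda>x y n. \<Oplus>\<^bsub>A\<^esub>m\<in>{m. x m \<noteq> \<zero>\<^bsub>A\<^esub>}. x m \<otimes>\<^bsub>A\<^esub> aut_power A \<alpha> m (y (n - m))),
      one = (\<lambda>n. if n = 0 then \<one>\<^bsub>A\<^esub> else \<zero>\<^bsub>A\<^esub>),
      zero = (\<lambda>n. \<zero>\<^bsub>A\<^esub>),
      add = (\<lambda>x y n. x n \<oplus>\<^bsub>A\<^esub> y n),
      smult = (\<lambda>c x n. c \<odot>\<^bsub>A\<^esub> x n),
      star = (\<lambda>x n. aut_power A \<alpha> n (star A (x (- n))))\<rparr>"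

definition l1_norm :: "('a, 'm) normed_star_algebra_scheme \<Rightarrow> (int \<Rightarrow> 'a) \<Rightarrow> real" where
  "l1_norm A x = (\<Sum>n\<in>{n. x n \<noteq> \<zero>\<^bsub>A\<^esub>}. cnorm A (x n))"

text \<open>The (full) crossed product of a unital C*-algebra \<open>A\<close> by the action generated by the
  automorphism \<open>\<alpha>\<close>, as the enveloping C*-algebra of the twisted \<open>l\<^sup>1\<close>-algebra.\<close>

definition crossed_product ::
  "('a, 'm) normed_star_algebra_scheme \<Rightarrow> ('a \<Rightarrow> 'a) \<Rightarrow> (nat \<Rightarrow> int \<Rightarrow> 'a) set normed_star_algebra" where
  "crossed_product A \<alpha> =
     universal_cstar (Cc_algebra A \<alpha>)
       {p. cstar_seminorm (Cc_algebra A \<alpha>) p \<and>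
           (\<forall>x\<in>carrier (Cc_algebra A \<alpha>). p x \<le> l1_norm A x)}"

end

theory Submission
  imports Defs
begin

text \<open>The automorphism \<open>\<alpha>\<close> exists because \<open>c u\<close> and \<open>F(u) v\<close>, for \<open>|c| = 1\<close> and a continuous
  \<open>F\<close> from the circle to itself, satisfy the relations of \<open>u\<close> and \<open>v\<close>; its inverse is of the same
  form. It is unique because *-homomorphisms of C*-algebras are contractive: a selfadjoint element of
  norm less than 1 is the real part of the unitary \<open>x + i \<surd>(1 - x\<^sup>2)\<close>, and unitaries go to
  unitaries. The functional calculus \<open>h \<mapsto> h(u)\<close> exists because the norm of a Laurent polynomial
  in \<open>u\<close> is at most its supremum on the circle; by contractivity it is unique, hence
  \<open>\<phi>(h(u)) = h(c u)\<close> for every *-homomorphism \<open>\<phi>\<close> with \<open>\<phi>(u) = c u\<close>. Applied to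
  \<open>\<phi> = Ad(u\<^sup>k v\<^sup>l)\<close> this yields the first claim by evaluating both automorphisms at \<open>u\<close> and \<open>v\<close>.

  For the second claim, if \<open>\<beta> = Ad(w) \<circ> \<alpha>\<close> then \<open>\<beta>\<^sup>n = Ad(w\<^sub>n) \<circ> \<alpha>\<^sup>n\<close> for a unitary cocycle
  \<open>w\<^sub>n\<close>, and \<open>(x\<^sub>n) \<mapsto> (x\<^sub>n w\<^sub>n\<^sup>*)\<close> is an \<open>l\<^sup>1\<close>-isometric *-isomorphism between the two
  twisted convolution algebras, so the C*-seminorms of the two algebras correspond.\<close>

section \<open>Complex *-algebras and C*-seminorms\<close>

text \<open>\<open>rot_aut\<close> and \<open>fun_calc\<close> are definite descriptions, so the
  claims say nothing until unique existence is proved for both; most of the development serves this.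
  The obstacle is to obtain norm estimates without spectral theory: the square root behind
  contractivity comes from a fixed-point iteration, and the estimate for Laurent polynomials in u
  from bounds on their coefficients, whose loss by a factor linear in the degree disappears under
  high powers. The formula for \<open>g\<close> is forced. Put \<Lambda> = e^(2 pi i \<theta>).
  Conjugation by u^k v^l multiplies u by \<Lambda>^l and v by \<Lambda>^(-k). Hence F(z) = exp(2 pi
  i f(z)) z^d becomes F(\<Lambda>^l z). Its factor z^d releases the constant \<Lambda>^(ld), and
  together with \<Lambda>^(-k) this amounts to adding (ld - k)\<theta> to the function in the
  exponent.\<close>

locale complex_star_algebra = ring A for A :: "('a, 'm) star_algebra_scheme" (structure) +
  assumes smult_closed [simp, intro]: "x \<in> carrier A \<Longrightarrow> c \<odot> x \<in> carrier A"
    and smult_l_distr: "x \<in> carrier A \<Longrightarrow> (b + c) \<odot> x = b \<odot> x \<oplus> c \<odot> x"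
    and smult_r_distr: "x \<in> carrier A \<Longrightarrow> y \<in> carrier A \<Longrightarrow> c \<odot> (x \<oplus> y) = c \<odot> x \<oplus> c \<odot> y"
    and smult_smult: "x \<in> carrier A \<Longrightarrow> b \<odot> (c \<odot> x) = (b * c) \<odot> x"
    and smult_one [simp]: "x \<in> carrier A \<Longrightarrow> 1 \<odot> x = x"
    and smult_mult_left: "x \<in> carrier A \<Longrightarrow> y \<in> carrier A \<Longrightarrow> (c \<odot> x) \<otimes> y = c \<odot> (x \<otimes> y)"
    and smult_mult_right: "x \<in> carrier A \<Longrightarrow> y \<in> carrier A \<Longrightarrow> x \<otimes> (c \<odot> y) = c \<odot> (x \<otimes> y)"
    and star_closed [simp, intro]: "x \<in> carrier A \<Longrightarrow> star A x \<in> carrier A"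
    and star_star [simp]: "x \<in> carrier A \<Longrightarrow> star A (star A x) = x"
    and star_add: "x \<in> carrier A \<Longrightarrow> y \<in> carrier A \<Longrightarrow> star A (x \<oplus> y) = star A x \<oplus> star A y"
    and star_mult: "x \<in> carrier A \<Longrightarrow> y \<in> carrier A \<Longrightarrow> star A (x \<otimes> y) = star A y \<otimes> star A x"
    and star_smult: "x \<in> carrier A \<Longrightarrow> star A (c \<odot> x) = cnj c \<odot> star A x"
begin

lemma smult_zero_left [simp]: assumes "x \<in> carrier A" shows "0 \<odot> x = \<zero>"
proof -
  have "0 \<odot> x \<oplus> 0 \<odot> x = 0 \<odot> x \<oplus> \<zero>"
    using smult_l_distr[OF assms, of 0 0] assms by simp
  then show ?thesis using assms by (metis a_assoc a_inv_closed r_neg r_zero smult_closed)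
qed

lemma smult_minus_one: assumes "x \<in> carrier A" shows "(- 1) \<odot> x = \<ominus> x"
proof -
  have "(- 1) \<odot> x \<oplus> x = \<zero>"
    using smult_l_distr[OF assms, of "-1" 1] assms by simp
  then show ?thesis using assms by (metis minus_equality smult_closed)
qed

lemma smult_zero_right [simp]: "c \<odot> \<zero> = \<zero>"
  using smult_smult[of \<zero> c 0] by simp

lemma minus_eq_smult: "x \<in> carrier A \<Longrightarrow> y \<in> carrier A \<Longrightarrow> x \<ominus> y = x \<oplus> (- 1) \<odot> y"
  by (simp add: a_minus_def smult_minus_one)

lemma star_zero [simp]: "star A \<zero> = \<zero>"
  using star_smult[of \<zero> 0] by simp

lemma star_minus:
  "x \<in> carrier A \<Longrightarrow> y \<in> carrier A \<Longrightarrow> star A (x \<ominus> y) = star A x \<ominus> star A y"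
  by (simp add: minus_eq_smult star_add star_smult)

lemma star_one [simp]: "star A \<one> = \<one>"
  using star_mult[of "star A \<one>" \<one>] by simp

lemma smult_minus:
  "x \<in> carrier A \<Longrightarrow> y \<in> carrier A \<Longrightarrow> c \<odot> (x \<ominus> y) = c \<odot> x \<ominus> c \<odot> y"
  by (simp add: minus_eq_smult smult_r_distr smult_smult)

lemma minus_eq_zero_iff:
  assumes "x \<in> carrier A" "y \<in> carrier A" shows "x \<ominus> y = \<zero> \<longleftrightarrow> x = y"
  using assms by (metis a_minus_def add.inv_solve_right' l_zero minus_closed r_neg zero_closed)

section \<open>Unitary elements\<close>

definition unitary :: "'a \<Rightarrow> bool" where
  "unitary w \<longleftrightarrow> w \<in> carrier A \<and> star A w \<otimes> w = \<one> \<and> w \<otimes> star A w = \<one>"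

lemma unitary_closed [simp]: "unitary w \<Longrightarrow> w \<in> carrier A"
  by (simp add: unitary_def)

lemma unitary_star: "unitary w \<Longrightarrow> unitary (star A w)"
  by (simp add: unitary_def)

lemma unitary_one: "unitary \<one>"
  by (simp add: unitary_def)

lemma unitary_mult:
  assumes "unitary x" "unitary y" shows "unitary (x \<otimes> y)"
proof -
  note [simp] = assms[unfolded unitary_def]
  have "star A y \<otimes> star A x \<otimes> (x \<otimes> y) = star A y \<otimes> (star A x \<otimes> x) \<otimes> y"
    by (simp only: m_assoc assms star_closed unitary_closed m_closed)
  moreover have "x \<otimes> y \<otimes> (star A y \<otimes> star A x) = x \<otimes> (y \<otimes> star A y) \<otimes> star A x"
    by (simp only: m_assoc assms star_closed unitary_closed m_closed)
  ultimately show ?thesis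
    unfolding unitary_def by (simp add: star_mult)
qed

lemma unitary_smult:
  assumes "unitary x" "cmod c = 1" shows "unitary (c \<odot> x)"
proof -
  have c: "c * cnj c = 1"
    using assms(2) by (simp add: complex_norm_square[symmetric])
  have "star A (c \<odot> x) \<otimes> (c \<odot> x) = (c * cnj c) \<odot> (star A x \<otimes> x)"
    "(c \<odot> x) \<otimes> star A (c \<odot> x) = (c * cnj c) \<odot> (x \<otimes> star A x)"
    using unitary_closed[OF assms(1)]
    by (simp_all add: star_smult smult_mult_left smult_mult_right smult_smult mult.commute)
  then show ?thesis using assms(1) unfolding c unitary_def by simp
qed

lemma unitary_left_cancel:
  assumes "unitary w" "a \<in> carrier A"
  shows "star A w \<otimes> (w \<otimes> a) = a" "w \<otimes> (star A w \<otimes> a) = a"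
  using assms by (simp_all add: unitary_def flip: m_assoc)

end

section \<open>C*-seminorms and their elementary inequalities\<close>

locale cstar_seminormed = complex_star_algebra A for A :: "('a, 'm) star_algebra_scheme" (structure) +
  fixes q :: "'a \<Rightarrow> real"
  assumes seminorm: "cstar_seminorm A q"
begin

lemma q_nonneg [simp]: "x \<in> carrier A \<Longrightarrow> 0 \<le> q x"
  and q_add: "x \<in> carrier A \<Longrightarrow> y \<in> carrier A \<Longrightarrow> q (x \<oplus> y) \<le> q x + q y"
  and q_smult: "x \<in> carrier A \<Longrightarrow> q (c \<odot> x) = cmod c * q x"
  and q_mult: "x \<in> carrier A \<Longrightarrow> y \<in> carrier A \<Longrightarrow> q (x \<otimes> y) \<le> q x * q y"
  and q_star_mult: "x \<in> carrier A \<Longrightarrow> q (star A x \<otimes> x) = (q x)\<^sup>2"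
  using seminorm by (auto simp: cstar_seminorm_def)

lemma q_zero [simp]: "q \<zero> = 0"
  using q_smult[of \<zero> 0] by simp

lemma q_diff_commute:
  assumes "x \<in> carrier A" "y \<in> carrier A" shows "q (x \<ominus> y) = q (y \<ominus> x)"
proof -
  have "y \<ominus> x = (-1) \<odot> (x \<ominus> y)"
    using assms by (simp add: minus_eq_smult smult_r_distr smult_smult a_comm)
  then show ?thesis using assms by (simp add: q_smult)
qed

lemma q_diff_self [simp]: "x \<in> carrier A \<Longrightarrow> q (x \<ominus> x) = 0"
  by (simp add: a_minus_def r_neg)

lemma q_diff_triangle:
  assumes "x \<in> carrier A" "y \<in> carrier A" "z \<in> carrier A"
  shows "q (x \<ominus> z) \<le> q (x \<ominus> y) + q (y \<ominus> z)"
proof -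
  have "x \<ominus> z = (x \<ominus> y) \<oplus> (y \<ominus> z)"
    using assms by (simp add: a_minus_def a_assoc r_neg1)
  then show ?thesis using assms q_add by simp
qed

lemma q_triangle_sub:
  assumes "x \<in> carrier A" "y \<in> carrier A" shows "\<bar>q x - q y\<bar> \<le> q (x \<ominus> y)"
  using q_diff_triangle[of x y \<zero>] q_diff_triangle[of y x \<zero>] assms
  by (simp add: minus_eq_smult[of _ \<zero>] q_diff_commute[of y x])

text \<open>The C*-identity and submultiplicativity give
  \<open>q y * q y \<le> q (star A y) * q y\<close>. Cancelling \<open>q y\<close> bounds an element
  by its adjoint, and the adjoint satisfies the same bound.\<close>

lemma q_star [simp]: assumes "x \<in> carrier A" shows "q (star A x) = q x"
proof -
  have le: "q y \<le> q (star A y)" if "y \<in> carrier A" for y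
  proof (cases "q y = 0")
    case False
    then have "q y > 0" using that by (simp add: order_less_le)
    moreover have "q y * q y \<le> q (star A y) * q y"
      using q_star_mult[OF that] q_mult[of "star A y" y] that by (simp add: power2_eq_square)
    ultimately show ?thesis by (simp add: mult_le_cancel_right)
  qed (use that in simp)
  from le[OF assms] le[of "star A x"] assms show ?thesis by simp
qed

text \<open>By the C*-identity the value at the unit equals its own square, hence is 0 or 1. The
  value 0 occurs for the zero seminorm, so in general only the inequality holds.\<close>

lemma q_one_le: "q \<one> \<le> 1"
proof -
  have "(q \<one>)\<^sup>2 = q \<one>" using q_star_mult[of \<one>] by simp
  then show ?thesis by (cases "q \<one> = 0") (auto simp: power2_eq_square)
qed

lemma q_unitary_le:
  assumes "unitary w" shows "q w \<le> 1"
proof -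
  have "(q w)\<^sup>2 = q \<one>" using q_star_mult[of w] assms by (simp add: unitary_def)
  then have "(q w)\<^sup>2 \<le> 1" using q_one_le by simp
  then show ?thesis using abs_square_le_1[of "q w"] by simp
qed

text \<open>For a selfadjoint element the C*-identity turns squaring into squaring of the seminorm,
  so repeated doubling yields the exponents \<open>2 ^ m\<close>. These are enough for a limiting
  argument over high powers.\<close>

lemma q_power_selfadjoint:
  assumes "x \<in> carrier A" "star A x = x"
  shows "q (x [^] (2 ^ m :: nat)) = q x ^ (2 ^ m)"
proof -
  have sa: "star A (x [^] n) = x [^] n" for n :: nat
  proof (induction n)
    case (Suc n)
    then have "star A (x [^] Suc n) = x \<otimes> x [^] n"
      using assms by (simp add: star_mult)
    then show ?case using assms(1) by (simp only: nat_pow_Suc2)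
  qed (use assms in simp)
  show ?thesis
  proof (induction m)
    case (Suc m)
    have "x [^] (2 ^ Suc m :: nat) = star A (x [^] (2 ^ m :: nat)) \<otimes> x [^] (2 ^ m :: nat)"
      using assms by (simp add: sa nat_pow_mult mult_2)
    then show ?case using assms Suc by (simp add: q_star_mult mult_2 power_add power2_eq_square)
  qed (use assms in simp)
qed

section \<open>Cauchy sequences and asymptotic equality\<close>

lemma cauchy_seqs_iff:
  "x \<in> cauchy_seqs A q \<longleftrightarrow>
     (\<forall>n. x n \<in> carrier A) \<and> (\<forall>e>0. \<exists>N. \<forall>m\<ge>N. \<forall>n\<ge>N. q (x m \<ominus> x n) < e)"
  by (simp add: cauchy_seqs_def)

lemma cauchy_closed [simp]: "x \<in> cauchy_seqs A q \<Longrightarrow> x n \<in> carrier A"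
  by (simp add: cauchy_seqs_iff)

text \<open>Convergence to a is expressed as asymptotic equality with the constant sequence a, so
  the same closure rules serve for limits and for the classes of a completion.\<close>

definition asymp :: "(nat \<Rightarrow> 'a) \<Rightarrow> (nat \<Rightarrow> 'a) \<Rightarrow> bool" where
  "asymp x y \<longleftrightarrow> (\<lambda>n. q (x n \<ominus> y n)) \<longlonglongrightarrow> 0"

lemma asympI:
  assumes "\<And>n. x n \<in> carrier A" "\<And>n. y n \<in> carrier A"
    and "\<And>n. q (x n \<ominus> y n) \<le> b n" "b \<longlonglongrightarrow> 0"
  shows "asymp x y"
  unfolding asymp_def
  by (rule tendsto_sandwich[OF _ _ tendsto_const assms(4)]) (use assms in auto)

lemma asymp_refl: "(\<And>n. x n \<in> carrier A) \<Longrightarrow> asymp x x"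
  by (simp add: asymp_def)

lemma asymp_sym:
  "(\<And>n. x n \<in> carrier A) \<Longrightarrow> (\<And>n. y n \<in> carrier A) \<Longrightarrow> asymp x y \<Longrightarrow> asymp y x"
  by (simp add: asymp_def q_diff_commute[of "y _"])

lemma asymp_trans:
  assumes "\<And>n. x n \<in> carrier A" "\<And>n. y n \<in> carrier A" "\<And>n. z n \<in> carrier A"
    and "asymp x y" "asymp y z"
  shows "asymp x z"
  using tendsto_add[OF assms(4,5)[unfolded asymp_def]] assms(1-3)
  by (intro asympI[where b="\<lambda>n. q (x n \<ominus> y n) + q (y n \<ominus> z n)"]) (auto intro: q_diff_triangle)

lemma asymp_add:
  assumes "\<And>n. x n \<in> carrier A" "\<And>n. y n \<in> carrier A" "\<And>n. x' n \<in> carrier A" "\<And>n. y' n \<in> carrier A"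
    and "asymp x x'" "asymp y y'"
  shows "asymp (\<lambda>n. x n \<oplus> y n) (\<lambda>n. x' n \<oplus> y' n)"
proof -
  have "q ((x n \<oplus> y n) \<ominus> (x' n \<oplus> y' n)) \<le> q (x n \<ominus> x' n) + q (y n \<ominus> y' n)" for n
  proof -
    have "(x n \<oplus> y n) \<ominus> (x' n \<oplus> y' n) = (x n \<ominus> x' n) \<oplus> (y n \<ominus> y' n)"
      using assms(1-4) by (simp add: a_minus_def minus_add a_ac)
    then show ?thesis using assms(1-4) q_add by simp
  qed
  then show ?thesis using tendsto_add[OF assms(5,6)[unfolded asymp_def]] assms(1-4)
    by (intro asympI[where b="\<lambda>n. q (x n \<ominus> x' n) + q (y n \<ominus> y' n)"]) auto
qed

lemma asymp_smult:
  assumes "\<And>n. x n \<in> carrier A" "\<And>n. x' n \<in> carrier A" "asymp x x'"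
  shows "asymp (\<lambda>n. c \<odot> x n) (\<lambda>n. c \<odot> x' n)"
  using tendsto_mult_right_zero[OF assms(3)[unfolded asymp_def], of "cmod c"] assms(1,2)
  by (simp add: asymp_def q_smult flip: smult_minus)

lemma asymp_star:
  assumes "\<And>n. x n \<in> carrier A" "\<And>n. x' n \<in> carrier A" "asymp x x'"
  shows "asymp (\<lambda>n. star A (x n)) (\<lambda>n. star A (x' n))"
  using assms by (simp add: asymp_def flip: star_minus)

text \<open>Inserting the mixed term \<open>x \<otimes> y'\<close> splits the difference into x (y -
  y') and (x - x') y'. This is why products of sequences need bounds for \<open>x\<close> and for
  \<open>y'\<close>.\<close>

lemma q_mult_diff:
  assumes "x \<in> carrier A" "y \<in> carrier A" "x' \<in> carrier A" "y' \<in> carrier A"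
  shows "q (x \<otimes> y \<ominus> x' \<otimes> y') \<le> q x * q (y \<ominus> y') + q (x \<ominus> x') * q y'"
proof -
  have "x \<otimes> y \<ominus> x' \<otimes> y' = x \<otimes> (y \<ominus> y') \<oplus> (x \<ominus> x') \<otimes> y'"
    using assms by (simp add: a_minus_def l_distr r_distr r_minus l_minus a_assoc r_neg1)
  also have "q \<dots> \<le> q (x \<otimes> (y \<ominus> y')) + q ((x \<ominus> x') \<otimes> y')" using assms q_add by simp
  also have "\<dots> \<le> q x * q (y \<ominus> y') + q (x \<ominus> x') * q y'"
    using assms by (intro add_mono q_mult) auto
  finally show ?thesis .
qed

lemma asymp_mult:
  assumes "\<And>n. x n \<in> carrier A" "\<And>n. y n \<in> carrier A" "\<And>n. x' n \<in> carrier A" "\<And>n. y' n \<in> carrier A"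
    and "asymp x x'" "asymp y y'" and B: "\<And>n. q (x n) \<le> B" "\<And>n. q (y' n) \<le> C"
  shows "asymp (\<lambda>n. x n \<otimes> y n) (\<lambda>n. x' n \<otimes> y' n)"
proof (rule asympI[where b="\<lambda>n. B * q (y n \<ominus> y' n) + q (x n \<ominus> x' n) * C"])
  fix n
  show "q (x n \<otimes> y n \<ominus> x' n \<otimes> y' n) \<le> B * q (y n \<ominus> y' n) + q (x n \<ominus> x' n) * C"
    by (rule order_trans[OF q_mult_diff add_mono[OF mult_right_mono mult_left_mono]])
      (use assms in auto)
  show "(\<lambda>n. B * q (y n \<ominus> y' n) + q (x n \<ominus> x' n) * C) \<longlonglongrightarrow> 0"
    using tendsto_add[OF tendsto_mult_right_zero[OF assms(6)[unfolded asymp_def], of B]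
        tendsto_mult_left_zero[OF assms(5)[unfolded asymp_def], of C]] by simp
qed (use assms in auto)

lemma cauchy_bounded:
  assumes "x \<in> cauchy_seqs A q"
  obtains B where "\<And>n. q (x n) \<le> B" "0 \<le> B"
proof -
  obtain N where N: "\<And>m n. m \<ge> N \<Longrightarrow> n \<ge> N \<Longrightarrow> q (x m \<ominus> x n) < 1"
    using assms by (metis cauchy_seqs_iff zero_less_one)
  define B where "B = Max ((\<lambda>n. q (x n)) ` {..N}) + 1"
  have B: "q (x n) \<le> B - 1" if "n \<le> N" for n
    using that by (auto simp: B_def intro!: Max_ge)
  have "q (x n) \<le> B" for n
  proof (cases "n \<le> N")
    case False
    then have "q (x n) \<le> q (x N) + 1"
      using N[of n N] q_triangle_sub[of "x n" "x N"] assms by auto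
    then show ?thesis using B[of N] by simp
  qed (use B[of n] in simp)
  moreover from this[of 0] have "0 \<le> B" using q_nonneg[of "x 0"] assms by (meson cauchy_closed order_trans)
  ultimately show thesis using that by blast
qed

lemma cauchy_asympI:
  assumes "x \<in> cauchy_seqs A q" "\<And>n. y n \<in> carrier A" "asymp x y"
  shows "y \<in> cauchy_seqs A q"
  unfolding cauchy_seqs_iff
proof (intro conjI allI impI)
  fix e :: real assume "e > 0"
  then obtain N1 where N1: "\<And>m n. m \<ge> N1 \<Longrightarrow> n \<ge> N1 \<Longrightarrow> q (x m \<ominus> x n) < e/3"
    using assms(1) by (metis cauchy_seqs_iff zero_less_divide_iff zero_less_numeral)
  have "\<forall>\<^sub>F n in sequentially. q (x n \<ominus> y n) < e/3"
    using \<open>e > 0\<close> by (intro order_tendstoD(2)[OF assms(3)[unfolded asymp_def]]) simp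
  then obtain N2 where N2: "\<And>n. n \<ge> N2 \<Longrightarrow> q (x n \<ominus> y n) < e/3"
    by (auto simp: eventually_sequentially)
  have "q (y m \<ominus> y n) < e" if "m \<ge> max N1 N2" "n \<ge> max N1 N2" for m n
    using N1[of m n] N2[of m] N2[of n] that assms q_diff_triangle[of "y m" "x m" "y n"]
      q_diff_triangle[of "x m" "x n" "y n"] q_diff_commute[of "x m" "y m"] by auto
  then show "\<exists>N. \<forall>m\<ge>N. \<forall>n\<ge>N. q (y m \<ominus> y n) < e" by blast
qed (use assms in auto)

lemma cauchy_const: "a \<in> carrier A \<Longrightarrow> (\<lambda>n. a) \<in> cauchy_seqs A q"
  by (auto simp: cauchy_seqs_iff)

lemma convergent_cauchy:
  assumes "\<And>n. x n \<in> carrier A" "a \<in> carrier A" "asymp x (\<lambda>n. a)"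
  shows "x \<in> cauchy_seqs A q"
  using cauchy_asympI[OF cauchy_const, of a x] asymp_sym[of x "\<lambda>n. a"] assms by simp

text \<open>One Lipschitz estimate in two Cauchy sequences covers all four operations. For the unary
  ones the second constant is 0; for products the constants are bounds of the two sequences.\<close>

lemma cauchy_isometryI:
  assumes x: "x \<in> cauchy_seqs A q" and y: "y \<in> cauchy_seqs A q" and "\<And>n. z n \<in> carrier A"
    and B: "0 \<le> B" "0 \<le> C"
    and le: "\<And>m n. q (z m \<ominus> z n) \<le> B * q (x m \<ominus> x n) + C * q (y m \<ominus> y n)"
  shows "z \<in> cauchy_seqs A q"
  unfolding cauchy_seqs_iff
proof (intro conjI allI impI)
  fix e :: real assume "e > 0"
  \<comment> \<open>The constants may be 0, hence the denominators with B + 1 and C + 1.\<close>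
  then have e': "e / (2 * (B + 1)) > 0" "e / (2 * (C + 1)) > 0" using B by auto
  obtain N1 where N1: "\<And>m n. m \<ge> N1 \<Longrightarrow> n \<ge> N1 \<Longrightarrow> q (x m \<ominus> x n) < e / (2 * (B + 1))"
    using x e' by (metis cauchy_seqs_iff)
  obtain N2 where N2: "\<And>m n. m \<ge> N2 \<Longrightarrow> n \<ge> N2 \<Longrightarrow> q (y m \<ominus> y n) < e / (2 * (C + 1))"
    using y e' by (metis cauchy_seqs_iff)
  have "q (z m \<ominus> z n) < e" if "m \<ge> max N1 N2" "n \<ge> max N1 N2" for m n
  proof -
    have "B * q (x m \<ominus> x n) \<le> B * (e / (2 * (B + 1)))"
      using N1[of m n] that B by (intro mult_left_mono) auto
    also have "\<dots> < e/2" using B \<open>e > 0\<close> by (simp add: field_simps)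
    finally have 1: "B * q (x m \<ominus> x n) < e/2" .
    have "C * q (y m \<ominus> y n) \<le> C * (e / (2 * (C + 1)))"
      using N2[of m n] that B by (intro mult_left_mono) auto
    also have "\<dots> < e/2" using B \<open>e > 0\<close> by (simp add: field_simps)
    finally show ?thesis using 1 le[of m n] by linarith
  qed
  then show "\<exists>N. \<forall>m\<ge>N. \<forall>n\<ge>N. q (z m \<ominus> z n) < e" by blast
qed (use assms in auto)

lemma cauchy_add:
  assumes "x \<in> cauchy_seqs A q" "y \<in> cauchy_seqs A q"
  shows "(\<lambda>n. x n \<oplus> y n) \<in> cauchy_seqs A q"
proof (rule cauchy_isometryI[OF assms, of _ 1 1])
  fix m n
  have "(x m \<oplus> y m) \<ominus> (x n \<oplus> y n) = (x m \<ominus> x n) \<oplus> (y m \<ominus> y n)"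
    using assms by (simp add: a_minus_def minus_add a_ac)
  then show "q ((x m \<oplus> y m) \<ominus> (x n \<oplus> y n)) \<le> 1 * q (x m \<ominus> x n) + 1 * q (y m \<ominus> y n)"
    using assms q_add by simp
qed (use assms in auto)

lemma cauchy_smult: "x \<in> cauchy_seqs A q \<Longrightarrow> (\<lambda>n. c \<odot> x n) \<in> cauchy_seqs A q"
  by (rule cauchy_isometryI[where B="cmod c" and C=0 and x=x and y=x])
     (auto simp: q_smult simp flip: smult_minus)

lemma cauchy_star: "x \<in> cauchy_seqs A q \<Longrightarrow> (\<lambda>n. star A (x n)) \<in> cauchy_seqs A q"
  by (rule cauchy_isometryI[where B=1 and C=0 and x=x and y=x])
     (auto simp flip: star_minus)

lemma cauchy_mult:
  assumes "x \<in> cauchy_seqs A q" "y \<in> cauchy_seqs A q"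
  shows "(\<lambda>n. x n \<otimes> y n) \<in> cauchy_seqs A q"
proof -
  obtain B where B: "\<And>n. q (x n) \<le> B" "0 \<le> B" using cauchy_bounded[OF assms(1)] by blast
  obtain C where C: "\<And>n. q (y n) \<le> C" "0 \<le> C" using cauchy_bounded[OF assms(2)] by blast
  show ?thesis
  proof (rule cauchy_isometryI[OF assms, of _ C B])
    fix m n
    have "q (x m \<otimes> y m \<ominus> x n \<otimes> y n) \<le> q (x m) * q (y m \<ominus> y n) + q (x m \<ominus> x n) * q (y n)"
      using assms by (intro q_mult_diff) auto
    also have "\<dots> \<le> B * q (y m \<ominus> y n) + q (x m \<ominus> x n) * C"
      using assms B C by (intro add_mono mult_right_mono mult_left_mono) auto
    finally show "q (x m \<otimes> y m \<ominus> x n \<otimes> y n) \<le> C * q (x m \<ominus> x n) + B * q (y m \<ominus> y n)"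
      by (simp add: mult.commute)
  qed (use assms B C in auto)
qed

end

section \<open>C*-algebras: definiteness, completeness and limits\<close>

locale cstar_algebra = cstar_seminormed A "cnorm A"
  for A :: "('a, 'm) normed_star_algebra_scheme" (structure) +
  assumes norm_eq_zeroD: "x \<in> carrier A \<Longrightarrow> cnorm A x = 0 \<Longrightarrow> x = \<zero>"
    and complete: "s \<in> cauchy_seqs A (cnorm A) \<Longrightarrow>
      \<exists>a\<in>carrier A. (\<lambda>n. cnorm A (s n \<ominus> a)) \<longlonglongrightarrow> 0"
begin

lemma cauchy_convergent:
  assumes "x \<in> cauchy_seqs A (cnorm A)"
  obtains a where "a \<in> carrier A" "asymp x (\<lambda>n. a)"
  using complete[OF assms] by (auto simp: asymp_def)

lemma eqI:
  assumes "a \<in> carrier A" "b \<in> carrier A" "cnorm A (a \<ominus> b) = 0"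
  shows "a = b"
  using norm_eq_zeroD[of "a \<ominus> b"] assms by (simp add: minus_eq_zero_iff)

lemma limit_unique:
  assumes "\<And>n. x n \<in> carrier A" "a \<in> carrier A" "b \<in> carrier A"
    and "asymp x (\<lambda>n. a)" "asymp x (\<lambda>n. b)"
  shows "a = b"
proof -
  have "asymp (\<lambda>n. a) (\<lambda>n. b)"
    using assms asymp_sym[of x "\<lambda>n. a"] asymp_trans[of "\<lambda>n. a" x "\<lambda>n. b"] by simp
  then have "cnorm A (a \<ominus> b) = 0" by (simp add: asymp_def LIMSEQ_const_iff)
  then show ?thesis using assms eqI by blast
qed

end

section \<open>*-homomorphisms\<close>

lemma star_hom_closed: "star_hom A B \<phi> \<Longrightarrow> x \<in> carrier A \<Longrightarrow> \<phi> x \<in> carrier B"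
  and star_hom_mult: "star_hom A B \<phi> \<Longrightarrow> x \<in> carrier A \<Longrightarrow> y \<in> carrier A \<Longrightarrow>
    \<phi> (x \<otimes>\<^bsub>A\<^esub> y) = \<phi> x \<otimes>\<^bsub>B\<^esub> \<phi> y"
  and star_hom_add: "star_hom A B \<phi> \<Longrightarrow> x \<in> carrier A \<Longrightarrow> y \<in> carrier A \<Longrightarrow>
    \<phi> (x \<oplus>\<^bsub>A\<^esub> y) = \<phi> x \<oplus>\<^bsub>B\<^esub> \<phi> y"
  and star_hom_one: "star_hom A B \<phi> \<Longrightarrow> \<phi> \<one>\<^bsub>A\<^esub> = \<one>\<^bsub>B\<^esub>"
  and star_hom_smult: "star_hom A B \<phi> \<Longrightarrow> x \<in> carrier A \<Longrightarrow> \<phi> (c \<odot>\<^bsub>A\<^esub> x) = c \<odot>\<^bsub>B\<^esub> \<phi> x"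
  and star_hom_star: "star_hom A B \<phi> \<Longrightarrow> x \<in> carrier A \<Longrightarrow> \<phi> (star A x) = star B (\<phi> x)"
  by (auto simp: star_hom_def ring_hom_closed ring_hom_mult ring_hom_add ring_hom_one)

lemma star_homI:
  assumes "\<And>x. x \<in> carrier A \<Longrightarrow> \<phi> x \<in> carrier B"
    and "\<And>x y. x \<in> carrier A \<Longrightarrow> y \<in> carrier A \<Longrightarrow> \<phi> (x \<otimes>\<^bsub>A\<^esub> y) = \<phi> x \<otimes>\<^bsub>B\<^esub> \<phi> y"
    and "\<And>x y. x \<in> carrier A \<Longrightarrow> y \<in> carrier A \<Longrightarrow> \<phi> (x \<oplus>\<^bsub>A\<^esub> y) = \<phi> x \<oplus>\<^bsub>B\<^esub> \<phi> y"
    and "\<phi> \<one>\<^bsub>A\<^esub> = \<one>\<^bsub>B\<^esub>"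
    and "\<And>c x. x \<in> carrier A \<Longrightarrow> \<phi> (c \<odot>\<^bsub>A\<^esub> x) = c \<odot>\<^bsub>B\<^esub> \<phi> x"
    and "\<And>x. x \<in> carrier A \<Longrightarrow> \<phi> (star A x) = star B (\<phi> x)"
  shows "star_hom A B \<phi>"
  using assms by (auto simp: star_hom_def intro!: ring_hom_memI)

lemma star_hom_comp:
  "star_hom A B \<phi> \<Longrightarrow> star_hom B C \<psi> \<Longrightarrow> star_hom A C (\<lambda>x. \<psi> (\<phi> x))"
  by (rule star_homI)
    (auto simp: star_hom_closed star_hom_mult star_hom_add star_hom_one star_hom_smult star_hom_star)

text \<open>Automorphisms are extensional, so maps built as plain composites or inverses are
  replaced by \<open>compose\<close> or \<open>restrict\<close> versions, which agree with them on
  the carrier only.\<close>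

lemma star_hom_cong:
  assumes "complex_star_algebra A" "star_hom A B \<phi>" "\<And>x. x \<in> carrier A \<Longrightarrow> \<phi> x = \<psi> x"
  shows "star_hom A B \<psi>"
proof -
  interpret complex_star_algebra A by fact
  show ?thesis
    by (rule star_homI) (use assms(2) in \<open>simp_all add: assms(3)[symmetric]
      star_hom_closed star_hom_mult star_hom_add star_hom_one star_hom_smult star_hom_star\<close>)
qed

lemma star_hom_minus:
  assumes "complex_star_algebra A" "complex_star_algebra B" "star_hom A B \<phi>"
    and "x \<in> carrier A" "y \<in> carrier A"
  shows "\<phi> (x \<ominus>\<^bsub>A\<^esub> y) = \<phi> x \<ominus>\<^bsub>B\<^esub> \<phi> y"
proof -
  interpret A: complex_star_algebra A by fact
  interpret B: complex_star_algebra B by fact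
  show ?thesis using assms(3-)
    by (simp add: A.minus_eq_smult B.minus_eq_smult star_hom_closed star_hom_add star_hom_smult)
qed

lemma star_hom_unitary:
  assumes "complex_star_algebra A" "complex_star_algebra B" "star_hom A B \<phi>"
    and "complex_star_algebra.unitary A w"
  shows "complex_star_algebra.unitary B (\<phi> w)"
proof -
  interpret A: complex_star_algebra A by fact
  interpret B: complex_star_algebra B by fact
  show ?thesis using assms(4) unfolding A.unitary_def B.unitary_def
    using star_hom_mult[OF assms(3), of "star A w" w] star_hom_mult[OF assms(3), of w "star A w"]
    by (simp add: star_hom_closed[OF assms(3)] star_hom_one[OF assms(3)] star_hom_star[OF assms(3)])
qed

text \<open>The C*-identity of the pullback evaluates \<open>\<phi>\<close> at
  \<open>star A x \<otimes> x\<close>, which is why closure under \<open>star\<close> is required of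
  A. In this form the lemma also applies to twisted convolution algebras.\<close>

lemma pullback_cstar_seminorm:
  assumes "\<And>x. x \<in> carrier A \<Longrightarrow> star A x \<in> carrier A" "star_hom A B \<phi>" "cstar_seminorm B q"
  shows "cstar_seminorm A (\<lambda>x. q (\<phi> x))"
  using assms unfolding cstar_seminorm_def
  by (simp add: star_hom_closed star_hom_mult star_hom_add star_hom_one star_hom_smult star_hom_star)

section \<open>Completions\<close>

lemma completion_carrier: "carrier (completion D q) = seq_class D q ` cauchy_seqs D q"
  by (auto simp: completion_def quotient_def seq_class_def)

context cstar_seminormed
begin

lemma null_rel_iff:
  "(x, y) \<in> null_rel A q \<longleftrightarrow> x \<in> cauchy_seqs A q \<and> y \<in> cauchy_seqs A q \<and> asymp x y"
  by (simp add: null_rel_def asymp_def)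

lemma equiv_null_rel: "equiv (cauchy_seqs A q) (null_rel A q)"
proof (rule equivI)
  show "refl_on (cauchy_seqs A q) (null_rel A q)"
    by (auto simp: refl_on_def null_rel_iff intro: asymp_refl)
  show "sym (null_rel A q)"
    by (rule symI) (auto simp: null_rel_iff intro: asymp_sym)
  show "trans (null_rel A q)"
    by (rule transI) (meson asymp_trans cauchy_closed null_rel_iff)
qed (auto simp: null_rel_def)

lemma seq_class_eq_iff:
  "x \<in> cauchy_seqs A q \<Longrightarrow> y \<in> cauchy_seqs A q \<Longrightarrow> seq_class A q x = seq_class A q y \<longleftrightarrow> asymp x y"
  by (simp add: seq_class_def eq_equiv_class_iff[OF equiv_null_rel] null_rel_iff)

lemma mem_seq_class_iff:
  "y \<in> seq_class A q x \<longleftrightarrow> x \<in> cauchy_seqs A q \<and> y \<in> cauchy_seqs A q \<and> asymp x y"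
  by (simp add: seq_class_def null_rel_iff)

lemma self_mem_seq_class: "x \<in> cauchy_seqs A q \<Longrightarrow> x \<in> seq_class A q x"
  by (simp add: mem_seq_class_iff asymp_refl)

lemma seq_class_closed: "x \<in> cauchy_seqs A q \<Longrightarrow> seq_class A q x \<in> carrier (completion A q)"
  by (simp add: completion_carrier)

lemma completion_one: "\<one>\<^bsub>completion A q\<^esub> = seq_class A q (\<lambda>n. \<one>)"
  and completion_zero: "\<zero>\<^bsub>completion A q\<^esub> = seq_class A q (\<lambda>n. \<zero>)"
  by (simp_all add: completion_def)

text \<open>In the completion the product of two classes is a union over all pairs of
  representatives. By \<open>asymp_mult\<close> all members of this union are the same class, and
  the union is inhabited because a sequence belongs to its own class.\<close>

lemma completion_mult:
  assumes x: "x \<in> cauchy_seqs A q" and y: "y \<in> cauchy_seqs A q"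
  shows "seq_class A q x \<otimes>\<^bsub>completion A q\<^esub> seq_class A q y = seq_class A q (\<lambda>n. x n \<otimes> y n)"
proof -
  have "seq_class A q (\<lambda>n. x' n \<otimes> y' n) = seq_class A q (\<lambda>n. x n \<otimes> y n)"
    if "x' \<in> seq_class A q x" "y' \<in> seq_class A q y" for x' y'
  proof -
    have c: "x' \<in> cauchy_seqs A q" "y' \<in> cauchy_seqs A q" "asymp x x'" "asymp y y'"
      using that by (auto simp: mem_seq_class_iff)
    obtain B where "\<And>n. q (x n) \<le> B" using cauchy_bounded[OF x] by blast
    moreover obtain C where "\<And>n. q (y' n) \<le> C" using cauchy_bounded[OF c(2)] by blast
    ultimately have "asymp (\<lambda>n. x n \<otimes> y n) (\<lambda>n. x' n \<otimes> y' n)"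
      using assms c by (intro asymp_mult) auto
    then show ?thesis using assms c by (metis cauchy_mult seq_class_eq_iff)
  qed
  then have "(\<Union>x'\<in>seq_class A q x. \<Union>y'\<in>seq_class A q y. seq_class A q (\<lambda>n. x' n \<otimes> y' n)) =
      seq_class A q (\<lambda>n. x n \<otimes> y n)"
    using self_mem_seq_class[OF x] self_mem_seq_class[OF y] by blast
  then show ?thesis by (simp add: completion_def)
qed

lemma completion_add:
  assumes x: "x \<in> cauchy_seqs A q" and y: "y \<in> cauchy_seqs A q"
  shows "seq_class A q x \<oplus>\<^bsub>completion A q\<^esub> seq_class A q y = seq_class A q (\<lambda>n. x n \<oplus> y n)"
proof -
  have "seq_class A q (\<lambda>n. x' n \<oplus> y' n) = seq_class A q (\<lambda>n. x n \<oplus> y n)"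
    if "x' \<in> seq_class A q x" "y' \<in> seq_class A q y" for x' y'
  proof -
    have c: "x' \<in> cauchy_seqs A q" "y' \<in> cauchy_seqs A q" "asymp x x'" "asymp y y'"
      using that by (auto simp: mem_seq_class_iff)
    have "asymp (\<lambda>n. x n \<oplus> y n) (\<lambda>n. x' n \<oplus> y' n)"
      using assms c by (intro asymp_add) auto
    then show ?thesis using assms c by (metis cauchy_add seq_class_eq_iff)
  qed
  then have "(\<Union>x'\<in>seq_class A q x. \<Union>y'\<in>seq_class A q y. seq_class A q (\<lambda>n. x' n \<oplus> y' n)) =
      seq_class A q (\<lambda>n. x n \<oplus> y n)"
    using self_mem_seq_class[OF x] self_mem_seq_class[OF y] by blast
  then show ?thesis by (simp add: completion_def)
qed

lemma completion_smult:
  assumes x: "x \<in> cauchy_seqs A q"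
  shows "c \<odot>\<^bsub>completion A q\<^esub> seq_class A q x = seq_class A q (\<lambda>n. c \<odot> x n)"
proof -
  have "seq_class A q (\<lambda>n. c \<odot> x' n) = seq_class A q (\<lambda>n. c \<odot> x n)"
    if "x' \<in> seq_class A q x" for x'
    using that assms by (auto simp: mem_seq_class_iff seq_class_eq_iff cauchy_smult
        intro!: asymp_smult asymp_sym[of x])
  then have "(\<Union>x'\<in>seq_class A q x. seq_class A q (\<lambda>n. c \<odot> x' n)) = seq_class A q (\<lambda>n. c \<odot> x n)"
    using self_mem_seq_class[OF x] by blast
  then show ?thesis by (simp add: completion_def)
qed

lemma completion_star:
  assumes x: "x \<in> cauchy_seqs A q"
  shows "star (completion A q) (seq_class A q x) = seq_class A q (\<lambda>n. star A (x n))"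
proof -
  have "seq_class A q (\<lambda>n. star A (x' n)) = seq_class A q (\<lambda>n. star A (x n))"
    if "x' \<in> seq_class A q x" for x'
    using that assms by (auto simp: mem_seq_class_iff seq_class_eq_iff cauchy_star
        intro!: asymp_star asymp_sym[of x])
  then have "(\<Union>x'\<in>seq_class A q x. seq_class A q (\<lambda>n. star A (x' n))) =
      seq_class A q (\<lambda>n. star A (x n))"
    using self_mem_seq_class[OF x] by blast
  then show ?thesis by (simp add: completion_def)
qed

lemma cauchy_q_convergent:
  assumes "x \<in> cauchy_seqs A q"
  shows "\<exists>r. (\<lambda>n. q (x n)) \<longlonglongrightarrow> r"
proof -
  have "Cauchy (\<lambda>n. q (x n))"
    unfolding Cauchy_def dist_real_def
  proof (intro allI impI)
    fix e :: real assume "e > 0"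
    then obtain N where "\<And>m n. m \<ge> N \<Longrightarrow> n \<ge> N \<Longrightarrow> q (x m \<ominus> x n) < e"
      using assms by (metis cauchy_seqs_iff)
    then show "\<exists>M. \<forall>m\<ge>M. \<forall>n\<ge>M. \<bar>q (x m) - q (x n)\<bar> < e"
      using q_triangle_sub assms by (meson cauchy_closed le_less_trans)
  qed
  then show ?thesis by (simp add: real_Cauchy_convergent convergentD)
qed

text \<open>The definite description in \<open>cnorm\<close> asks for a limit along some
  representative. Asymptotically equal sequences have the same limit by the reverse triangle
  inequality.\<close>

lemma completion_norm:
  assumes x: "x \<in> cauchy_seqs A q"
  shows "(\<lambda>n. q (x n)) \<longlonglongrightarrow> cnorm (completion A q) (seq_class A q x)"
proof -
  obtain r where r: "(\<lambda>n. q (x n)) \<longlonglongrightarrow> r" using cauchy_q_convergent[OF x] ..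
  have "s = r" if "x' \<in> seq_class A q x" "(\<lambda>n. q (x' n)) \<longlonglongrightarrow> s" for x' s
  proof -
    have c: "x' \<in> cauchy_seqs A q" "asymp x x'" using that by (auto simp: mem_seq_class_iff)
    have "(\<lambda>n. \<bar>q (x n) - q (x' n)\<bar>) \<longlonglongrightarrow> 0"
      by (rule tendsto_sandwich[OF _ _ tendsto_const c(2)[unfolded asymp_def]])
        (use assms c q_triangle_sub in auto)
    then have "(\<lambda>n. q (x n) - q (x' n)) \<longlonglongrightarrow> 0" by (simp add: tendsto_rabs_zero_iff)
    moreover have "(\<lambda>n. q (x n) - q (x' n)) \<longlonglongrightarrow> r - s" using r that(2) by (rule tendsto_diff)
    ultimately show ?thesis using LIMSEQ_unique by fastforce
  qed
  then have "(THE r. \<exists>x\<in>seq_class A q x. (\<lambda>n. q (x n)) \<longlonglongrightarrow> r) = r"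
    using self_mem_seq_class[OF x] r by (intro the_equality) blast+
  then show ?thesis using r by (simp add: completion_def)
qed

lemma completion_norm_const:
  assumes "a \<in> carrier A"
  shows "cnorm (completion A q) (seq_class A q (\<lambda>n. a)) = q a"
  using completion_norm[OF cauchy_const[OF assms]] by (simp add: LIMSEQ_const_iff)

lemma completion_complex_star_algebra: "complex_star_algebra (completion A q)"
proof -
  note [simp] = completion_carrier completion_one completion_zero completion_mult completion_add
    completion_smult completion_star cauchy_mult cauchy_add cauchy_smult cauchy_star
    cauchy_const[OF one_closed] cauchy_const[OF zero_closed]
  have "ring (completion A q)"
  proof (rule ringI)
    show "abelian_group (completion A q)"
    proof (rule abelian_groupI)
      fix X assume "X \<in> carrier (completion A q)"
      then obtain x where x: "x \<in> cauchy_seqs A q" "X = seq_class A q x" by auto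
      have "(\<lambda>n. (- 1) \<odot> x n \<oplus> x n) = (\<lambda>n. \<zero>)"
        using x by (simp add: smult_minus_one l_neg)
      then show "\<exists>Y\<in>carrier (completion A q). Y \<oplus>\<^bsub>completion A q\<^esub> X = \<zero>\<^bsub>completion A q\<^esub>"
        using x by (auto intro!: bexI[of _ "\<lambda>n. (- 1) \<odot> x n"])
    qed (auto simp: a_ac)
    show "monoid (completion A q)" by (rule monoidI) (auto simp: m_assoc)
  qed (auto simp: l_distr r_distr)
  then interpret C: ring "completion A q" .
  show ?thesis
    by unfold_locales (auto simp: smult_l_distr smult_r_distr smult_smult smult_mult_left
      smult_mult_right star_add star_mult star_smult)
qed

lemma completion_minus:
  assumes "x \<in> cauchy_seqs A q" "y \<in> cauchy_seqs A q"
  shows "seq_class A q x \<ominus>\<^bsub>completion A q\<^esub> seq_class A q y = seq_class A q (\<lambda>n. x n \<ominus> y n)"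
proof -
  interpret C: complex_star_algebra "completion A q" by (rule completion_complex_star_algebra)
  show ?thesis
    using assms by (simp add: C.minus_eq_smult minus_eq_smult seq_class_closed completion_smult
        completion_add cauchy_smult)
qed

lemma completion_cstar_seminorm: "cstar_seminorm (completion A q) (cnorm (completion A q))"
proof -
  have "0 \<le> cnorm (completion A q) (seq_class A q x)" if "x \<in> cauchy_seqs A q" for x
    using completion_norm[OF that] that by (intro LIMSEQ_le_const[OF completion_norm]) auto
  moreover have "cnorm (completion A q) (seq_class A q x \<oplus>\<^bsub>completion A q\<^esub> seq_class A q y)
      \<le> cnorm (completion A q) (seq_class A q x) + cnorm (completion A q) (seq_class A q y)"
    if "x \<in> cauchy_seqs A q" "y \<in> cauchy_seqs A q" for x y
    unfolding completion_add[OF that]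
    by (rule LIMSEQ_le[OF completion_norm[OF cauchy_add] tendsto_add[OF completion_norm completion_norm]])
      (use that q_add in auto)
  moreover have "cnorm (completion A q) (seq_class A q x \<otimes>\<^bsub>completion A q\<^esub> seq_class A q y)
      \<le> cnorm (completion A q) (seq_class A q x) * cnorm (completion A q) (seq_class A q y)"
    if "x \<in> cauchy_seqs A q" "y \<in> cauchy_seqs A q" for x y
    unfolding completion_mult[OF that]
    by (rule LIMSEQ_le[OF completion_norm[OF cauchy_mult] tendsto_mult[OF completion_norm completion_norm]])
      (use that q_mult in auto)
  moreover have "cnorm (completion A q) (c \<odot>\<^bsub>completion A q\<^esub> seq_class A q x)
      = cmod c * cnorm (completion A q) (seq_class A q x)"
    if "x \<in> cauchy_seqs A q" for x c
  proof -
    have "(\<lambda>n. q (c \<odot> x n)) \<longlonglongrightarrow> cmod c * cnorm (completion A q) (seq_class A q x)"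
      using tendsto_mult_left[OF completion_norm[OF that], of "cmod c"] that by (simp add: q_smult)
    then show ?thesis unfolding completion_smult[OF that]
      using LIMSEQ_unique[OF completion_norm[OF cauchy_smult[OF that, of c]]] by simp
  qed
  moreover have "cnorm (completion A q) (star (completion A q) (seq_class A q x) \<otimes>\<^bsub>completion A q\<^esub> seq_class A q x)
      = (cnorm (completion A q) (seq_class A q x))\<^sup>2"
    if "x \<in> cauchy_seqs A q" for x
  proof -
    have "(\<lambda>n. q (star A (x n) \<otimes> x n)) \<longlonglongrightarrow> (cnorm (completion A q) (seq_class A q x))\<^sup>2"
      using tendsto_power[OF completion_norm[OF that], of 2] that by (simp add: q_star_mult)
    then show ?thesis unfolding completion_star[OF that] completion_mult[OF cauchy_star[OF that] that]
      using LIMSEQ_unique[OF completion_norm[OF cauchy_mult[OF cauchy_star[OF that] that]]] by simp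
  qed
  ultimately show ?thesis
    unfolding cstar_seminorm_def completion_carrier by blast
qed

text \<open>By the Cauchy condition the constant sequence at \<open>x k\<close> stays close to the
  tail of x. This yields the density of the original algebra and the limits in the completeness
  proof.\<close>

lemma completion_limit_of_constants:
  assumes x: "x \<in> cauchy_seqs A q"
  shows "(\<lambda>k. cnorm (completion A q) (seq_class A q (\<lambda>n. x k) \<ominus>\<^bsub>completion A q\<^esub> seq_class A q x)) \<longlonglongrightarrow> 0"
  unfolding LIMSEQ_iff
proof (intro allI impI)
  fix e :: real assume "e > 0"
  then obtain N where N: "\<And>m n. m \<ge> N \<Longrightarrow> n \<ge> N \<Longrightarrow> q (x m \<ominus> x n) < e/2"
    using x by (metis cauchy_seqs_iff half_gt_zero)
  interpret C: cstar_seminormed "completion A q" "cnorm (completion A q)"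
    by (intro cstar_seminormed.intro completion_complex_star_algebra
        cstar_seminormed_axioms.intro completion_cstar_seminorm)
  have "cnorm (completion A q) (seq_class A q (\<lambda>n. x k) \<ominus>\<^bsub>completion A q\<^esub> seq_class A q x) \<le> e/2"
    if "k \<ge> N" for k
  proof -
    have c: "(\<lambda>n. x k \<ominus> x n) \<in> cauchy_seqs A q"
      using cauchy_add[OF cauchy_const[of "x k"] cauchy_smult[OF x, of "-1"]] x
      by (simp add: minus_eq_smult)
    show ?thesis
      unfolding completion_minus[OF cauchy_const[OF cauchy_closed[OF x]] x]
      by (rule LIMSEQ_le_const2[OF completion_norm[OF c]]) (use N that in \<open>auto intro: less_imp_le\<close>)
  qed
  then show "\<exists>N. \<forall>k\<ge>N. norm (cnorm (completion A q) (seq_class A q (\<lambda>n. x k)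
      \<ominus>\<^bsub>completion A q\<^esub> seq_class A q x) - 0) < e"
    using \<open>e > 0\<close> x by (intro exI[of _ N])
      (force simp: C.q_nonneg seq_class_closed cauchy_const)
qed

theorem completion_cstar_algebra: "cstar_algebra (completion A q)"
proof -
  interpret C: cstar_seminormed "completion A q" "cnorm (completion A q)"
    by (intro cstar_seminormed.intro completion_complex_star_algebra
        cstar_seminormed_axioms.intro completion_cstar_seminorm)
  show ?thesis
  proof
    fix X assume X: "X \<in> carrier (completion A q)" "cnorm (completion A q) X = 0"
    then obtain x where x: "x \<in> cauchy_seqs A q" "X = seq_class A q x"
      by (auto simp: completion_carrier)
    then have "asymp x (\<lambda>n. \<zero>)"
      using completion_norm[OF x(1)] X by (simp add: asymp_def minus_eq_smult)
    then show "X = \<zero>\<^bsub>completion A q\<^esub>"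
      using x by (simp add: completion_zero seq_class_eq_iff cauchy_const)
  next
    fix X assume X: "X \<in> cauchy_seqs (completion A q) (cnorm (completion A q))"
    let ?i = "\<lambda>a. seq_class A q (\<lambda>n. a)"
    have i: "a \<in> carrier A \<Longrightarrow> ?i a \<in> carrier (completion A q)" for a
      by (simp add: seq_class_closed cauchy_const)
    \<comment> \<open>Each class \<open>X k\<close> is approximated by a constant up to 1/(k+1).
      Constants embed isometrically, so these approximations form a Cauchy sequence in A itself, and
      its class is the limit of X.\<close>
    have "\<exists>a\<in>carrier A. cnorm (completion A q) (?i a \<ominus>\<^bsub>completion A q\<^esub> X k) \<le> inverse (Suc k)" for k
    proof -
      obtain x where x: "x \<in> cauchy_seqs A q" "X k = seq_class A q x"
        using C.cauchy_closed[OF X, of k] by (auto simp: completion_carrier)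
      have "\<forall>\<^sub>F j in sequentially. cnorm (completion A q) (?i (x j) \<ominus>\<^bsub>completion A q\<^esub> X k) < inverse (Suc k)"
        unfolding x(2) by (rule order_tendstoD(2)[OF completion_limit_of_constants[OF x(1)]]) simp
      then obtain j where "cnorm (completion A q) (?i (x j) \<ominus>\<^bsub>completion A q\<^esub> X k) < inverse (Suc k)"
        by (auto simp: eventually_sequentially)
      then show ?thesis using cauchy_closed[OF x(1)] less_imp_le by blast
    qed
    then obtain y where y: "\<And>k. y k \<in> carrier A"
        "\<And>k. cnorm (completion A q) (?i (y k) \<ominus>\<^bsub>completion A q\<^esub> X k) \<le> inverse (Suc k)"
      by metis
    have yX: "C.asymp (\<lambda>k. ?i (y k)) X"
      by (rule C.asympI[OF _ _ y(2) LIMSEQ_inverse_real_of_nat]) (use X i y in auto)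
    have "(\<lambda>k. ?i (y k)) \<in> cauchy_seqs (completion A q) (cnorm (completion A q))"
      by (rule C.cauchy_asympI[OF X _ C.asymp_sym[OF _ _ yX]]) (use X i y in auto)
    moreover have "cnorm (completion A q) (?i (y m) \<ominus>\<^bsub>completion A q\<^esub> ?i (y n)) = q (y m \<ominus> y n)" for m n
      using y by (simp add: completion_minus cauchy_const completion_norm_const)
    ultimately have yc: "y \<in> cauchy_seqs A q"
      using y(1) by (simp add: C.cauchy_seqs_iff cauchy_seqs_iff)
    have "C.asymp X (\<lambda>k. seq_class A q y)"
      by (rule C.asymp_trans[OF _ _ _ C.asymp_sym[OF _ _ yX]])
        (use X i y completion_limit_of_constants[OF yc] in
          \<open>auto simp: C.asymp_def seq_class_closed yc\<close>)
    then show "\<exists>a\<in>carrier (completion A q). (\<lambda>n. cnorm (completion A q) (X n \<ominus>\<^bsub>completion A q\<^esub> a)) \<longlonglongrightarrow> 0"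
      using seq_class_closed[OF yc] by (auto simp: C.asymp_def)
  qed
qed

lemma completion_embedding: "star_hom A (completion A q) (\<lambda>a. seq_class A q (\<lambda>n. a))"
  by (rule star_homI) (simp_all add: seq_class_closed cauchy_const completion_mult completion_add
      completion_one completion_smult completion_star)

end

section \<open>Extension by density\<close>

text \<open>\<open>q\<close> is the seminorm of the target \<open>E\<close>. The notion serves a
  completion as well as the map from the free *-algebra on one generator to the functions on the
  circle.\<close>

definition dense_hom ::
  "('d, 'k) star_algebra_scheme \<Rightarrow> ('a, 'm) star_algebra_scheme \<Rightarrow> ('a \<Rightarrow> real) \<Rightarrow> ('d \<Rightarrow> 'a) \<Rightarrow> bool" where
  "dense_hom D E q \<iota> \<longleftrightarrow> star_hom D E \<iota> \<and>
     (\<forall>X\<in>carrier E. \<exists>x. (\<forall>n. x n \<in> carrier D) \<and> (\<lambda>n. q (\<iota> (x n) \<ominus>\<^bsub>E\<^esub> X)) \<longlonglongrightarrow> 0)"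

lemma (in cstar_seminormed) dense_hom_completion:
  "dense_hom A (completion A q) (cnorm (completion A q)) (\<lambda>a. seq_class A q (\<lambda>n. a))"
  unfolding dense_hom_def completion_carrier
  using completion_embedding completion_limit_of_constants cauchy_closed by blast

lemma dense_hom_extension:
  assumes D: "complex_star_algebra D" and E: "cstar_seminormed E q" and B: "cstar_algebra B"
    and \<iota>: "dense_hom D E q \<iota>" and \<phi>: "star_hom D B \<phi>"
    and le: "\<And>x. x \<in> carrier D \<Longrightarrow> cnorm B (\<phi> x) \<le> q (\<iota> x)"
  obtains \<Phi> where "star_hom E B \<Phi>" "\<And>x. x \<in> carrier D \<Longrightarrow> \<Phi> (\<iota> x) = \<phi> x"
proof -
  interpret D: complex_star_algebra D by fact
  interpret E: cstar_seminormed E q by fact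
  interpret B: cstar_algebra B by fact
  have \<iota>h: "star_hom D E \<iota>" using \<iota> by (simp add: dense_hom_def)
  note [simp] = star_hom_closed[OF \<iota>h] star_hom_closed[OF \<phi>]
  note hom = star_hom_mult[OF \<iota>h] star_hom_mult[OF \<phi>] star_hom_add[OF \<iota>h] star_hom_add[OF \<phi>]
    star_hom_smult[OF \<iota>h] star_hom_smult[OF \<phi>] star_hom_star[OF \<iota>h] star_hom_star[OF \<phi>]
    star_hom_one[OF \<iota>h] star_hom_one[OF \<phi>]
  \<comment> \<open>\<open>R\<close> is the closure of the graph of \<open>\<phi>\<close> over
    \<open>\<iota>\<close>. The bound of \<open>\<phi>\<close> by the seminorm of
    \<open>\<iota>\<close> makes it single valued, completeness of \<open>B\<close> makes it total,
    and the algebraic laws pass to it termwise.\<close>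
  define R where "R X b \<longleftrightarrow> X \<in> carrier E \<and> b \<in> carrier B \<and>
     (\<exists>x. (\<forall>n. x n \<in> carrier D) \<and> E.asymp (\<lambda>n. \<iota> (x n)) (\<lambda>n. X) \<and> B.asymp (\<lambda>n. \<phi> (x n)) (\<lambda>n. b))" for X b
  have R_E: "\<exists>x. (\<forall>n. x n \<in> carrier D) \<and> E.asymp (\<lambda>n. \<iota> (x n)) (\<lambda>n. X) \<and> B.asymp (\<lambda>n. \<phi> (x n)) (\<lambda>n. b)"
    if "R X b" for X b
    using that by (simp add: R_def)
  have le_diff: "cnorm B (\<phi> x \<ominus>\<^bsub>B\<^esub> \<phi> y) \<le> q (\<iota> x \<ominus>\<^bsub>E\<^esub> \<iota> y)" if "x \<in> carrier D" "y \<in> carrier D" for x y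
    using le[of "x \<ominus>\<^bsub>D\<^esub> y"] that star_hom_minus[OF D _ \<phi>] star_hom_minus[OF D _ \<iota>h]
    by (simp add: B.complex_star_algebra_axioms E.complex_star_algebra_axioms)
  have ex: "\<exists>b. R X b" if X: "X \<in> carrier E" for X
  proof -
    obtain x where x: "\<And>n. x n \<in> carrier D" "E.asymp (\<lambda>n. \<iota> (x n)) (\<lambda>n. X)"
      using \<iota> X unfolding dense_hom_def E.asymp_def by blast
    have "(\<lambda>n. \<iota> (x n)) \<in> cauchy_seqs E q"
      using E.convergent_cauchy x X by simp
    then have "(\<lambda>n. \<phi> (x n)) \<in> cauchy_seqs B (cnorm B)"
      using le_diff[OF x(1) x(1)] x(1) unfolding E.cauchy_seqs_iff B.cauchy_seqs_iff
      by (meson le_less_trans star_hom_closed[OF \<phi>])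
    then show ?thesis using B.cauchy_convergent x X unfolding R_def by metis
  qed
  have uniq: "b = b'" if R: "R X b" "R X b'" for X b b'
  proof -
    obtain x where x: "\<And>n. x n \<in> carrier D" "E.asymp (\<lambda>n. \<iota> (x n)) (\<lambda>n. X)" "B.asymp (\<lambda>n. \<phi> (x n)) (\<lambda>n. b)"
      using R_E[OF R(1)] by blast
    obtain y where y: "\<And>n. y n \<in> carrier D" "E.asymp (\<lambda>n. \<iota> (y n)) (\<lambda>n. X)" "B.asymp (\<lambda>n. \<phi> (y n)) (\<lambda>n. b')"
      using R_E[OF R(2)] by blast
    have X: "X \<in> carrier E" "b \<in> carrier B" "b' \<in> carrier B" using R by (auto simp: R_def)
    have "E.asymp (\<lambda>n. \<iota> (x n)) (\<lambda>n. \<iota> (y n))"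
      using E.asymp_trans[of "\<lambda>n. \<iota> (x n)" "\<lambda>n. X" "\<lambda>n. \<iota> (y n)"] x y X
        E.asymp_sym[of "\<lambda>n. \<iota> (y n)" "\<lambda>n. X"] by simp
    then have "B.asymp (\<lambda>n. \<phi> (x n)) (\<lambda>n. \<phi> (y n))"
      using le_diff[OF x(1) y(1)] x y
      by (intro B.asympI[where b="\<lambda>n. q (\<iota> (x n) \<ominus>\<^bsub>E\<^esub> \<iota> (y n))"]) (auto simp: E.asymp_def)
    then have "B.asymp (\<lambda>n. \<phi> (x n)) (\<lambda>n. b')"
      using B.asymp_trans[of "\<lambda>n. \<phi> (x n)" "\<lambda>n. \<phi> (y n)" "\<lambda>n. b'"] x y X by simp
    then show ?thesis using B.limit_unique[of "\<lambda>n. \<phi> (x n)"] x X by simp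
  qed
  have R_const: "R (\<iota> x) (\<phi> x)" if "x \<in> carrier D" for x
    unfolding R_def using that by (auto intro!: exI[of _ "\<lambda>n. x"] E.asymp_refl B.asymp_refl)
  have R_add: "R (X \<oplus>\<^bsub>E\<^esub> Y) (b \<oplus>\<^bsub>B\<^esub> c)" if R: "R X b" "R Y c" for X Y b c
  proof -
    obtain x where x: "\<And>n. x n \<in> carrier D" "E.asymp (\<lambda>n. \<iota> (x n)) (\<lambda>n. X)" "B.asymp (\<lambda>n. \<phi> (x n)) (\<lambda>n. b)"
      using R_E[OF R(1)] by blast
    obtain y where y: "\<And>n. y n \<in> carrier D" "E.asymp (\<lambda>n. \<iota> (y n)) (\<lambda>n. Y)" "B.asymp (\<lambda>n. \<phi> (y n)) (\<lambda>n. c)"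
      using R_E[OF R(2)] by blast
    show ?thesis using R x y unfolding R_def
      by (auto simp: hom intro!: exI[of _ "\<lambda>n. x n \<oplus>\<^bsub>D\<^esub> y n"] E.asymp_add B.asymp_add)
  qed
  have R_mult: "R (X \<otimes>\<^bsub>E\<^esub> Y) (b \<otimes>\<^bsub>B\<^esub> c)" if R: "R X b" "R Y c" for X Y b c
  proof -
    obtain x where x: "\<And>n. x n \<in> carrier D" "E.asymp (\<lambda>n. \<iota> (x n)) (\<lambda>n. X)" "B.asymp (\<lambda>n. \<phi> (x n)) (\<lambda>n. b)"
      using R_E[OF R(1)] by blast
    obtain y where y: "\<And>n. y n \<in> carrier D" "E.asymp (\<lambda>n. \<iota> (y n)) (\<lambda>n. Y)" "B.asymp (\<lambda>n. \<phi> (y n)) (\<lambda>n. c)"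
      using R_E[OF R(2)] by blast
    have X: "X \<in> carrier E" "Y \<in> carrier E" "b \<in> carrier B" "c \<in> carrier B" using R by (auto simp: R_def)
    have "(\<lambda>n. \<iota> (x n)) \<in> cauchy_seqs E q" "(\<lambda>n. \<phi> (x n)) \<in> cauchy_seqs B (cnorm B)"
      using E.convergent_cauchy[of "\<lambda>n. \<iota> (x n)" X] B.convergent_cauchy[of "\<lambda>n. \<phi> (x n)" b] x X
      by auto
    then obtain K L where K: "\<And>n. q (\<iota> (x n)) \<le> K" and L: "\<And>n. cnorm B (\<phi> (x n)) \<le> L"
      by (metis E.cauchy_bounded B.cauchy_bounded)
    have "E.asymp (\<lambda>n. \<iota> (x n \<otimes>\<^bsub>D\<^esub> y n)) (\<lambda>n. X \<otimes>\<^bsub>E\<^esub> Y)"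
      using E.asymp_mult[of "\<lambda>n. \<iota> (x n)" "\<lambda>n. \<iota> (y n)" "\<lambda>n. X" "\<lambda>n. Y" K "q Y"] x y X K by (simp add: hom)
    moreover have "B.asymp (\<lambda>n. \<phi> (x n \<otimes>\<^bsub>D\<^esub> y n)) (\<lambda>n. b \<otimes>\<^bsub>B\<^esub> c)"
      using B.asymp_mult[of "\<lambda>n. \<phi> (x n)" "\<lambda>n. \<phi> (y n)" "\<lambda>n. b" "\<lambda>n. c" L "cnorm B c"] x y X L by (simp add: hom)
    ultimately show ?thesis using X x y unfolding R_def
      by (auto intro!: exI[of _ "\<lambda>n. x n \<otimes>\<^bsub>D\<^esub> y n"])
  qed
  have R_smult: "R (a \<odot>\<^bsub>E\<^esub> X) (a \<odot>\<^bsub>B\<^esub> b)" if R: "R X b" for X b a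
  proof -
    obtain x where x: "\<And>n. x n \<in> carrier D" "E.asymp (\<lambda>n. \<iota> (x n)) (\<lambda>n. X)" "B.asymp (\<lambda>n. \<phi> (x n)) (\<lambda>n. b)"
      using R_E[OF R(1)] by blast
    show ?thesis using R x unfolding R_def
      by (auto simp: hom intro!: exI[of _ "\<lambda>n. a \<odot>\<^bsub>D\<^esub> x n"] E.asymp_smult B.asymp_smult)
  qed
  have R_star: "R (star E X) (star B b)" if R: "R X b" for X b
  proof -
    obtain x where x: "\<And>n. x n \<in> carrier D" "E.asymp (\<lambda>n. \<iota> (x n)) (\<lambda>n. X)" "B.asymp (\<lambda>n. \<phi> (x n)) (\<lambda>n. b)"
      using R_E[OF R(1)] by blast
    show ?thesis using R x unfolding R_def
      by (auto simp: hom intro!: exI[of _ "\<lambda>n. star D (x n)"] E.asymp_star B.asymp_star)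
  qed
  define \<Phi> where "\<Phi> X = (THE b. R X b)" for X
  have \<Phi>: "\<Phi> X = b" if "R X b" for X b
    unfolding \<Phi>_def using that uniq by blast
  have R\<Phi>: "R X (\<Phi> X)" if "X \<in> carrier E" for X
    using ex[OF that] \<Phi> by blast
  have "star_hom E B \<Phi>"
  proof (rule star_homI)
    show "\<Phi> \<one>\<^bsub>E\<^esub> = \<one>\<^bsub>B\<^esub>" using \<Phi>[OF R_const[OF D.one_closed]] by (simp add: hom)
    show "\<Phi> X \<in> carrier B" if "X \<in> carrier E" for X using R\<Phi>[OF that] by (simp add: R_def)
  qed (auto intro!: \<Phi> R_add R_mult R_smult R_star R\<Phi>)
  moreover have "\<Phi> (\<iota> x) = \<phi> x" if "x \<in> carrier D" for x
    using \<Phi>[OF R_const[OF that]] .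
  ultimately show thesis using that by blast
qed

lemma dense_hom_eqI:
  assumes E: "cstar_seminormed E q" and B: "cstar_algebra B"
    and \<iota>: "dense_hom D E q \<iota>" and \<phi>: "star_hom E B \<phi>" and \<psi>: "star_hom E B \<psi>"
    and le: "\<And>x. x \<in> carrier E \<Longrightarrow> cnorm B (\<phi> x) \<le> q x" "\<And>x. x \<in> carrier E \<Longrightarrow> cnorm B (\<psi> x) \<le> q x"
    and eq: "\<And>x. x \<in> carrier D \<Longrightarrow> \<phi> (\<iota> x) = \<psi> (\<iota> x)"
    and X: "X \<in> carrier E"
  shows "\<phi> X = \<psi> X"
proof -
  interpret E: cstar_seminormed E q by fact
  interpret B: cstar_algebra B by fact
  obtain x where x: "\<And>n. x n \<in> carrier D" "(\<lambda>n. q (\<iota> (x n) \<ominus>\<^bsub>E\<^esub> X)) \<longlonglongrightarrow> 0"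
    using \<iota> X unfolding dense_hom_def by blast
  have c: "\<iota> (x n) \<in> carrier E" for n
    using \<iota> x(1)[of n] star_hom_closed unfolding dense_hom_def by metis
  have lim: "B.asymp (\<lambda>n. \<eta> (\<iota> (x n))) (\<lambda>n. \<eta> X)"
    if \<eta>: "star_hom E B \<eta>" and le: "\<And>x. x \<in> carrier E \<Longrightarrow> cnorm B (\<eta> x) \<le> q x" for \<eta>
  proof (rule B.asympI[OF _ _ _ x(2)])
    show "cnorm B (\<eta> (\<iota> (x n)) \<ominus>\<^bsub>B\<^esub> \<eta> X) \<le> q (\<iota> (x n) \<ominus>\<^bsub>E\<^esub> X)" for n
      using le[of "\<iota> (x n) \<ominus>\<^bsub>E\<^esub> X"] c X star_hom_minus[OF _ _ \<eta>]
      by (simp add: B.complex_star_algebra_axioms E.complex_star_algebra_axioms)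
  qed (use c X star_hom_closed[OF \<eta>] in auto)
  show ?thesis
    using B.limit_unique[OF _ _ _ lim[OF \<phi> le(1)]] lim[OF \<psi> le(2)] c X
    by (simp add: eq[OF x(1)] star_hom_closed[OF \<phi>] star_hom_closed[OF \<psi>])
qed

section \<open>Contractivity of *-homomorphisms\<close>

text \<open>The property of the domain on which contractivity rests. It is stated for seminormed
  algebras because it has two proofs: by an iteration in a C*-algebra, and pointwise for functions
  on the circle.\<close>

definition (in cstar_seminormed) averages_of_unitaries :: bool where
  "averages_of_unitaries \<longleftrightarrow>
     (\<forall>x\<in>carrier A. star A x = x \<and> q x < 1 \<longrightarrow> (\<exists>w. unitary w \<and> x \<oplus> x = w \<oplus> star A w))"

text \<open>The unitaries bound the image of a selfadjoint element of norm below 1 by 1. For general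
  x this is applied to x* x / r^2 with r > \<open>q x\<close>, so that the norm is strictly below 1;
  the C*-identity takes the square root, and r tends to \<open>q x\<close>.\<close>

lemma star_hom_contractive:
  assumes E: "cstar_seminormed E q" "cstar_seminormed.averages_of_unitaries E q"
    and B: "cstar_seminormed B p" and \<phi>: "star_hom E B \<phi>" and x: "x \<in> carrier E"
  shows "p (\<phi> x) \<le> q x"
proof -
  interpret E: cstar_seminormed E q by fact
  interpret B: cstar_seminormed B p by fact
  have sa: "p (\<phi> y) \<le> 1" if y: "y \<in> carrier E" "star E y = y" "q y < 1" for y
  proof -
    obtain w where w: "E.unitary w" "y \<oplus>\<^bsub>E\<^esub> y = w \<oplus>\<^bsub>E\<^esub> star E w"
      using E(2) y by (auto simp: E.averages_of_unitaries_def)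
    have u: "B.unitary (\<phi> w)"
      using star_hom_unitary[OF E.complex_star_algebra_axioms B.complex_star_algebra_axioms \<phi> w(1)] .
    have yc: "\<phi> y \<in> carrier B" using star_hom_closed[OF \<phi> y(1)] .
    have "2 \<odot>\<^bsub>B\<^esub> \<phi> y = \<phi> y \<oplus>\<^bsub>B\<^esub> \<phi> y"
      using B.smult_l_distr[OF yc, of 1 1] yc by simp
    also have "\<dots> = \<phi> w \<oplus>\<^bsub>B\<^esub> star B (\<phi> w)"
      using star_hom_add[OF \<phi> y(1) y(1)] star_hom_add[OF \<phi>, of w "star E w"] star_hom_star[OF \<phi>, of w] w
      by simp
    finally have "2 * p (\<phi> y) \<le> p (\<phi> w) + p (star B (\<phi> w))"
      using B.q_add[of "\<phi> w" "star B (\<phi> w)"] B.q_smult[OF yc, of 2] u by simp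
    then show ?thesis using B.q_unitary_le[OF u] u by simp
  qed
  show ?thesis
  proof (rule dense_ge)
    fix r assume r: "q x < r"
    then have r0: "r > 0" using E.q_nonneg[OF x] by linarith
    define y where "y = star E x \<otimes>\<^bsub>E\<^esub> x"
    define c where "c = complex_of_real (1 / r\<^sup>2)"
    have y: "y \<in> carrier E" "star E y = y" "q y = (q x)\<^sup>2"
      using x by (simp_all add: y_def E.star_mult E.q_star_mult)
    have "q (c \<odot>\<^bsub>E\<^esub> y) < 1"
      using y r r0 x by (simp add: E.q_smult c_def norm_divide norm_power power_strict_mono)
    moreover have "star E (c \<odot>\<^bsub>E\<^esub> y) = c \<odot>\<^bsub>E\<^esub> y" using y by (simp add: E.star_smult c_def)
    ultimately have "p (\<phi> (c \<odot>\<^bsub>E\<^esub> y)) \<le> 1" using sa y by simp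
    then have "p (\<phi> y) \<le> r\<^sup>2"
      using y r0 by (simp add: star_hom_smult[OF \<phi>] B.q_smult star_hom_closed[OF \<phi>] c_def
          norm_divide norm_power divide_simps)
    moreover have "p (\<phi> y) = (p (\<phi> x))\<^sup>2"
      using x by (simp add: y_def star_hom_mult[OF \<phi>] star_hom_star[OF \<phi>] B.q_star_mult star_hom_closed[OF \<phi>])
    ultimately show "p (\<phi> x) \<le> r" using r0 by (metis less_imp_le power2_le_imp_le)
  qed
qed

section \<open>Square roots by a fixed-point iteration\<close>

lemma (in cstar_seminormed) geometric_cauchy:
  assumes y: "\<And>n. y n \<in> carrier A" and r: "0 \<le> r" "r < 1"
    and le: "\<And>n. q (y (Suc n) \<ominus> y n) \<le> r ^ n"
  shows "y \<in> cauchy_seqs A q"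
proof -
  have step: "q (y (n + k) \<ominus> y n) \<le> r ^ n / (1 - r)" for n k
  proof -
    \<comment> \<open>The partial sum of the geometric series is the form that survives the
      induction on k; the bound by the full series follows from it.\<close>
    have "q (y (n + k) \<ominus> y n) \<le> r ^ n * (1 - r ^ k) / (1 - r)"
    proof (induction k)
      case (Suc k)
      have "q (y (n + Suc k) \<ominus> y n) \<le> r ^ (n + k) + r ^ n * (1 - r ^ k) / (1 - r)"
        using q_diff_triangle[of "y (n + Suc k)" "y (n + k)" "y n"] Suc le[of "n + k"] y by simp
      also have "\<dots> = r ^ n * (1 - r ^ Suc k) / (1 - r)"
        using r by (simp add: field_simps power_add)
      finally show ?case .
    qed (use y in simp)
    also have "\<dots> \<le> r ^ n / (1 - r)"
      using r by (intro divide_right_mono) (auto simp: mult_left_le)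
    finally show ?thesis .
  qed
  show ?thesis unfolding cauchy_seqs_iff
  proof (intro conjI allI impI)
    fix e :: real assume e: "e > 0"
    have "(\<lambda>n. r ^ n / (1 - r)) \<longlonglongrightarrow> 0"
      using tendsto_divide[OF LIMSEQ_realpow_zero[OF r] tendsto_const, of "1 - r"] r by simp
    then have "\<forall>\<^sub>F n in sequentially. r ^ n / (1 - r) < e / 2"
      using e by (intro order_tendstoD(2)) auto
    then obtain N where N: "r ^ N / (1 - r) < e / 2" by (auto simp: eventually_sequentially)
    have close: "q (y m \<ominus> y N) < e / 2" if "m \<ge> N" for m
      using le_less_trans[OF step[of N "m - N"] N] that by simp
    have "q (y m \<ominus> y n) < e" if "m \<ge> N" "n \<ge> N" for m n
      using close[OF that(1)] close[OF that(2)] q_diff_triangle[of "y m" "y N" "y n"]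
        q_diff_commute[of "y N" "y n"] y by simp
    then show "\<exists>N. \<forall>m\<ge>N. \<forall>n\<ge>N. q (y m \<ominus> y n) < e" by blast
  qed (use y in auto)
qed

context cstar_algebra
begin

text \<open>Identities that hold for all terms of an iteration are carried to its limit by comparing
  two limits of the same sequence.\<close>

lemma limit_eqI:
  assumes "\<And>n. x n \<in> carrier A" "\<And>n. y n \<in> carrier A" "a \<in> carrier A" "b \<in> carrier A"
    and "asymp x (\<lambda>n. a)" "asymp y (\<lambda>n. b)" "\<And>n. x n = y n"
  shows "a = b"
  using limit_unique[of x a b] assms by (metis ext)

text \<open>For \<open>y = 1 - s\<close> the equation \<open>s\<^sup>2 = 1 - x\<^sup>2\<close> becomes the fixed point equation
  \<open>y = (x\<^sup>2 + y\<^sup>2) / 2\<close>, whose right-hand side is a contraction of the ball of radius \<open>\<parallel>x\<parallel> < 1\<close>.\<close>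

lemma sqrt_one_minus_square:
  assumes x: "x \<in> carrier A" "star A x = x" "cnorm A x < 1"
  obtains s where "s \<in> carrier A" "star A s = s" "x \<otimes> s = s \<otimes> x" "x \<otimes> x \<oplus> s \<otimes> s = \<one>"
proof -
  define r where "r = cnorm A x"
  have r: "0 \<le> r" "r < 1" using x by (simp_all add: r_def)
  define T where "T z = (1/2) \<odot> (x \<otimes> x \<oplus> z \<otimes> z)" for z
  define y where "y n = (T ^^ n) \<zero>" for n
  have y_Suc: "y (Suc n) = T (y n)" for n by (simp add: y_def)
  \<comment> \<open>Staying in the ball of radius r makes the map contract along the iteration.
    Selfadjointness and commutation with x are recorded because the limit inherits them.\<close>
  have y: "y n \<in> carrier A \<and> cnorm A (y n) \<le> r \<and> star A (y n) = y n \<and> x \<otimes> y n = y n \<otimes> x" for n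
  proof (induction n)
    case 0
    then show ?case using r x by (simp add: y_def)
  next
    case (Suc n)
    let ?z = "y n"
    have c: "T ?z \<in> carrier A" using Suc x by (simp add: T_def)
    have "cnorm A (T ?z) = cnorm A (x \<otimes> x \<oplus> ?z \<otimes> ?z) / 2"
      using Suc x by (simp add: T_def q_smult)
    also have "\<dots> \<le> (r * r + r * r) / 2"
      using q_add[of "x \<otimes> x" "?z \<otimes> ?z"] q_mult[of x x] q_mult[of ?z ?z] Suc x r
        mult_mono[of "cnorm A ?z" r "cnorm A ?z" r] by (simp add: r_def)
    also have "\<dots> \<le> r" using r by (simp add: mult_left_le)
    finally have n: "cnorm A (T ?z) \<le> r" .
    have s: "star A (T ?z) = T ?z" using Suc x by (simp add: T_def star_smult star_add star_mult)
    have "x \<otimes> (x \<otimes> x \<oplus> ?z \<otimes> ?z) = (x \<otimes> x \<oplus> ?z \<otimes> ?z) \<otimes> x"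
    proof -
      have "x \<otimes> (?z \<otimes> ?z) = (?z \<otimes> ?z) \<otimes> x"
        using Suc x(1) by (metis m_assoc)
      then show ?thesis using Suc x(1) by (simp add: l_distr r_distr m_assoc)
    qed
    then have "x \<otimes> T ?z = T ?z \<otimes> x"
      using Suc x(1) by (simp add: T_def smult_mult_left smult_mult_right)
    then show ?case using c n s by (simp add: y_Suc)
  qed
  have step: "cnorm A (y (Suc n) \<ominus> y n) \<le> r ^ n" for n
  proof (induction n)
    case 0
    have "y (Suc 0) \<ominus> y 0 = y 1" using y[of 1] by (simp add: y_def[of 0] minus_eq_smult)
    then show ?case using y[of 1] r by simp
  next
    case (Suc n)
    let ?z = "y (Suc n)" and ?w = "y n"
    have c: "?z \<in> carrier A" "?w \<in> carrier A" "cnorm A ?z \<le> r" "cnorm A ?w \<le> r" using y by auto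
    have "T ?z \<ominus> T ?w = (1/2) \<odot> (?z \<otimes> ?z \<ominus> ?w \<otimes> ?w)"
    proof -
      have "(x \<otimes> x \<oplus> ?z \<otimes> ?z) \<ominus> (x \<otimes> x \<oplus> ?w \<otimes> ?w) = ?z \<otimes> ?z \<ominus> ?w \<otimes> ?w"
        using c x(1) by (simp add: a_minus_def minus_add a_ac r_neg1 r_neg2)
      then show ?thesis using c x(1) by (simp add: T_def flip: smult_minus)
    qed
    then have "cnorm A (T ?z \<ominus> T ?w) = cnorm A (?z \<otimes> ?z \<ominus> ?w \<otimes> ?w) / 2"
      using c by (simp add: q_smult)
    also have "\<dots> \<le> (cnorm A ?z * cnorm A (?z \<ominus> ?w) + cnorm A (?z \<ominus> ?w) * cnorm A ?w) / 2"
      using q_mult_diff[of ?z ?z ?w ?w] c by simp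
    \<comment> \<open>Both iterates have norm at most r, so a difference of squares costs at most 2
      r times the difference; the factor 1/2 in \<open>T\<close> leaves the ratio r.\<close>
    also have "\<dots> \<le> (r * r ^ n + r ^ n * r) / 2"
      using Suc c r by (intro divide_right_mono add_mono mult_mono) auto
    finally show ?case by (simp add: y_Suc)
  qed
  have "y \<in> cauchy_seqs A (cnorm A)"
    using geometric_cauchy[OF _ r step] y by blast
  then obtain a where a: "a \<in> carrier A" "asymp y (\<lambda>n. a)" using cauchy_convergent by blast
  have yc: "\<And>n. y n \<in> carrier A" using y by blast
  have sq: "asymp (\<lambda>n. y n \<otimes> y n) (\<lambda>n. a \<otimes> a)"
    by (rule asymp_mult[where B=r and C="cnorm A a"]) (use y a in auto)
  have Ta: "asymp (\<lambda>n. T (y n)) (\<lambda>n. T a)" unfolding T_def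
    by (intro asymp_smult asymp_add asymp_refl sq) (use yc a x in auto)
  have "asymp (\<lambda>n. y (Suc n)) (\<lambda>n. a)"
    using a(2) unfolding asymp_def by (rule LIMSEQ_Suc)
  then have a_T: "a = T a"
    by (intro limit_eqI[OF _ _ _ _ _ Ta]) (use yc a x in \<open>auto simp: y_Suc T_def\<close>)
  have a_star: "star A a = a"
    by (rule limit_eqI[OF _ yc _ _ asymp_star[OF yc _ a(2)] a(2)]) (use y a in auto)
  have l: "asymp (\<lambda>n. x \<otimes> y n) (\<lambda>n. x \<otimes> a)"
    by (rule asymp_mult[where B="cnorm A x" and C="cnorm A a"]) (use y a x in \<open>auto intro: asymp_refl\<close>)
  have r: "asymp (\<lambda>n. y n \<otimes> x) (\<lambda>n. a \<otimes> x)"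
    by (rule asymp_mult[where B=r and C="cnorm A x"]) (use y a x in \<open>auto intro: asymp_refl\<close>)
  have a_comm: "x \<otimes> a = a \<otimes> x"
    by (rule limit_eqI[OF _ _ _ _ l r]) (use y a x in auto)
  have two: "a \<oplus> a = x \<otimes> x \<oplus> a \<otimes> a"
  proof -
    have "a \<oplus> a = 2 \<odot> a" using smult_l_distr[OF a(1), of 1 1] a(1) by simp
    also have "\<dots> = 2 \<odot> T a" using a_T by simp
    also have "\<dots> = x \<otimes> x \<oplus> a \<otimes> a" unfolding T_def using a(1) x by (simp add: smult_smult)
    finally show ?thesis .
  qed
  show thesis
  proof (rule that[of "\<one> \<ominus> a"])
    show "x \<otimes> (\<one> \<ominus> a) = (\<one> \<ominus> a) \<otimes> x"
      using a x(1) a_comm by (simp add: a_minus_def l_distr r_distr l_minus r_minus)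
    have "(\<one> \<ominus> a) \<otimes> (\<one> \<ominus> a) = (\<one> \<oplus> a \<otimes> a) \<ominus> (a \<oplus> a)"
      using a by (simp add: a_minus_def l_distr r_distr l_minus r_minus minus_add a_ac)
    also have "\<dots> = \<one> \<ominus> x \<otimes> x"
      unfolding two using a x by (simp add: a_minus_def minus_add a_ac r_neg1 r_neg2)
    finally show "x \<otimes> x \<oplus> (\<one> \<ominus> a) \<otimes> (\<one> \<ominus> a) = \<one>"
      using a x by (simp add: a_minus_def a_ac r_neg r_neg1 r_neg2)
  qed (use a a_star in \<open>auto simp: star_minus\<close>)
qed

lemma averages_of_unitaries: averages_of_unitaries
  unfolding averages_of_unitaries_def
proof (intro ballI impI, elim conjE)
  fix x assume x: "x \<in> carrier A" "star A x = x" "cnorm A x < 1"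
  obtain s where s: "s \<in> carrier A" "star A s = s" "x \<otimes> s = s \<otimes> x" "x \<otimes> x \<oplus> s \<otimes> s = \<one>"
    using sqrt_one_minus_square[OF x] .
  define w where "w = x \<oplus> \<i> \<odot> s"
  have sw: "star A w = x \<oplus> (-\<i>) \<odot> s" using x s by (simp add: w_def star_add star_smult)
  have z: "(-\<i>) \<odot> t \<oplus> \<i> \<odot> t = \<zero>" "\<i> \<odot> t \<oplus> (-\<i>) \<odot> t = \<zero>" if "t \<in> carrier A" for t
    using smult_l_distr[OF that, of "-\<i>" \<i>] smult_l_distr[OF that, of \<i> "-\<i>"] that by simp_all
  \<comment> \<open>Since s commutes with x, the cross terms are -i s x and i s x. They cancel by
    \<open>z\<close>, leaving \<open>x \<otimes> x \<oplus> s \<otimes> s\<close>.\<close>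
  have "w \<otimes> star A w = x \<otimes> x \<oplus> (((-\<i>) \<odot> (s \<otimes> x) \<oplus> \<i> \<odot> (s \<otimes> x)) \<oplus> s \<otimes> s)"
    unfolding sw unfolding w_def using x(1) s
    by (simp add: l_distr r_distr smult_mult_left smult_mult_right smult_smult smult_r_distr a_ac)
  moreover have "star A w \<otimes> w = x \<otimes> x \<oplus> (((-\<i>) \<odot> (s \<otimes> x) \<oplus> \<i> \<odot> (s \<otimes> x)) \<oplus> s \<otimes> s)"
    unfolding sw unfolding w_def using x(1) s
    by (simp add: l_distr r_distr smult_mult_left smult_mult_right smult_smult smult_r_distr a_ac)
  ultimately have "unitary w"
    using x(1) s by (simp add: unitary_def z w_def)
  moreover have "w \<oplus> star A w = (x \<oplus> x) \<oplus> (\<i> \<odot> s \<oplus> (-\<i>) \<odot> s)"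
    unfolding sw unfolding w_def using x(1) s by (simp add: a_ac)
  then have "x \<oplus> x = w \<oplus> star A w" using x(1) s by (simp add: z)
  ultimately show "\<exists>w. unitary w \<and> x \<oplus> x = w \<oplus> star A w" by blast
qed

end

section \<open>The free *-algebra\<close>

definition word_star :: "('g \<times> bool) list \<Rightarrow> ('g \<times> bool) list" where
  "word_star w = rev (map (apsnd Not) w)"

lemma word_star_word_star [simp]: "word_star (word_star w) = w"
proof -
  have "apsnd Not \<circ> apsnd Not = (id :: 'a \<times> bool \<Rightarrow> _)" by auto
  then show ?thesis by (simp add: word_star_def rev_map)
qed

lemma length_word_star [simp]: "length (word_star w) = length w"
  by (simp add: word_star_def)

lemma word_star_take: "i \<le> length w \<Longrightarrow> word_star (take i w) = drop (length w - i) (word_star w)"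
  by (simp add: word_star_def drop_rev take_map)

lemma word_star_drop: "i \<le> length w \<Longrightarrow> word_star (drop i w) = take (length w - i) (word_star w)"
  by (simp add: word_star_def take_rev drop_map)

definition word_fun :: "('g \<times> bool) list \<Rightarrow> 'g star_poly" where
  "word_fun w = (\<lambda>v. if v = w then 1 else 0)"

lemma free_carrier: "x \<in> carrier free_star_algebra \<longleftrightarrow> finite {w. x w \<noteq> 0}"
  and free_mult: "(x \<otimes>\<^bsub>free_star_algebra\<^esub> y) w = (\<Sum>i\<le>length w. x (take i w) * y (drop i w))"
  and free_one: "\<one>\<^bsub>free_star_algebra\<^esub> = word_fun []"
  and free_zero: "\<zero>\<^bsub>free_star_algebra\<^esub> = (\<lambda>w. 0)"
  and free_add: "x \<oplus>\<^bsub>free_star_algebra\<^esub> y = (\<lambda>w. x w + y w)"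
  and free_smult: "c \<odot>\<^bsub>free_star_algebra\<^esub> x = (\<lambda>w. c * x w)"
  and free_star: "star free_star_algebra x = (\<lambda>w. cnj (x (word_star w)))"
  by (simp_all add: free_star_algebra_def word_star_def word_fun_def)

lemma free_gen_word_fun: "free_gen g = word_fun [(g, False)]"
  by (simp add: free_gen_def word_fun_def)

lemma word_fun_closed [simp]: "word_fun w \<in> carrier free_star_algebra"
  by (simp add: free_carrier word_fun_def)

lemma free_gen_closed [simp]: "free_gen g \<in> carrier free_star_algebra"
  by (simp add: free_gen_word_fun)

lemma free_mult_nonzero:
  assumes "(x \<otimes>\<^bsub>free_star_algebra\<^esub> y) w \<noteq> 0"
  shows "\<exists>a b. w = a @ b \<and> x a \<noteq> 0 \<and> y b \<noteq> 0"
proof -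
  obtain i where "x (take i w) * y (drop i w) \<noteq> 0"
    using assms sum.not_neutral_contains_not_neutral unfolding free_mult by blast
  then show ?thesis by (intro exI[of _ "take i w"] exI[of _ "drop i w"]) simp
qed

text \<open>Both sides sum over the ways to cut a word into three pieces. The left side records the
  later cut i and then j \<le> i; reindexing by j and the length i - j of the middle piece gives the
  right side.\<close>

lemma free_mult_assoc:
  "(x \<otimes>\<^bsub>free_star_algebra\<^esub> y) \<otimes>\<^bsub>free_star_algebra\<^esub> z = x \<otimes>\<^bsub>free_star_algebra\<^esub> (y \<otimes>\<^bsub>free_star_algebra\<^esub> z)"
proof
  fix w :: "('a \<times> bool) list"
  let ?n = "length w"
  have "((x \<otimes>\<^bsub>free_star_algebra\<^esub> y) \<otimes>\<^bsub>free_star_algebra\<^esub> z) w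
      = (\<Sum>i\<le>?n. \<Sum>j\<le>i. x (take j w) * y (drop j (take i w)) * z (drop i w))"
    unfolding free_mult sum_distrib_right by (intro sum.cong) (auto simp: min_def)
  also have "\<dots> = (\<Sum>(i, j)\<in>Sigma {..?n} (\<lambda>i. {..i}). x (take j w) * y (drop j (take i w)) * z (drop i w))"
    by (simp add: sum.Sigma)
  also have "\<dots> = (\<Sum>(j, k)\<in>Sigma {..?n} (\<lambda>j. {..?n - j}). x (take j w) * y (take k (drop j w)) * z (drop (j + k) w))"
    by (rule sum.reindex_bij_witness[of _ "\<lambda>(j, k). (j + k, j)" "\<lambda>(i, j). (j, i - j)"])
      (auto simp: drop_take)
  also have "\<dots> = (\<Sum>j\<le>?n. \<Sum>k\<le>?n - j. x (take j w) * y (take k (drop j w)) * z (drop (j + k) w))"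
    by (simp add: sum.Sigma)
  also have "\<dots> = (x \<otimes>\<^bsub>free_star_algebra\<^esub> (y \<otimes>\<^bsub>free_star_algebra\<^esub> z)) w"
    unfolding free_mult sum_distrib_left by (intro sum.cong) (auto simp: mult.assoc add.commute)
  finally show "((x \<otimes>\<^bsub>free_star_algebra\<^esub> y) \<otimes>\<^bsub>free_star_algebra\<^esub> z) w = \<dots>" .
qed

lemma free_complex_star_algebra: "complex_star_algebra (free_star_algebra :: 'g star_poly star_algebra)"
proof -
  let ?F = "free_star_algebra :: 'g star_poly star_algebra"
  have add: "x \<oplus>\<^bsub>?F\<^esub> y \<in> carrier ?F" if "x \<in> carrier ?F" "y \<in> carrier ?F" for x y
    using that unfolding free_carrier free_add
    by (rule rev_finite_subset[OF finite_UnI]) auto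
  have mult: "x \<otimes>\<^bsub>?F\<^esub> y \<in> carrier ?F" if "x \<in> carrier ?F" "y \<in> carrier ?F" for x y
  proof -
    have "{w. (x \<otimes>\<^bsub>?F\<^esub> y) w \<noteq> 0} \<subseteq> (\<lambda>(a, b). a @ b) ` ({w. x w \<noteq> 0} \<times> {w. y w \<noteq> 0})"
      using free_mult_nonzero by fastforce
    then show ?thesis using that unfolding free_carrier by (meson finite_SigmaI finite_imageI finite_subset)
  qed
  have smult: "c \<odot>\<^bsub>?F\<^esub> x \<in> carrier ?F" if "x \<in> carrier ?F" for c x
    using that unfolding free_carrier free_smult by (rule rev_finite_subset) auto
  have star: "star ?F x \<in> carrier ?F" if "x \<in> carrier ?F" for x
  proof -
    have "{w. star ?F x w \<noteq> 0} \<subseteq> word_star ` {w. x w \<noteq> 0}"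
      by (auto simp: free_star intro!: image_eqI[where x="word_star _"])
    then show ?thesis using that unfolding free_carrier by (meson finite_imageI finite_subset)
  qed
  have "ring ?F"
  proof (rule ringI)
    show "abelian_group ?F"
    proof (rule abelian_groupI)
      fix x assume "x \<in> carrier ?F"
      then show "\<exists>y\<in>carrier ?F. y \<oplus>\<^bsub>?F\<^esub> x = \<zero>\<^bsub>?F\<^esub>"
        using smult[of x "-1"] by (auto simp: free_add free_smult free_zero intro!: bexI[of _ "\<lambda>w. - x w"])
      show "\<zero>\<^bsub>?F\<^esub> \<oplus>\<^bsub>?F\<^esub> x = x" by (simp add: free_zero free_add)
    qed (auto simp: add free_carrier[of "\<zero>\<^bsub>?F\<^esub>"], auto simp: free_add free_zero)
    show "monoid ?F"
    proof (rule monoidI)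
      fix x assume "x \<in> carrier ?F"
      show "\<one>\<^bsub>?F\<^esub> \<otimes>\<^bsub>?F\<^esub> x = x"
      proof
        fix w
        have "(\<one>\<^bsub>?F\<^esub> \<otimes>\<^bsub>?F\<^esub> x) w = (\<Sum>i\<le>length w. if i = 0 then x w else 0)"
          unfolding free_mult free_one word_fun_def by (intro sum.cong) auto
        then show "(\<one>\<^bsub>?F\<^esub> \<otimes>\<^bsub>?F\<^esub> x) w = x w" by simp
      qed
      show "x \<otimes>\<^bsub>?F\<^esub> \<one>\<^bsub>?F\<^esub> = x"
      proof
        fix w
        have "(x \<otimes>\<^bsub>?F\<^esub> \<one>\<^bsub>?F\<^esub>) w = (\<Sum>i\<le>length w. if i = length w then x w else 0)"
          unfolding free_mult free_one word_fun_def by (intro sum.cong) auto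
        then show "(x \<otimes>\<^bsub>?F\<^esub> \<one>\<^bsub>?F\<^esub>) w = x w" by simp
      qed
    qed (auto simp: mult free_mult_assoc, simp add: free_one)
  qed (auto simp: fun_eq_iff free_mult free_add sum.distrib algebra_simps)
  then interpret ring ?F .
  show ?thesis
  proof (unfold_locales)
    fix x y :: "'g star_poly"
    show "star ?F (x \<otimes>\<^bsub>?F\<^esub> y) = star ?F y \<otimes>\<^bsub>?F\<^esub> star ?F x"
    proof
      fix w :: "('g \<times> bool) list"
      let ?n = "length w"
      have "star ?F (x \<otimes>\<^bsub>?F\<^esub> y) w
          = (\<Sum>i\<le>?n. cnj (x (take i (word_star w))) * cnj (y (drop i (word_star w))))"
        by (simp add: free_star free_mult)
      also have "\<dots> = (\<Sum>i\<le>?n. cnj (y (word_star (take i w))) * cnj (x (word_star (drop i w))))"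
        by (rule sum.reindex_bij_witness[of _ "\<lambda>i. ?n - i" "\<lambda>i. ?n - i"])
          (auto simp: word_star_take word_star_drop)
      also have "\<dots> = (star ?F y \<otimes>\<^bsub>?F\<^esub> star ?F x) w"
        by (simp add: free_star free_mult)
      finally show "star ?F (x \<otimes>\<^bsub>?F\<^esub> y) w = \<dots>" .
    qed
  qed (auto simp: add mult smult star,
      auto simp: fun_eq_iff free_add free_smult free_star free_mult algebra_simps sum_distrib_left)
qed

lemma word_fun_mult: "word_fun a \<otimes>\<^bsub>free_star_algebra\<^esub> word_fun b = word_fun (a @ b)"
proof
  fix w :: "('a \<times> bool) list"
  have iff: "take i w = a \<and> drop i w = b \<longleftrightarrow> i = length a \<and> w = a @ b" if "i \<le> length w" for i
  proof
    assume "take i w = a \<and> drop i w = b"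
    then show "i = length a \<and> w = a @ b" using that append_take_drop_id[of i w] by force
  qed simp
  have "(word_fun a \<otimes>\<^bsub>free_star_algebra\<^esub> word_fun b) w
      = (\<Sum>i\<le>length w. if take i w = a \<and> drop i w = b then 1 else 0)"
    unfolding free_mult word_fun_def by (intro sum.cong) auto
  also have "\<dots> = (\<Sum>i\<le>length w. if i = length a \<and> w = a @ b then 1 else 0)"
    by (intro sum.cong refl if_cong) (simp only: iff atMost_iff)
  also have "\<dots> = word_fun (a @ b) w" by (cases "w = a @ b") (auto simp: word_fun_def)
  finally show "(word_fun a \<otimes>\<^bsub>free_star_algebra\<^esub> word_fun b) w = word_fun (a @ b) w" .
qed

lemma word_fun_star: "star free_star_algebra (word_fun w) = word_fun (word_star w)"
  by (auto simp: free_star word_fun_def fun_eq_iff)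

text \<open>Removing one word at a time from the finite support reduces linear statements to
  words.\<close>

lemma free_induct [consumes 1, case_names zero add]:
  assumes "x \<in> carrier free_star_algebra" and "P \<zero>\<^bsub>free_star_algebra\<^esub>"
    and add: "\<And>c w x. x \<in> carrier free_star_algebra \<Longrightarrow> P x \<Longrightarrow>
      P ((c \<odot>\<^bsub>free_star_algebra\<^esub> word_fun w) \<oplus>\<^bsub>free_star_algebra\<^esub> x)"
  shows "P x"
proof -
  have "\<forall>x. {w. x w \<noteq> 0} = S \<longrightarrow> P x" if "finite S" for S
    using that
  proof (induction S)
    case empty
    have "x = \<zero>\<^bsub>free_star_algebra\<^esub>" if "{w. x w \<noteq> 0} = {}" for x :: "'a star_poly"
      unfolding free_zero using that by blast
    then show ?case using assms(2) by blast
  next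
    case (insert w S)
    show ?case
    proof (intro allI impI)
      fix x :: "'a star_poly" assume x: "{v. x v \<noteq> 0} = insert w S"
      have S: "{v. (x(w := 0)) v \<noteq> 0} = S" using x insert(2) by auto
      then have "P (x(w := 0))" using insert(3) by blast
      moreover have "x(w := 0) \<in> carrier free_star_algebra" unfolding free_carrier S by fact
      ultimately have "P ((x w \<odot>\<^bsub>free_star_algebra\<^esub> word_fun w) \<oplus>\<^bsub>free_star_algebra\<^esub> x(w := 0))"
        by (rule add[rotated])
      moreover have "(x w \<odot>\<^bsub>free_star_algebra\<^esub> word_fun w) \<oplus>\<^bsub>free_star_algebra\<^esub> x(w := 0) = x"
        by (auto simp: free_add free_smult word_fun_def fun_eq_iff)
      ultimately show "P x" by simp
    qed
  qed
  then show ?thesis using assms(1) by (auto simp: free_carrier)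
qed

lemma free_hom_eqI:
  assumes \<phi>: "star_hom free_star_algebra B \<phi>" and \<psi>: "star_hom free_star_algebra B \<psi>"
    and B: "complex_star_algebra B" and eq: "\<And>g. \<phi> (free_gen g) = \<psi> (free_gen g)"
    and x: "x \<in> carrier free_star_algebra"
  shows "\<phi> x = \<psi> x"
proof -
  interpret F: complex_star_algebra free_star_algebra by (rule free_complex_star_algebra)
  interpret B: complex_star_algebra B by fact
  have letter: "\<phi> (word_fun [l]) = \<psi> (word_fun [l])" for l
  proof (cases l)
    case (Pair g b)
    have "word_fun [(g, True)] = star free_star_algebra (free_gen g)"
      by (simp add: free_gen_word_fun word_fun_star word_star_def)
    then show ?thesis
      using eq[of g] Pair by (cases b) (simp_all add: star_hom_star[OF \<phi>] star_hom_star[OF \<psi>] free_gen_word_fun[symmetric])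
  qed
  have word: "\<phi> (word_fun w) = \<psi> (word_fun w)" for w
  proof (induction w)
    case Nil
    then show ?case using star_hom_one[OF \<phi>] star_hom_one[OF \<psi>] by (simp add: free_one)
  next
    case (Cons l w)
    have "word_fun (l # w) = word_fun [l] \<otimes>\<^bsub>free_star_algebra\<^esub> word_fun w" by (simp add: word_fun_mult)
    then show ?case using Cons by (simp add: star_hom_mult[OF \<phi>] star_hom_mult[OF \<psi>] letter)
  qed
  have "\<phi> \<zero>\<^bsub>free_star_algebra\<^esub> = \<psi> \<zero>\<^bsub>free_star_algebra\<^esub>"
    using star_hom_smult[OF \<phi> F.zero_closed, of 0] star_hom_smult[OF \<psi> F.zero_closed, of 0]
      star_hom_closed[OF \<phi> F.zero_closed] star_hom_closed[OF \<psi> F.zero_closed] by simp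
  with x show ?thesis
    by (induction rule: free_induct)
      (simp_all add: star_hom_add[OF \<phi>] star_hom_add[OF \<psi>] star_hom_smult[OF \<phi>] star_hom_smult[OF \<psi>] word)
qed

section \<open>Universal property of the free *-algebra\<close>

context complex_star_algebra
begin

fun word_eval :: "('g \<Rightarrow> 'a) \<Rightarrow> ('g \<times> bool) list \<Rightarrow> 'a" where
  "word_eval b [] = \<one>"
| "word_eval b ((g, s) # w) = (if s then star A (b g) else b g) \<otimes> word_eval b w"

definition free_eval :: "('g \<Rightarrow> 'a) \<Rightarrow> 'g star_poly \<Rightarrow> 'a" where
  "free_eval b x = (\<Oplus>w\<in>{w. x w \<noteq> 0}. x w \<odot> word_eval b w)"

lemma word_eval_closed [simp]:
  assumes "\<And>g. b g \<in> carrier A" shows "word_eval b w \<in> carrier A"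
  by (induction w) (auto simp: assms)

lemma word_eval_append:
  assumes "\<And>g. b g \<in> carrier A" shows "word_eval b (v @ w) = word_eval b v \<otimes> word_eval b w"
  by (induction v) (auto simp: assms m_assoc)

lemma word_eval_star:
  assumes "\<And>g. b g \<in> carrier A" shows "word_eval b (word_star w) = star A (word_eval b w)"
proof (induction w)
  case (Cons l w)
  have "word_star (l # w) = word_star w @ [apsnd Not l]" by (simp add: word_star_def)
  then show ?case using Cons by (cases l) (simp add: word_eval_append assms star_mult)
qed (simp add: word_star_def)

lemma finsum_smult:
  assumes "finite S" "f \<in> S \<rightarrow> carrier A"
  shows "(\<Oplus>i\<in>S. c \<odot> f i) = c \<odot> (\<Oplus>i\<in>S. f i)"
  using assms
proof (induction S)
  case (insert i S)
  then have "f i \<in> carrier A" "f \<in> S \<rightarrow> carrier A" by auto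
  then show ?case using insert by (simp add: smult_r_distr Pi_iff)
qed simp

lemma free_eval_superset:
  assumes b: "\<And>g. b g \<in> carrier A" and "finite S" "{w. x w \<noteq> 0} \<subseteq> S"
  shows "free_eval b x = (\<Oplus>w\<in>S. x w \<odot> word_eval b w)"
  unfolding free_eval_def
  by (rule add.finprod_mono_neutral_cong_left) (use assms in \<open>auto simp: Pi_iff\<close>)

lemma free_eval_hom:
  assumes b: "\<And>g. b g \<in> carrier A"
  shows "star_hom free_star_algebra A (free_eval b)"
    and "free_eval b (free_gen g) = b g"
    and "free_eval b (word_fun w) = word_eval b w"
proof -
  interpret F: complex_star_algebra free_star_algebra by (rule free_complex_star_algebra)
  note [simp] = word_eval_closed[of b, OF b]
  let ?F = free_star_algebra
  have closed [simp]: "free_eval b x \<in> carrier A" for x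
    by (auto simp: free_eval_def intro!: finsum_closed)
  have add: "free_eval b (x \<oplus>\<^bsub>?F\<^esub> y) = free_eval b x \<oplus> free_eval b y"
    if "x \<in> carrier ?F" "y \<in> carrier ?F" for x y
  proof -
    let ?S = "{w. x w \<noteq> 0} \<union> {w. y w \<noteq> 0}"
    have S: "finite ?S" using that by (simp add: free_carrier)
    have "free_eval b (x \<oplus>\<^bsub>?F\<^esub> y) = (\<Oplus>w\<in>?S. (x w + y w) \<odot> word_eval b w)"
      unfolding free_add by (rule free_eval_superset[OF b S]) auto
    also have "\<dots> = (\<Oplus>w\<in>?S. x w \<odot> word_eval b w \<oplus> y w \<odot> word_eval b w)"
      by (intro finsum_cong') (auto simp: smult_l_distr)
    also have "\<dots> = (\<Oplus>w\<in>?S. x w \<odot> word_eval b w) \<oplus> (\<Oplus>w\<in>?S. y w \<odot> word_eval b w)"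
      by (rule finsum_addf) auto
    also have "\<dots> = free_eval b x \<oplus> free_eval b y"
      using free_eval_superset[of b ?S x, OF b S] free_eval_superset[of b ?S y, OF b S]
      by simp
    finally show ?thesis .
  qed
  have smult: "free_eval b (c \<odot>\<^bsub>?F\<^esub> x) = c \<odot> free_eval b x" if "x \<in> carrier ?F" for c x
  proof -
    let ?S = "{w. x w \<noteq> 0}"
    have S: "finite ?S" using that by (simp add: free_carrier)
    have "free_eval b (c \<odot>\<^bsub>?F\<^esub> x) = (\<Oplus>w\<in>?S. (c * x w) \<odot> word_eval b w)"
      unfolding free_smult by (rule free_eval_superset[OF b S]) auto
    also have "\<dots> = (\<Oplus>w\<in>?S. c \<odot> (x w \<odot> word_eval b w))"
      by (intro finsum_cong') (auto simp: smult_smult)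
    also have "\<dots> = c \<odot> free_eval b x"
      using finsum_smult[OF S] by (simp add: free_eval_def)
    finally show ?thesis .
  qed
  have word: "free_eval b (word_fun w) = word_eval b w" for w
    using free_eval_superset[of b "{w}" "word_fun w", OF b]
    by (simp add: word_fun_def)
  have zero: "free_eval b \<zero>\<^bsub>?F\<^esub> = \<zero>" by (simp add: free_eval_def free_zero)
  \<comment> \<open>Multiplicativity is bilinear, so it is checked by two inductions: first in the
    right factor with a word on the left, then in the left factor.\<close>
  have mult1: "free_eval b (word_fun v \<otimes>\<^bsub>?F\<^esub> y) = word_eval b v \<otimes> free_eval b y"
    if "y \<in> carrier ?F" for v y
    using that
    by (induction rule: free_induct)
      (simp_all add: zero F.r_distr add F.smult_mult_right smult word_fun_mult word word_eval_append b
        r_distr smult_mult_right)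
  have mult: "free_eval b (x \<otimes>\<^bsub>?F\<^esub> y) = free_eval b x \<otimes> free_eval b y"
    if x: "x \<in> carrier ?F" and y: "y \<in> carrier ?F" for x y
    using x
    by (induction rule: free_induct)
      (simp_all add: zero y F.l_distr add F.smult_mult_left smult mult1 word l_distr smult_mult_left)
  have star: "free_eval b (star ?F x) = star A (free_eval b x)" if "x \<in> carrier ?F" for x
    using that
    by (induction rule: free_induct)
      (simp_all add: zero F.star_add F.star_smult add smult star_add star_smult word_fun_star word
        word_eval_star b)
  show "star_hom ?F A (free_eval b)"
    by (rule star_homI) (auto simp: add smult mult star free_one word)
  show "free_eval b (word_fun w) = word_eval b w" by (rule word)
  show "free_eval b (free_gen g) = b g" using b by (simp add: free_gen_word_fun word)
qed

end

section \<open>Integer powers of unitaries\<close>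

context complex_star_algebra
begin

lemma unitary_Units: "unitary w \<Longrightarrow> w \<in> Units A"
  unfolding Units_def unitary_def by auto

lemma unitary_inv: "unitary w \<Longrightarrow> inv w = star A w"
  using inv_unique'[of w "star A w"] by (simp add: unitary_def)

lemma units_of_nat_pow: "w [^]\<^bsub>units_of A\<^esub> (n :: nat) = w [^] n"
  by (simp add: nat_pow_def units_of_def)

text \<open>The laws for integer exponents hold in groups, and unitaries lie in the group of units.
  This identifies powers there with powers in the algebra.\<close>

lemma units_of_int_pow:
  assumes "w \<in> Units A"
  shows "w [^]\<^bsub>units_of A\<^esub> (k :: int) = w [^] k"
proof -
  interpret U: group "units_of A" by (rule units_group)
  have "w [^] n \<in> Units A" for n :: nat
    using U.nat_pow_closed[of w n] assms by (simp add: units_of_carrier units_of_nat_pow)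
  then show ?thesis unfolding int_pow_def2 units_of_nat_pow by (simp only: units_of_inv)
qed

lemma unitary_int_pow_add:
  assumes "unitary w" shows "w [^] (k + l :: int) = w [^] k \<otimes> w [^] l"
proof -
  interpret U: group "units_of A" by (rule units_group)
  show ?thesis
    using U.int_pow_mult[of w k l] unitary_Units[OF assms]
    by (simp add: units_of_int_pow units_of_carrier units_of_mult)
qed

lemma unitary_nat_pow: "unitary w \<Longrightarrow> unitary (w [^] (n :: nat))"
  by (induction n) (simp_all add: unitary_one unitary_mult)

lemma unitary_int_pow_neg:
  assumes "unitary w" shows "w [^] (- int n) = star A (w [^] n)"
  using unitary_inv[OF unitary_nat_pow[OF assms, of n]] by (cases "n = 0") (simp_all add: int_pow_def2 del: pow_nat)

lemma unitary_int_pow: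
  assumes "unitary w" shows "unitary (w [^] (k :: int))"
  by (cases k rule: int_cases2)
    (simp_all add: assms int_pow_int unitary_int_pow_neg unitary_nat_pow unitary_star)

lemma unitary_int_pow_one: "unitary w \<Longrightarrow> w [^] (1 :: int) = w"
  using int_pow_int[of A w 1] by simp

lemma unitary_int_pow_minus_one: "unitary w \<Longrightarrow> w [^] (- 1 :: int) = star A w"
  using unitary_int_pow_neg[of w 1] by simp

end

lemma star_hom_nat_pow:
  assumes "complex_star_algebra A" "star_hom A B \<phi>" "x \<in> carrier A"
  shows "\<phi> (x [^]\<^bsub>A\<^esub> (n :: nat)) = \<phi> x [^]\<^bsub>B\<^esub> n"
proof -
  interpret complex_star_algebra A by fact
  show ?thesis
    by (induction n) (use assms in \<open>simp_all add: star_hom_mult star_hom_one\<close>)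
qed

lemma star_hom_int_pow:
  assumes "complex_star_algebra A" "complex_star_algebra B" "star_hom A B \<phi>"
    and "complex_star_algebra.unitary A w"
  shows "\<phi> (w [^]\<^bsub>A\<^esub> (k :: int)) = \<phi> w [^]\<^bsub>B\<^esub> k"
proof -
  interpret A: complex_star_algebra A by fact
  interpret B: complex_star_algebra B by fact
  have "B.unitary (\<phi> w)" using star_hom_unitary[OF assms] .
  then show ?thesis
    using assms(4) star_hom_nat_pow[OF assms(1,3), of w] star_hom_star[OF assms(3)]
    by (cases k rule: int_cases2)
      (simp_all add: int_pow_int A.unitary_int_pow_neg B.unitary_int_pow_neg)
qed

section \<open>Continuous functions on the circle\<close>

lemma circle_carrier: "h \<in> carrier circle_algebra \<longleftrightarrow> h \<in> extensional unit_circle \<and> continuous_on unit_circle h"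
  and circle_mult: "h \<otimes>\<^bsub>circle_algebra\<^esub> k = (\<lambda>z\<in>unit_circle. h z * k z)"
  and circle_one: "\<one>\<^bsub>circle_algebra\<^esub> = (\<lambda>z\<in>unit_circle. 1)"
  and circle_zero: "\<zero>\<^bsub>circle_algebra\<^esub> = (\<lambda>z\<in>unit_circle. 0)"
  and circle_add: "h \<oplus>\<^bsub>circle_algebra\<^esub> k = (\<lambda>z\<in>unit_circle. h z + k z)"
  and circle_smult: "c \<odot>\<^bsub>circle_algebra\<^esub> h = (\<lambda>z\<in>unit_circle. c * h z)"
  and circle_star: "star circle_algebra h = (\<lambda>z\<in>unit_circle. cnj (h z))"
  by (simp_all add: circle_algebra_def)

lemma restrict_circle_closed:
  "restrict h unit_circle \<in> carrier circle_algebra \<longleftrightarrow> continuous_on unit_circle h"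
  using continuous_on_cong[OF refl, of unit_circle "restrict h unit_circle" h] by (simp add: circle_carrier)

lemma circle_complex_star_algebra: "complex_star_algebra circle_algebra"
proof -
  note simps = circle_mult circle_one circle_zero circle_add circle_smult circle_star
  have eqI: "h = k" if "h \<in> extensional unit_circle" "k \<in> extensional unit_circle"
    "\<And>z. z \<in> unit_circle \<Longrightarrow> h z = k z" for h k :: "complex \<Rightarrow> complex"
    using that by (rule extensionalityI)
  have cont: "h \<in> carrier circle_algebra \<Longrightarrow> continuous_on unit_circle h"
    and ext: "h \<in> carrier circle_algebra \<Longrightarrow> h \<in> extensional unit_circle" for h
    by (simp_all add: circle_carrier)
  have closed:
    "x \<in> carrier circle_algebra \<Longrightarrow> y \<in> carrier circle_algebra \<Longrightarrow>
      (\<lambda>z\<in>unit_circle. x z + y z) \<in> carrier circle_algebra"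
    "x \<in> carrier circle_algebra \<Longrightarrow> y \<in> carrier circle_algebra \<Longrightarrow>
      (\<lambda>z\<in>unit_circle. x z * y z) \<in> carrier circle_algebra"
    "(\<lambda>z\<in>unit_circle. c) \<in> carrier circle_algebra"
    "x \<in> carrier circle_algebra \<Longrightarrow> (\<lambda>z\<in>unit_circle. c * x z) \<in> carrier circle_algebra"
    "x \<in> carrier circle_algebra \<Longrightarrow> (\<lambda>z\<in>unit_circle. - x z) \<in> carrier circle_algebra"
    "x \<in> carrier circle_algebra \<Longrightarrow> (\<lambda>z\<in>unit_circle. cnj (x z)) \<in> carrier circle_algebra" for x y c
    unfolding restrict_circle_closed by (auto intro!: continuous_intros dest!: cont)
  have "ring circle_algebra"
  proof (rule ringI)
    show "abelian_group circle_algebra"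
    proof (rule abelian_groupI)
      fix x assume x: "x \<in> carrier circle_algebra"
      show "\<exists>y\<in>carrier circle_algebra. y \<oplus>\<^bsub>circle_algebra\<^esub> x = \<zero>\<^bsub>circle_algebra\<^esub>"
        by (rule bexI[OF _ closed(5)[OF x]]) (auto simp: simps intro!: eqI)
    qed (auto simp: simps closed ext intro!: eqI)
    show "monoid circle_algebra"
      by (rule monoidI) (auto simp: simps closed ext intro!: eqI)
  qed (auto simp: simps algebra_simps intro!: eqI)
  then interpret ring circle_algebra .
  show ?thesis
    by unfold_locales (auto simp: simps algebra_simps closed ext intro!: eqI)
qed

interpretation circle: complex_star_algebra circle_algebra
  by (rule circle_complex_star_algebra)

section \<open>The supremum norm on the circle\<close>

definition circle_norm :: "(complex \<Rightarrow> complex) \<Rightarrow> real" where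
  "circle_norm h = (SUP z\<in>unit_circle. cmod (h z))"

lemma circle_norm_upper:
  assumes "h \<in> carrier circle_algebra" "z \<in> unit_circle"
  shows "cmod (h z) \<le> circle_norm h"
proof -
  have "compact ((\<lambda>z. cmod (h z)) ` unit_circle)"
    using assms by (intro compact_continuous_image continuous_intros) (auto simp: circle_carrier)
  then have "bdd_above ((\<lambda>z. cmod (h z)) ` unit_circle)"
    by (simp add: bounded_imp_bdd_above compact_imp_bounded)
  then show ?thesis unfolding circle_norm_def using assms(2) by (intro cSUP_upper)
qed

lemma one_in_unit_circle: "(1 :: complex) \<in> unit_circle"
  by simp

lemma circle_norm_least:
  assumes "\<And>z. z \<in> unit_circle \<Longrightarrow> cmod (h z) \<le> M"
  shows "circle_norm h \<le> M"
  unfolding circle_norm_def using assms one_in_unit_circle by (intro cSUP_least) blast+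

lemma circle_norm_nonneg: "h \<in> carrier circle_algebra \<Longrightarrow> 0 \<le> circle_norm h"
  using circle_norm_upper[OF _ one_in_unit_circle] norm_ge_zero order_trans by blast

lemma circle_minus:
  assumes "h \<in> carrier circle_algebra" "k \<in> carrier circle_algebra" "z \<in> unit_circle"
  shows "(h \<ominus>\<^bsub>circle_algebra\<^esub> k) z = h z - k z"
  using assms by (simp add: circle.minus_eq_smult circle_add circle_smult)

lemma circle_seminormed: "cstar_seminormed circle_algebra circle_norm"
proof -
  have smult_le: "circle_norm (c \<odot>\<^bsub>circle_algebra\<^esub> h) \<le> cmod c * circle_norm h"
    if "h \<in> carrier circle_algebra" for c h
    using that by (intro circle_norm_least) (auto simp: circle_smult norm_mult intro!: mult_left_mono circle_norm_upper)
  have smult: "circle_norm (c \<odot>\<^bsub>circle_algebra\<^esub> h) = cmod c * circle_norm h"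
    if h: "h \<in> carrier circle_algebra" for c h
  proof (cases "c = 0")
    case True
    have "circle_norm (\<zero>\<^bsub>circle_algebra\<^esub>) = 0"
      using circle_norm_nonneg[of "\<zero>\<^bsub>circle_algebra\<^esub>"]
        circle_norm_least[of "\<zero>\<^bsub>circle_algebra\<^esub>" 0] circle.zero_closed by (simp add: circle_zero)
    then show ?thesis using True h by simp
  next
    case False
    have "circle_norm h \<le> cmod (1 / c) * circle_norm (c \<odot>\<^bsub>circle_algebra\<^esub> h)"
      using smult_le[of "c \<odot>\<^bsub>circle_algebra\<^esub> h" "1 / c"] False h by (simp add: circle.smult_smult)
    then have "cmod c * circle_norm h \<le> circle_norm (c \<odot>\<^bsub>circle_algebra\<^esub> h)"
      using False by (simp add: norm_divide field_simps)
    then show ?thesis using smult_le[OF h, of c] by simp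
  qed
  have add: "circle_norm (h \<oplus>\<^bsub>circle_algebra\<^esub> k) \<le> circle_norm h + circle_norm k"
    if "h \<in> carrier circle_algebra" "k \<in> carrier circle_algebra" for h k
    using that by (intro circle_norm_least)
      (auto simp: circle_add intro!: norm_triangle_le add_mono circle_norm_upper)
  have mult: "circle_norm (h \<otimes>\<^bsub>circle_algebra\<^esub> k) \<le> circle_norm h * circle_norm k"
    if "h \<in> carrier circle_algebra" "k \<in> carrier circle_algebra" for h k
    using that by (intro circle_norm_least)
      (auto simp: circle_mult norm_mult circle_norm_nonneg intro!: mult_mono circle_norm_upper)
  have star: "circle_norm (star circle_algebra h \<otimes>\<^bsub>circle_algebra\<^esub> h) = (circle_norm h)\<^sup>2"
    if h: "h \<in> carrier circle_algebra" for h
  proof (rule antisym)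
    let ?g = "star circle_algebra h \<otimes>\<^bsub>circle_algebra\<^esub> h"
    have g: "cmod (?g z) = (cmod (h z))\<^sup>2" if "z \<in> unit_circle" for z
      using that by (simp add: circle_mult circle_star norm_mult power2_eq_square)
    show "circle_norm ?g \<le> (circle_norm h)\<^sup>2"
      by (rule circle_norm_least) (simp only: g, intro power_mono circle_norm_upper h, auto)
    have "cmod (h z) \<le> sqrt (circle_norm ?g)" if "z \<in> unit_circle" for z
      using circle_norm_upper[of ?g z] that h g[OF that] by (simp add: real_le_rsqrt)
    then have "circle_norm h \<le> sqrt (circle_norm ?g)" by (rule circle_norm_least)
    then show "(circle_norm h)\<^sup>2 \<le> circle_norm ?g"
      using circle_norm_nonneg[OF h] circle_norm_nonneg[of ?g] h
      by (metis circle.m_closed circle.star_closed power_mono real_sqrt_pow2)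
  qed
  show ?thesis
    by (intro cstar_seminormed.intro circle_complex_star_algebra cstar_seminormed_axioms.intro)
      (simp add: cstar_seminorm_def smult add mult star circle_norm_nonneg)
qed

interpretation circle: cstar_seminormed circle_algebra circle_norm
  by (rule circle_seminormed)

lemma circle_unitaryI:
  assumes "h \<in> carrier circle_algebra" "\<And>z. z \<in> unit_circle \<Longrightarrow> cmod (h z) = 1"
  shows "circle.unitary h"
proof -
  have "cnj (h z) * h z = 1" "h z * cnj (h z) = 1" if "z \<in> unit_circle" for z
    using assms(2)[OF that] by (simp_all add: complex_norm_square[symmetric] mult.commute[of "cnj (h z)"])
  then show ?thesis using assms(1)
    unfolding circle.unitary_def circle_star circle_mult circle_one
    by (auto intro!: restrict_ext)
qed

text \<open>The counterpart of x + i sqrt(1 - x^2) with the square root taken pointwise: a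
  selfadjoint h is real valued, and norm below 1 keeps the radicand nonnegative.\<close>

lemma circle_averages_of_unitaries: "circle.averages_of_unitaries"
  unfolding circle.averages_of_unitaries_def
proof (intro ballI impI, elim conjE)
  fix h assume h: "h \<in> carrier circle_algebra" "star circle_algebra h = h" "circle_norm h < 1"
  have real: "Im (h z) = 0" if "z \<in> unit_circle" for z
  proof -
    have "cnj (h z) = h z" using fun_cong[OF h(2), of z] that by (simp add: circle_star)
    then show ?thesis by (metis complex_cnj_cancel_iff complex_In_mult_cnj_zero complex_is_Real_iff Reals_cnj_iff)
  qed
  define w where "w = (\<lambda>z\<in>unit_circle. Complex (Re (h z)) (sqrt (1 - (Re (h z))\<^sup>2)))"
  have le: "(Re (h z))\<^sup>2 \<le> 1" if "z \<in> unit_circle" for z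
    using circle_norm_upper[OF h(1) that] h(3) abs_Re_le_cmod[of "h z"] by (simp add: abs_square_le_1)
  have "continuous_on unit_circle h" using h by (simp add: circle_carrier)
  then have w: "w \<in> carrier circle_algebra"
    unfolding w_def restrict_circle_closed Complex_eq by (intro continuous_intros)
  have "circle.unitary w"
    by (rule circle_unitaryI[OF w]) (use le in \<open>auto simp: w_def cmod_def\<close>)
  moreover have "h \<oplus>\<^bsub>circle_algebra\<^esub> h = w \<oplus>\<^bsub>circle_algebra\<^esub> star circle_algebra w"
    unfolding circle_add circle_star w_def
    by (intro restrict_ext) (use real in \<open>auto simp: complex_eq_iff\<close>)
  ultimately show "\<exists>w. circle.unitary w \<and> h \<oplus>\<^bsub>circle_algebra\<^esub> h = w \<oplus>\<^bsub>circle_algebra\<^esub> star circle_algebra w"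
    by blast
qed

definition circle_id :: "complex \<Rightarrow> complex" where
  "circle_id = (\<lambda>z\<in>unit_circle. z)"

lemma circle_id_unitary: "circle.unitary circle_id"
  by (rule circle_unitaryI) (auto simp: circle_id_def restrict_circle_closed)

lemma circle_id_closed [simp]: "circle_id \<in> carrier circle_algebra"
  using circle_id_unitary by simp

lemma circle_id_nat_pow: "z \<in> unit_circle \<Longrightarrow> (circle_id [^]\<^bsub>circle_algebra\<^esub> (n :: nat)) z = z ^ n"
  by (induction n) (simp_all add: circle_one circle_mult circle_id_def)

lemma circle_id_int_pow:
  assumes "z \<in> unit_circle" shows "(circle_id [^]\<^bsub>circle_algebra\<^esub> (k :: int)) z = z powi k"
proof (cases k rule: int_cases2)
  case (nonneg n)
  then show ?thesis using assms by (simp add: int_pow_int circle_id_nat_pow)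
next
  case (nonpos n)
  have "z * cnj z = 1" using assms by (simp add: complex_norm_square[symmetric])
  then have "inverse z = cnj z" by (rule inverse_unique)
  then show ?thesis
    using nonpos assms circle.unitary_int_pow_neg[OF circle_id_unitary, of n]
    by (simp add: circle_star circle_id_nat_pow power_int_minus flip: power_inverse)
qed

lemma circle_finsum:
  assumes "finite S" "f \<in> S \<rightarrow> carrier circle_algebra" "z \<in> unit_circle"
  shows "(\<Oplus>\<^bsub>circle_algebra\<^esub>i\<in>S. f i) z = (\<Sum>i\<in>S. f i z)"
  using assms
proof (induction S)
  case empty
  then show ?case by (simp add: circle_zero)
next
  case (insert i S)
  then have "f i \<in> carrier circle_algebra" "f \<in> S \<rightarrow> carrier circle_algebra" by auto
  then show ?case using insert by (simp add: circle_add)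
qed

section \<open>Functional calculus of a unitary\<close>

text \<open>Discrete Fourier inversion: averaging the polynomial times \<open>\<omega>^(-k)\<close>
  over the M-th roots of unity \<open>\<omega>\<close> isolates \<open>c k\<close>, and every term
  of the average has modulus at most S.\<close>

lemma laurent_coeff_bound:
  fixes c :: "int \<Rightarrow> complex" and N :: nat
  assumes le: "\<And>z. z \<in> unit_circle \<Longrightarrow> cmod (\<Sum>k\<in>{- int N..int N}. c k * z powi k) \<le> S"
    and k: "k \<in> {- int N..int N}"
  shows "cmod (c k) \<le> S"
proof -
  \<comment> \<open>Two exponents differ by at most 2 N, so M = 2 N + 1 is large enough to separate
    them modulo M.\<close>
  define M where "M = 2 * N + 1"
  define \<omega> where "\<omega> j = cis (2 * pi * real j / real M)" for j
  have \<omega>: "\<omega> j \<in> unit_circle" "\<omega> j \<noteq> 0" for j by (simp_all add: \<omega>_def)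
  have orth: "(\<Sum>j<M. \<omega> j powi m) = (if m = 0 then of_nat M else 0)" if "\<bar>m\<bar> < int M" for m
  proof (cases "m = 0")
    case False
    define \<zeta> where "\<zeta> = cis (2 * pi * real_of_int m / real M)"
    have "\<zeta> \<noteq> 1"
    proof
      assume "\<zeta> = 1"
      then obtain n :: int where "2 * pi * real_of_int m / real M = of_int (2 * n) * pi"
        unfolding \<zeta>_def cis_conv_exp exp_eq_1 by auto
      then have "2 * pi * real_of_int m = 2 * pi * (real_of_int n * real M)"
        using M_def by (simp add: divide_simps mult_ac)
      then have "real_of_int m = real_of_int (n * int M)" by simp
      then have "m = n * int M" by linarith
      then show False using that False by (auto simp: abs_mult)
    qed
    moreover have "\<zeta> ^ M = 1"
    proof -
      have "real M * (2 * pi * real_of_int m / real M) = 2 * pi * real_of_int m"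
        unfolding M_def by simp
      then show ?thesis unfolding \<zeta>_def Complex.DeMoivre by (simp add: cis_multiple_2pi)
    qed
    moreover have "\<omega> j powi m = \<zeta> ^ j" for j
      unfolding \<omega>_def \<zeta>_def Complex.DeMoivre cis_power_int by (simp add: mult_ac)
    ultimately show ?thesis using False by (simp add: geometric_sum)
  qed simp
  have "(\<Sum>j<M. (\<Sum>l\<in>{- int N..int N}. c l * \<omega> j powi l) * \<omega> j powi (- k))
      = (\<Sum>j<M. \<Sum>l\<in>{- int N..int N}. c l * \<omega> j powi (l - k))"
    using \<omega>(2) by (simp add: sum_distrib_right mult.assoc power_int_add[symmetric])
  also have "\<dots> = (\<Sum>l\<in>{- int N..int N}. c l * (\<Sum>j<M. \<omega> j powi (l - k)))"
    by (subst sum.swap) (simp add: sum_distrib_left)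
  also have "\<dots> = (\<Sum>l\<in>{- int N..int N}. if l = k then c l * of_nat M else 0)"
  proof (intro sum.cong refl)
    fix l assume "l \<in> {- int N..int N}"
    then have "\<bar>l - k\<bar> < int M" using k by (auto simp: M_def)
    then show "c l * (\<Sum>j<M. \<omega> j powi (l - k)) = (if l = k then c l * of_nat M else 0)"
      using orth[of "l - k"] by simp
  qed
  also have "\<dots> = c k * of_nat M" using k by simp
  finally have "cmod (c k) * real M
      = cmod (\<Sum>j<M. (\<Sum>l\<in>{- int N..int N}. c l * \<omega> j powi l) * \<omega> j powi (- k))"
    by (simp add: norm_mult)
  also have "\<dots> \<le> (\<Sum>j<M. S)"
    using le[OF \<omega>(1)] \<omega>(1) by (intro sum_norm_le) (simp add: norm_mult norm_power_int)
  also have "\<dots> = S * real M" by simp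
  finally show ?thesis by (simp add: M_def)
qed

text \<open>In the free *-algebra the generator and its adjoint are independent letters. Once a
  unitary is substituted, the value of a word depends only on this net exponent.\<close>

fun word_exp :: "(unit \<times> bool) list \<Rightarrow> int" where
  "word_exp [] = 0"
| "word_exp ((g, s) # w) = (if s then - 1 else 1) + word_exp w"

lemma abs_word_exp_le: "\<bar>word_exp w\<bar> \<le> int (length w)"
  by (induction w rule: word_exp.induct) auto

definition laurent_coeff :: "unit star_poly \<Rightarrow> int \<Rightarrow> complex" where
  "laurent_coeff x k = (\<Sum>w\<in>{w. x w \<noteq> 0 \<and> word_exp w = k}. x w)"

definition degree_le :: "'g star_poly \<Rightarrow> nat \<Rightarrow> bool" where
  "degree_le x N \<longleftrightarrow> (\<forall>w. x w \<noteq> 0 \<longrightarrow> length w \<le> N)"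

lemma degree_le_exists:
  assumes "x \<in> carrier free_star_algebra" obtains N where "degree_le x N"
proof
  show "degree_le x (Max (length ` {w. x w \<noteq> 0}))"
    using assms by (auto simp: degree_le_def free_carrier)
qed

lemma degree_le_mult:
  assumes "degree_le x M" "degree_le y N" shows "degree_le (x \<otimes>\<^bsub>free_star_algebra\<^esub> y) (M + N)"
  unfolding degree_le_def
proof (intro allI impI)
  fix w assume "(x \<otimes>\<^bsub>free_star_algebra\<^esub> y) w \<noteq> 0"
  then obtain a b where "w = a @ b" "x a \<noteq> 0" "y b \<noteq> 0" using free_mult_nonzero by blast
  then show "length w \<le> M + N" using assms by (simp add: degree_le_def add_mono)
qed

lemma degree_le_pow: "degree_le x N \<Longrightarrow> degree_le (x [^]\<^bsub>free_star_algebra\<^esub> (n :: nat)) (n * N)"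
proof (induction n)
  case 0
  then show ?case by (simp add: degree_le_def free_one word_fun_def)
next
  case (Suc n)
  then show ?case using degree_le_mult[of _ "n * N" x N] by (simp add: add.commute)
qed

context complex_star_algebra
begin

lemma word_eval_unitary:
  assumes "unitary u" shows "word_eval (\<lambda>_. u) w = u [^] word_exp w"
proof (induction w rule: word_exp.induct)
  case (2 g s w)
  have "u [^] word_exp ((g, s) # w) = (if s then star A u else u) \<otimes> u [^] word_exp w"
    using unitary_int_pow_add[OF assms, of 1 "word_exp w"] unitary_int_pow_add[OF assms, of "- 1" "word_exp w"]
    by (simp only: word_exp.simps unitary_int_pow_one[OF assms] unitary_int_pow_minus_one[OF assms]
        split: if_split) simp
  then show ?case using 2 by simp
qed simp

lemma smult_sum:
  assumes "finite S" "a \<in> carrier A"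
  shows "(\<Sum>i\<in>S. c i) \<odot> a = (\<Oplus>i\<in>S. c i \<odot> a)"
  using assms by (induction S) (simp_all add: smult_l_distr Pi_iff)

text \<open>Words are collected by their net exponent, which is bounded by the word length. The
  coefficients depend on x alone, so the same Laurent polynomial gives the value at every unitary of
  any algebra, in particular at the identity function of the circle.\<close>

lemma free_eval_laurent:
  assumes u: "unitary u" and x: "x \<in> carrier free_star_algebra" "degree_le x N"
  shows "free_eval (\<lambda>_. u) x = (\<Oplus>k\<in>{- int N..int N}. laurent_coeff x k \<odot> u [^] k)"
proof -
  let ?W = "\<lambda>k. {w. x w \<noteq> 0 \<and> word_exp w = k}"
  have uc: "u [^] k \<in> carrier A" for k :: int using unitary_int_pow[OF u] by simp
  have fin: "finite (?W k)" for k using x(1) by (simp add: free_carrier)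
  have "word_exp w \<in> {- int N..int N}" if "x w \<noteq> 0" for w
    using x(2) that abs_word_exp_le[of w] unfolding degree_le_def by fastforce
  then have "{w. x w \<noteq> 0} = (\<Union>k\<in>{- int N..int N}. ?W k)" by blast
  then have "free_eval (\<lambda>_. u) x = (\<Oplus>w\<in>(\<Union>k\<in>{- int N..int N}. ?W k). x w \<odot> u [^] word_exp w)"
    unfolding free_eval_def word_eval_unitary[OF u] by simp
  also have "\<dots> = (\<Oplus>k\<in>{- int N..int N}. \<Oplus>w\<in>?W k. x w \<odot> u [^] word_exp w)"
    by (rule add.finprod_UN_disjoint) (use fin uc in \<open>auto simp: pairwise_def disjnt_def\<close>)
  also have "\<dots> = (\<Oplus>k\<in>{- int N..int N}. laurent_coeff x k \<odot> u [^] k)"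
  proof (rule finsum_cong')
    fix k assume "k \<in> {- int N..int N}"
    have "(\<Oplus>w\<in>?W k. x w \<odot> u [^] word_exp w) = (\<Oplus>w\<in>?W k. x w \<odot> u [^] k)"
      by (rule finsum_cong') (use uc in auto)
    then show "(\<Oplus>w\<in>?W k. x w \<odot> u [^] word_exp w) = laurent_coeff x k \<odot> u [^] k"
      unfolding laurent_coeff_def using smult_sum[OF fin uc] by simp
  qed (use uc in auto)
  finally show ?thesis .
qed

end

lemma (in cstar_seminormed) q_finsum:
  assumes "finite S" "f \<in> S \<rightarrow> carrier A"
  shows "q (\<Oplus>i\<in>S. f i) \<le> (\<Sum>i\<in>S. q (f i))"
  using assms
proof (induction S)
  case (insert i S)
  then have f: "f i \<in> carrier A" "f \<in> S \<rightarrow> carrier A" by auto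
  then show ?case using insert q_add[of "f i" "\<Oplus>i\<in>S. f i"] by simp
qed simp

text \<open>If r = a/b - 1 were positive, then (1 + r)^n would be at most C n + 1 for all n = 2^m.
  Bernoulli's inequality, being linear in n, need not contradict this; the quadratic term of the
  binomial expansion does.\<close>

lemma le_of_powers_le:
  fixes a b C :: real
  assumes "0 \<le> a" "0 \<le> b" "0 \<le> C" and le: "\<And>m. a ^ (2 ^ m) \<le> (C * 2 ^ m + 1) * b ^ (2 ^ m)"
  shows "a \<le> b"
proof (rule ccontr)
  assume "\<not> a \<le> b"
  then have ab: "b < a" by simp
  show False
  proof (cases "b = 0")
    case True
    then show False using le[of 0] ab by simp
  next
    case False
    then have b: "b > 0" using assms by simp
    define r where "r = a / b - 1"
    have r: "r > 0" using ab b by (simp add: r_def)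
    have "(1 + r) ^ n \<ge> 1 + real n * r + real n * (real n - 1) / 2 * r\<^sup>2" for n
    proof (induction n)
      case (Suc n)
      have "0 \<le> real n * (real n - 1) / 2 * r\<^sup>2 * r" using r by (cases n) auto
      moreover have "(1 + real n * r + real n * (real n - 1) / 2 * r\<^sup>2) * (1 + r) \<le> (1 + r) ^ n * (1 + r)"
        using Suc r by (intro mult_right_mono) auto
      ultimately show ?case by (simp add: algebra_simps power2_eq_square add_divide_distrib diff_divide_distrib)
    qed simp
    moreover have "(1 + r) ^ (2 ^ m) \<le> C * 2 ^ m + 1" for m
      using le[of m] b by (simp add: r_def power_divide field_simps)
    ultimately have bound: "1 + real (2 ^ m) * r + real (2 ^ m) * (real (2 ^ m) - 1) / 2 * r\<^sup>2 \<le> C * 2 ^ m + 1" for m :: nat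
      using order_trans by blast
    \<comment> \<open>The quadratic term n (n - 1) r^2 / 2 exceeds C n as soon as n - 1 > 2 C /
      r^2.\<close>
    obtain m :: nat where m: "2 * C / r\<^sup>2 + 1 < 2 ^ m"
      using real_arch_pow[of 2 "2 * C / r\<^sup>2 + 1"] by auto
    define t :: real where "t = 2 ^ m"
    have t: "t > 0" "2 * C / r\<^sup>2 + 1 < t" using m by (simp_all add: t_def)
    have "1 + t * r + t * (t - 1) / 2 * r\<^sup>2 \<le> C * t + 1"
      using bound[of m] by (simp add: t_def)
    then have "t * (t - 1) / 2 * r\<^sup>2 < C * t"
      using mult_pos_pos[OF t(1) r] by linarith
    then have "t * ((t - 1) * r\<^sup>2) < t * (2 * C)" by (simp add: algebra_simps)
    then have "(t - 1) * r\<^sup>2 < 2 * C" using t(1) by simp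
    then show False using t(2) r by (simp add: field_simps)
  qed
qed

text \<open>Let \<open>S\<close> be the supremum of a Laurent polynomial of degree at most \<open>N\<close>. Its coefficients are
  bounded by \<open>S\<close>, so its value at \<open>u\<close> has norm at most \<open>(2 N + 1) S\<close>. Applied to the powers
  \<open>y\<^sup>n\<close> with \<open>n = 2\<^sup>m\<close> of the selfadjoint \<open>y = x\<^sup>* x\<close>, this gives
  \<open>\<parallel>y(u)\<parallel>\<^sup>n \<le> (2 N n + 1) S\<^sup>n\<close>, hence \<open>\<parallel>y(u)\<parallel> \<le> S\<close>.\<close>

lemma (in cstar_seminormed) free_eval_unitary_le:
  fixes u :: 'a and x :: "unit star_poly"
  assumes u: "unitary u" and x: "x \<in> carrier free_star_algebra"
  shows "q (free_eval (\<lambda>_. u) x) \<le> circle_norm (circle.free_eval (\<lambda>_. circle_id) x)"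
proof -
  let ?F = "free_star_algebra :: unit star_poly star_algebra"
  interpret F: complex_star_algebra ?F by (rule free_complex_star_algebra)
  let ?u = "free_eval (\<lambda>_ :: unit. u)" and ?z = "circle.free_eval (\<lambda>_ :: unit. circle_id)"
  have hu: "star_hom ?F A ?u" and hz: "star_hom ?F circle_algebra ?z"
    using u by (auto intro: free_eval_hom circle.free_eval_hom)
  have linear: "q (?u y) \<le> (2 * real N + 1) * circle_norm (?z y)"
    if y: "y \<in> carrier ?F" "degree_le y N" for y N
  proof -
    let ?K = "{- int N..int N}"
    have zc: "circle_id [^]\<^bsub>circle_algebra\<^esub> k \<in> carrier circle_algebra" for k :: int
      using circle.unitary_int_pow[OF circle_id_unitary] by simp
    have uc: "unitary (u [^] k)" for k :: int using unitary_int_pow[OF u] .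
    have "cmod (\<Sum>k\<in>?K. laurent_coeff y k * z powi k) \<le> circle_norm (?z y)" if z: "z \<in> unit_circle" for z
    proof -
      have "?z y z = (\<Sum>k\<in>?K. (laurent_coeff y k \<odot>\<^bsub>circle_algebra\<^esub> circle_id [^]\<^bsub>circle_algebra\<^esub> k) z)"
        unfolding circle.free_eval_laurent[OF circle_id_unitary y]
        by (rule circle_finsum) (use z zc in auto)
      also have "\<dots> = (\<Sum>k\<in>?K. laurent_coeff y k * z powi k)"
        using z by (simp add: circle_smult circle_id_int_pow)
      finally show ?thesis
        using circle_norm_upper[OF star_hom_closed[OF hz y(1)] z] by simp
    qed
    then have c: "cmod (laurent_coeff y k) \<le> circle_norm (?z y)" if "k \<in> ?K" for k
      using laurent_coeff_bound that by blast
    have "q (?u y) \<le> (\<Sum>k\<in>?K. q (laurent_coeff y k \<odot> u [^] k))"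
      unfolding free_eval_laurent[OF u y] by (rule q_finsum) (use uc in auto)
    also have "\<dots> \<le> (\<Sum>k\<in>?K. circle_norm (?z y))"
    proof (rule sum_mono)
      fix k assume "k \<in> ?K"
      then have "cmod (laurent_coeff y k) * q (u [^] k) \<le> circle_norm (?z y) * 1"
        using c q_unitary_le[OF uc] uc by (intro mult_mono) (auto simp: circle_norm_nonneg star_hom_closed[OF hz] y)
      then show "q (laurent_coeff y k \<odot> u [^] k) \<le> circle_norm (?z y)"
        using uc by (simp add: q_smult)
    qed
    also have "\<dots> = (2 * real N + 1) * circle_norm (?z y)" by simp
    finally show ?thesis .
  qed
  define y where "y = star ?F x \<otimes>\<^bsub>?F\<^esub> x"
  have y: "y \<in> carrier ?F" "star ?F y = y" using x by (simp_all add: y_def F.star_mult)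
  obtain N where N: "degree_le y N" using degree_le_exists[OF y(1)] .
  have pow: "q (?u y) ^ (2 ^ m) \<le> (2 * real N * 2 ^ m + 1) * circle_norm (?z y) ^ (2 ^ m)" for m
  proof -
    have sa: "star A (?u y) = ?u y" "star circle_algebra (?z y) = ?z y"
      using y star_hom_star[OF hu y(1)] star_hom_star[OF hz y(1)] by simp_all
    have "q (?u y) ^ (2 ^ m) = q (?u (y [^]\<^bsub>?F\<^esub> (2 ^ m :: nat)))"
      using q_power_selfadjoint[OF _ sa(1)] star_hom_closed[OF hu y(1)]
        star_hom_nat_pow[OF F.complex_star_algebra_axioms hu y(1)] by simp
    also have "\<dots> \<le> (2 * real (2 ^ m * N) + 1) * circle_norm (?z (y [^]\<^bsub>?F\<^esub> (2 ^ m :: nat)))"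
      using y N by (intro linear degree_le_pow) auto
    also have "circle_norm (?z (y [^]\<^bsub>?F\<^esub> (2 ^ m :: nat))) = circle_norm (?z y) ^ (2 ^ m)"
      using circle.q_power_selfadjoint[OF _ sa(2)] star_hom_closed[OF hz y(1)]
        star_hom_nat_pow[OF F.complex_star_algebra_axioms hz y(1)] by simp
    finally show ?thesis by (simp add: mult_ac)
  qed
  have "q (?u y) \<le> circle_norm (?z y)"
    by (rule le_of_powers_le[OF q_nonneg[OF star_hom_closed[OF hu y(1)]]
          circle_norm_nonneg[OF star_hom_closed[OF hz y(1)]] _ pow]) simp
  then have "(q (?u x))\<^sup>2 \<le> (circle_norm (?z x))\<^sup>2"
    using x star_hom_closed[OF hu x] star_hom_closed[OF hz x]
    by (simp add: y_def star_hom_mult[OF hu] star_hom_mult[OF hz] star_hom_star[OF hu] star_hom_star[OF hz]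
        q_star_mult circle.q_star_mult)
  then show ?thesis
    using circle_norm_nonneg[OF star_hom_closed[OF hz x]] by (rule power2_le_imp_le)
qed

text \<open>The theorem of Stone and Weierstrass for real polynomials on the plane is applied to Re
  h and Im h separately. On the circle such polynomials come from the free *-algebra, whose
  generator is sent to z and its adjoint to \<open>cnj z\<close>.\<close>

lemma circle_dense_hom:
  "dense_hom free_star_algebra circle_algebra circle_norm (circle.free_eval (\<lambda>_ :: unit. circle_id))"
proof -
  let ?F = "free_star_algebra :: unit star_poly star_algebra"
  let ?z = "circle.free_eval (\<lambda>_ :: unit. circle_id)"
  interpret F: complex_star_algebra ?F by (rule free_complex_star_algebra)
  have hz: "star_hom ?F circle_algebra ?z" and gen: "?z (free_gen ()) = circle_id"
    by (auto intro: circle.free_eval_hom)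
  define P where "P f \<longleftrightarrow> (\<exists>x\<in>carrier ?F. \<forall>z\<in>unit_circle. ?z x z = f z)" for f :: "complex \<Rightarrow> complex"
  have P_cong: "P f" if "P g" "\<And>z. z \<in> unit_circle \<Longrightarrow> g z = f z" for f g
    using that by (auto simp: P_def)
  have P_const: "P (\<lambda>z. c)" for c
    unfolding P_def by (rule bexI[of _ "c \<odot>\<^bsub>?F\<^esub> \<one>\<^bsub>?F\<^esub>"])
      (auto simp: star_hom_smult[OF hz] star_hom_one[OF hz] circle_smult circle_one)
  have P_add: "P (\<lambda>z. f z + g z)" if "P f" "P g" for f g
  proof -
    obtain x y where "x \<in> carrier ?F" "\<forall>z\<in>unit_circle. ?z x z = f z" "y \<in> carrier ?F" "\<forall>z\<in>unit_circle. ?z y z = g z"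
      using \<open>P f\<close> \<open>P g\<close> unfolding P_def by blast
    then show ?thesis unfolding P_def
      by (intro bexI[of _ "x \<oplus>\<^bsub>?F\<^esub> y"]) (auto simp: star_hom_add[OF hz] circle_add)
  qed
  have P_mult: "P (\<lambda>z. f z * g z)" if "P f" "P g" for f g
  proof -
    obtain x y where "x \<in> carrier ?F" "\<forall>z\<in>unit_circle. ?z x z = f z" "y \<in> carrier ?F" "\<forall>z\<in>unit_circle. ?z y z = g z"
      using \<open>P f\<close> \<open>P g\<close> unfolding P_def by blast
    then show ?thesis unfolding P_def
      by (intro bexI[of _ "x \<otimes>\<^bsub>?F\<^esub> y"]) (auto simp: star_hom_mult[OF hz] circle_mult)
  qed
  have P_id: "P (\<lambda>z. z)"
    unfolding P_def by (rule bexI[of _ "free_gen ()"], unfold gen) (auto simp: circle_id_def)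
  have P_cnj: "P (\<lambda>z. cnj z)"
    unfolding P_def by (rule bexI[of _ "star ?F (free_gen ())"], unfold star_hom_star[OF hz free_gen_closed] gen)
      (auto simp: circle_star circle_id_def)
  have P_poly: "P (\<lambda>z. of_real (p z))" if "real_polynomial_function p" for p
    using that
  proof (induction p)
    case (linear f)
    \<comment> \<open>A real-linear f satisfies f(z) = Re z f(1) + Im z f(i). Substituting Re z = (z
      + cnj z)/2 and Im z = (z - cnj z)/(2i) gives these two coefficients.\<close>
    let ?a = "(of_real (f 1) - \<i> * of_real (f \<i>)) / 2" and ?b = "(of_real (f 1) + \<i> * of_real (f \<i>)) / 2"
    have "P (\<lambda>z. ?a * z + ?b * cnj z)"
      by (intro P_add P_mult P_const P_id P_cnj)
    moreover have "?a * z + ?b * cnj z = of_real (f z)" for z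
    proof -
      have "z = Re z *\<^sub>R 1 + Im z *\<^sub>R \<i>" by (simp add: complex_eq_iff)
      then have "f z = Re z * f 1 + Im z * f \<i>"
        using bounded_linear.linear[OF linear] linear_add[of f] linear_scale[of f]
        by (metis real_scaleR_def)
      then show ?thesis by (simp add: complex_eq_iff field_simps)
    qed
    ultimately show ?case by simp
  qed (auto intro: P_const P_add P_mult)
  have approx: "\<exists>x\<in>carrier ?F. circle_norm (?z x \<ominus>\<^bsub>circle_algebra\<^esub> h) \<le> e"
    if h: "h \<in> carrier circle_algebra" and e: "e > 0" for h e
  proof -
    have hc: "continuous_on unit_circle h" using h by (simp add: circle_carrier)
    obtain p where p: "real_polynomial_function p" "\<And>z. z \<in> unit_circle \<Longrightarrow> \<bar>Re (h z) - p z\<bar> < e/2"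
      using Stone_Weierstrass_real_polynomial_function[of unit_circle "\<lambda>z. Re (h z)" "e/2"] hc e
      by (auto intro: continuous_intros)
    obtain r where r: "real_polynomial_function r" "\<And>z. z \<in> unit_circle \<Longrightarrow> \<bar>Im (h z) - r z\<bar> < e/2"
      using Stone_Weierstrass_real_polynomial_function[of unit_circle "\<lambda>z. Im (h z)" "e/2"] hc e
      by (auto intro: continuous_intros)
    have "P (\<lambda>z. of_real (p z) + \<i> * of_real (r z))"
      by (intro P_add P_mult P_const P_poly p r)
    then obtain x where x: "x \<in> carrier ?F" "\<And>z. z \<in> unit_circle \<Longrightarrow> ?z x z = of_real (p z) + \<i> * of_real (r z)"
      unfolding P_def by blast
    have "circle_norm (?z x \<ominus>\<^bsub>circle_algebra\<^esub> h) \<le> e"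
    proof (rule circle_norm_least)
      fix z :: complex assume z: "z \<in> unit_circle"
      have "cmod ((?z x \<ominus>\<^bsub>circle_algebra\<^esub> h) z) \<le> \<bar>p z - Re (h z)\<bar> + \<bar>r z - Im (h z)\<bar>"
        using cmod_le[of "?z x z - h z"] z x h
        by (simp add: circle_minus star_hom_closed[OF hz])
      also have "\<dots> \<le> e" using p(2)[OF z] r(2)[OF z] by linarith
      finally show "cmod ((?z x \<ominus>\<^bsub>circle_algebra\<^esub> h) z) \<le> e" .
    qed
    then show ?thesis using x by blast
  qed
  show ?thesis unfolding dense_hom_def
  proof (intro conjI ballI hz)
    fix h assume h: "h \<in> carrier circle_algebra"
    have "\<exists>x. \<forall>n. x n \<in> carrier ?F \<and> circle_norm (?z (x n) \<ominus>\<^bsub>circle_algebra\<^esub> h) \<le> inverse (Suc n)"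
      by (rule choice) (metis approx[OF h] inverse_positive_iff_positive of_nat_0_less_iff zero_less_Suc)
    then obtain x where x: "\<And>n. x n \<in> carrier ?F" "\<And>n. circle_norm (?z (x n) \<ominus>\<^bsub>circle_algebra\<^esub> h) \<le> inverse (Suc n)"
      by blast
    have "circle.asymp (\<lambda>n. ?z (x n)) (\<lambda>n. h)"
      by (rule circle.asympI[OF _ _ x(2) LIMSEQ_inverse_real_of_nat]) (use x h star_hom_closed[OF hz] in auto)
    then show "\<exists>x. (\<forall>n. x n \<in> carrier ?F) \<and> (\<lambda>n. circle_norm (?z (x n) \<ominus>\<^bsub>circle_algebra\<^esub> h)) \<longlonglongrightarrow> 0"
      using x(1) by (auto simp: circle.asymp_def)
  qed
qed

section \<open>Existence and uniqueness of the functional calculus\<close>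

context cstar_algebra
begin

text \<open>A choice operator is used because the homomorphism is determined on the carrier only,
  with arbitrary values elsewhere. The value described by \<open>fun_calc\<close> is nevertheless
  unique for continuous h, since it is taken at a member of the carrier.\<close>

definition circle_calc :: "'a \<Rightarrow> (complex \<Rightarrow> complex) \<Rightarrow> 'a" where
  "circle_calc u = (SOME \<Phi>. star_hom circle_algebra A \<Phi> \<and> \<Phi> circle_id = u)"

lemma circle_hom_unique:
  assumes \<Phi>: "star_hom circle_algebra A \<Phi>" and \<Psi>: "star_hom circle_algebra A \<Psi>"
    and eq: "\<Phi> circle_id = \<Psi> circle_id" and h: "h \<in> carrier circle_algebra"
  shows "\<Phi> h = \<Psi> h"
proof (rule dense_hom_eqI[OF circle_seminormed cstar_algebra_axioms circle_dense_hom \<Phi> \<Psi> _ _ _ h])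
  let ?z = "circle.free_eval (\<lambda>_ :: unit. circle_id)"
  have hz: "star_hom free_star_algebra circle_algebra ?z" and gen: "?z (free_gen g) = circle_id" for g
    by (auto intro: circle.free_eval_hom)
  show "\<Phi> (?z x) = \<Psi> (?z x)" if "x \<in> carrier free_star_algebra" for x
    by (rule free_hom_eqI[OF star_hom_comp[OF hz \<Phi>] star_hom_comp[OF hz \<Psi>] complex_star_algebra_axioms _ that])
      (simp add: gen eq)
qed (auto intro!: star_hom_contractive[OF circle_seminormed circle_averages_of_unitaries
      cstar_seminormed_axioms] \<Phi> \<Psi>)

lemma circle_calc:
  assumes u: "unitary u"
  shows circle_calc_hom: "star_hom circle_algebra A (circle_calc u)"
    and circle_calc_id: "circle_calc u circle_id = u"
proof -
  let ?z = "circle.free_eval (\<lambda>_ :: unit. circle_id)"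
  have gen: "?z (free_gen g) = circle_id" for g
    by (auto intro: circle.free_eval_hom)
  have hu: "star_hom free_star_algebra A (free_eval (\<lambda>_ :: unit. u))"
    and gu: "free_eval (\<lambda>_ :: unit. u) (free_gen g) = u" for g
    using u by (auto intro: free_eval_hom)
  obtain \<Phi> where \<Phi>: "star_hom circle_algebra A \<Phi>"
    "\<And>x. x \<in> carrier free_star_algebra \<Longrightarrow> \<Phi> (?z x) = free_eval (\<lambda>_ :: unit. u) x"
  proof (rule dense_hom_extension[OF free_complex_star_algebra circle_seminormed cstar_algebra_axioms
        circle_dense_hom hu])
    show "cnorm A (free_eval (\<lambda>_ :: unit. u) x) \<le> circle_norm (?z x)" if "x \<in> carrier free_star_algebra" for x
      using free_eval_unitary_le[OF u that] .
  qed (rule that)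
  have "\<Phi> circle_id = u" using \<Phi>(2)[of "free_gen ()"] by (simp add: gen gu)
  then have "star_hom circle_algebra A (circle_calc u) \<and> circle_calc u circle_id = u"
    unfolding circle_calc_def using \<Phi>(1)
    by (intro someI[where P="\<lambda>\<Phi>. star_hom circle_algebra A \<Phi> \<and> \<Phi> circle_id = u" and x=\<Phi>]) blast
  then show "star_hom circle_algebra A (circle_calc u)" "circle_calc u circle_id = u" by auto
qed

lemma fun_calc_eq:
  assumes u: "unitary u" and h: "continuous_on unit_circle h"
  shows "fun_calc A h u = circle_calc u (restrict h unit_circle)"
  unfolding fun_calc_def circle_id_def[symmetric]
proof (rule the_equality)
  show "\<exists>\<Phi>. star_hom circle_algebra A \<Phi> \<and> \<Phi> circle_id = u \<and>
      circle_calc u (restrict h unit_circle) = \<Phi> (restrict h unit_circle)"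
    using circle_calc[OF u] by blast
next
  fix a assume "\<exists>\<Phi>. star_hom circle_algebra A \<Phi> \<and> \<Phi> circle_id = u \<and> a = \<Phi> (restrict h unit_circle)"
  then show "a = circle_calc u (restrict h unit_circle)"
    using circle_hom_unique[OF _ circle_calc_hom[OF u]] circle_calc_id[OF u] h
    by (auto simp: restrict_circle_closed)
qed

end

section \<open>Inner automorphisms\<close>

context complex_star_algebra
begin

lemma Ad_hom:
  assumes w: "unitary w" shows "star_hom A A (Ad A w)"
proof (rule star_homI)
  fix x y assume x: "x \<in> carrier A" "y \<in> carrier A"
  have "w \<otimes> x \<otimes> star A w \<otimes> (w \<otimes> y \<otimes> star A w) = w \<otimes> x \<otimes> (star A w \<otimes> (w \<otimes> (y \<otimes> star A w)))"
    using w x by (simp add: m_assoc)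
  then show "Ad A w (x \<otimes> y) = Ad A w x \<otimes> Ad A w y"
    using w x by (simp add: Ad_def unitary_left_cancel m_assoc)
next
  have "w \<in> carrier A" "w \<otimes> star A w = \<one>" using w by (auto simp: unitary_def)
  then show "Ad A w \<one> = \<one>" by (simp add: Ad_def)
qed (use unitary_closed[OF w] in
  \<open>simp_all add: Ad_def l_distr r_distr smult_mult_left smult_mult_right star_mult m_assoc\<close>)

lemma Ad_mult:
  assumes "v \<in> carrier A" "w \<in> carrier A" "a \<in> carrier A"
  shows "Ad A (v \<otimes> w) a = Ad A v (Ad A w a)"
  using assms by (simp add: Ad_def star_mult m_assoc)

lemma Ad_eq_iff:
  assumes "unitary w" "a \<in> carrier A" "b \<in> carrier A"
  shows "Ad A w a = b \<longleftrightarrow> w \<otimes> a = b \<otimes> w"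
proof -
  have w: "w \<in> carrier A" "star A w \<otimes> w = \<one>" "w \<otimes> star A w = \<one>"
    using assms(1) by (simp_all add: unitary_def)
  have "Ad A w a \<otimes> w = w \<otimes> a" "b \<otimes> w \<otimes> star A w = b"
    using assms(2,3) w by (simp_all add: Ad_def m_assoc)
  then show ?thesis by (metis Ad_def)
qed

lemma smult_nat_pow: "x \<in> carrier A \<Longrightarrow> (c \<odot> x) [^] (n :: nat) = c ^ n \<odot> x [^] n"
  by (induction n) (simp_all add: smult_mult_left smult_mult_right smult_smult mult.commute)

lemma smult_int_pow:
  assumes x: "unitary x" and c: "cmod c = 1"
  shows "(c \<odot> x) [^] (k :: int) = c powi k \<odot> x [^] k"
proof (cases k rule: int_cases2)
  case (nonneg n)
  then show ?thesis using x by (simp add: int_pow_int smult_nat_pow)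
next
  case (nonpos n)
  have "c * cnj c = 1" using c by (simp add: complex_norm_square[symmetric])
  then have "inverse c = cnj c" by (rule inverse_unique)
  then show ?thesis
    using nonpos x unitary_int_pow_neg[OF unitary_smult[OF x c], of n] unitary_int_pow_neg[OF x, of n]
      unitary_nat_pow[OF x, of n]
    by (simp add: smult_nat_pow star_smult power_int_minus flip: power_inverse)
qed

lemma Ad_int_pow:
  assumes w: "unitary w" and x: "unitary x" and c: "cmod c = 1" and eq: "Ad A w x = c \<odot> x"
  shows "Ad A w (x [^] (k :: int)) = c powi k \<odot> x [^] k"
  using star_hom_int_pow[OF complex_star_algebra_axioms complex_star_algebra_axioms Ad_hom[OF w] x]
  by (simp add: eq smult_int_pow[OF x c])

text \<open>The hypothesis amounts to the commutation relation w x = c x w. Solving it for x w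
  exchanges the roles of w and x and inverts c.\<close>

lemma Ad_smult_swap:
  assumes w: "unitary w" and x: "unitary x" and c: "cmod c = 1" and eq: "Ad A w x = c \<odot> x"
  shows "Ad A x w = inverse c \<odot> w"
proof -
  have c0: "c \<noteq> 0" using c by auto
  have "w \<otimes> x = c \<odot> (x \<otimes> w)"
    using eq w x by (simp add: Ad_eq_iff smult_mult_left)
  then have "inverse c \<odot> (w \<otimes> x) = x \<otimes> w"
    using w x c0 by (simp add: smult_smult)
  then show ?thesis using w x by (simp add: Ad_eq_iff smult_mult_left)
qed

text \<open>Conjugation is multiplicative in its argument, so powers of the argument are easy.
  Exchanging roles moves the power of w there, and exchanging them back undoes the inversion of
  c.\<close>

lemma Ad_pow_commute:
  assumes w: "unitary w" and x: "unitary x" and c: "cmod c = 1" and eq: "Ad A w x = c \<odot> x"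
  shows "Ad A (w [^] (l :: int)) x = c powi l \<odot> x"
proof -
  have c': "cmod (inverse c) = 1" "cmod (inverse c powi l) = 1"
    using c by (simp_all add: norm_inverse norm_power_int)
  have "Ad A x (w [^] l) = inverse c powi l \<odot> w [^] l"
    using Ad_int_pow[OF x w c'(1) Ad_smult_swap[OF assms]] .
  from Ad_smult_swap[OF x unitary_int_pow[OF w] c'(2) this] show ?thesis
    by (simp add: power_int_inverse)
qed

end

section \<open>The rotation algebra\<close>

lemma sup_seminorm_upper:
  "bdd_above ((\<lambda>p. p x) ` S) \<Longrightarrow> p \<in> S \<Longrightarrow> p x \<le> sup_seminorm S x"
  unfolding sup_seminorm_def by (rule cSUP_upper)

lemma sup_seminorm_least:
  "S \<noteq> {} \<Longrightarrow> (\<And>p. p \<in> S \<Longrightarrow> p x \<le> M) \<Longrightarrow> sup_seminorm S x \<le> M"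
  unfolding sup_seminorm_def by (rule cSUP_least)

text \<open>The C*-identity survives the supremum because squaring and square roots are monotone on
  nonnegative reals: one inequality squares upper bounds, the other takes roots. Nonemptiness and
  boundedness make the real supremum a least upper bound.\<close>

lemma sup_seminorm_cstar_seminorm:
  assumes D: "complex_star_algebra D" and S: "S \<noteq> {}"
    and p: "\<And>p. p \<in> S \<Longrightarrow> cstar_seminorm D p"
    and bdd: "\<And>x. x \<in> carrier D \<Longrightarrow> bdd_above ((\<lambda>p. p x) ` S)"
  shows "cstar_seminorm D (sup_seminorm S)"
proof -
  interpret complex_star_algebra D by fact
  note upper = sup_seminorm_upper[OF bdd]
  have sn: "cstar_seminormed D p" if "p \<in> S" for p
    by (intro cstar_seminormed.intro D cstar_seminormed_axioms.intro p that)
  have nonneg: "0 \<le> sup_seminorm S x" if x: "x \<in> carrier D" for x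
  proof -
    obtain p where "p \<in> S" using S by blast
    then show ?thesis
      using upper[OF x] cstar_seminormed.q_nonneg[OF sn x] order_trans by blast
  qed
  have add: "sup_seminorm S (x \<oplus>\<^bsub>D\<^esub> y) \<le> sup_seminorm S x + sup_seminorm S y"
    if x: "x \<in> carrier D" "y \<in> carrier D" for x y
    by (rule sup_seminorm_least[OF S])
      (meson add_mono cstar_seminormed.q_add[OF sn] order_trans upper x)
  have mult: "sup_seminorm S (x \<otimes>\<^bsub>D\<^esub> y) \<le> sup_seminorm S x * sup_seminorm S y"
    if x: "x \<in> carrier D" "y \<in> carrier D" for x y
    by (rule sup_seminorm_least[OF S])
      (meson mult_mono cstar_seminormed.q_mult[OF sn] cstar_seminormed.q_nonneg[OF sn] nonneg order_trans upper x)
  have smult_le: "sup_seminorm S (c \<odot>\<^bsub>D\<^esub> x) \<le> cmod c * sup_seminorm S x" if x: "x \<in> carrier D" for c x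
    by (rule sup_seminorm_least[OF S])
      (use x upper[OF x] in \<open>auto simp: cstar_seminormed.q_smult[OF sn] intro!: mult_left_mono\<close>)
  have smult: "sup_seminorm S (c \<odot>\<^bsub>D\<^esub> x) = cmod c * sup_seminorm S x" if x: "x \<in> carrier D" for c x
  proof (cases "c = 0")
    case True
    then show ?thesis using smult_le[OF x, of c] nonneg[of "c \<odot>\<^bsub>D\<^esub> x"] x by simp
  next
    case False
    have "sup_seminorm S x \<le> cmod (1 / c) * sup_seminorm S (c \<odot>\<^bsub>D\<^esub> x)"
      using smult_le[of "c \<odot>\<^bsub>D\<^esub> x" "1 / c"] False x by (simp add: smult_smult)
    then have "cmod c * sup_seminorm S x \<le> sup_seminorm S (c \<odot>\<^bsub>D\<^esub> x)"
      using False by (simp add: norm_divide field_simps)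
    then show ?thesis using smult_le[OF x, of c] by simp
  qed
  have star: "sup_seminorm S (star D x \<otimes>\<^bsub>D\<^esub> x) = (sup_seminorm S x)\<^sup>2" if x: "x \<in> carrier D" for x
  proof (rule antisym)
    let ?y = "star D x \<otimes>\<^bsub>D\<^esub> x"
    have y: "?y \<in> carrier D" using x by simp
    have eq: "p ?y = (p x)\<^sup>2" if "p \<in> S" for p
      using cstar_seminormed.q_star_mult[OF sn[OF that] x] .
    show "sup_seminorm S ?y \<le> (sup_seminorm S x)\<^sup>2"
      by (rule sup_seminorm_least[OF S]) (simp only: eq, rule power_mono[OF upper[OF x]],
          simp_all add: cstar_seminormed.q_nonneg[OF sn] x)
    have "sup_seminorm S x \<le> sqrt (sup_seminorm S ?y)"
    proof (rule sup_seminorm_least[OF S])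
      fix p assume "p \<in> S"
      then show "p x \<le> sqrt (sup_seminorm S ?y)"
        using upper[OF y, of p] eq[of p] by (intro real_le_rsqrt) simp
    qed
    then show "(sup_seminorm S x)\<^sup>2 \<le> sup_seminorm S ?y"
      using nonneg[OF x] nonneg[OF y] by (metis power_mono real_sqrt_pow2)
  qed
  show ?thesis
    by (simp add: cstar_seminorm_def nonneg add mult smult star)
qed

lemma rot_seminorms_iff:
  "p \<in> rot_seminorms \<theta> \<longleftrightarrow>
     cstar_seminorm free_star_algebra p \<and>
     (\<forall>g. p (star free_star_algebra (free_gen g) \<otimes>\<^bsub>free_star_algebra\<^esub> free_gen g
              \<ominus>\<^bsub>free_star_algebra\<^esub> \<one>\<^bsub>free_star_algebra\<^esub>) = 0) \<and>
     (\<forall>g. p (free_gen g \<otimes>\<^bsub>free_star_algebra\<^esub> star free_star_algebra (free_gen g)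
              \<ominus>\<^bsub>free_star_algebra\<^esub> \<one>\<^bsub>free_star_algebra\<^esub>) = 0) \<and>
     p (free_gen Gen_v \<otimes>\<^bsub>free_star_algebra\<^esub> free_gen Gen_u \<ominus>\<^bsub>free_star_algebra\<^esub>
        cis (2 * pi * \<theta>) \<odot>\<^bsub>free_star_algebra\<^esub> (free_gen Gen_u \<otimes>\<^bsub>free_star_algebra\<^esub> free_gen Gen_v)) = 0"
proof -
  have all: "(\<forall>g. P g) \<longleftrightarrow> P Gen_u \<and> P Gen_v" for P by (metis rot_gen.exhaust)
  show ?thesis unfolding rot_seminorms_def Let_def all mem_Collect_eq by (simp only: conj_ac)
qed

text \<open>The zero seminorm satisfies every relation, which already makes the supremum
  meaningful.\<close>

lemma rot_seminorms_nonempty: "rot_seminorms \<theta> \<noteq> {}"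
proof -
  have "(\<lambda>x. 0) \<in> rot_seminorms \<theta>" by (simp add: rot_seminorms_iff cstar_seminorm_def)
  then show ?thesis by blast
qed

text \<open>Since p vanishes on g* g - 1, the C*-identity gives (p g)^2 \<le> p 1 \<le> 1. Hence
  every word has seminorm at most 1, and a polynomial is bounded through the moduli of its
  coefficients, uniformly in p.\<close>

lemma rot_seminorms_bounded:
  assumes "x \<in> carrier free_star_algebra"
  shows "bdd_above ((\<lambda>p. p x) ` rot_seminorms \<theta>)"
proof -
  let ?F = "free_star_algebra :: rot_gen star_poly star_algebra"
  interpret F: complex_star_algebra ?F by (rule free_complex_star_algebra)
  have sn: "cstar_seminormed ?F p" if "p \<in> rot_seminorms \<theta>" for p
    using that by (intro cstar_seminormed.intro free_complex_star_algebra cstar_seminormed_axioms.intro)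
      (simp add: rot_seminorms_iff)
  have word: "p (word_fun w) \<le> 1" if p: "p \<in> rot_seminorms \<theta>" for p w
  proof -
    interpret F: cstar_seminormed ?F p by (rule sn[OF p])
    have gen: "p (free_gen g) \<le> 1" for g
    proof -
      let ?g = "free_gen g" and ?y = "star ?F (free_gen g) \<otimes>\<^bsub>?F\<^esub> free_gen g"
      have "p ?y \<le> p (?y \<ominus>\<^bsub>?F\<^esub> \<one>\<^bsub>?F\<^esub>) + p \<one>\<^bsub>?F\<^esub>"
        using F.q_triangle_sub[of ?y "\<one>\<^bsub>?F\<^esub>"] by simp
      then have "(p ?g)\<^sup>2 \<le> 1"
        using F.q_one_le p F.q_star_mult[of ?g] by (simp add: rot_seminorms_iff)
      then show ?thesis using abs_square_le_1[of "p ?g"] by simp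
    qed
    have letter: "p (word_fun [l]) \<le> 1" for l
    proof (cases l)
      case (Pair g s)
      have "word_fun [(g, True)] = star ?F (free_gen g)"
        by (simp add: free_gen_word_fun word_fun_star word_star_def)
      then show ?thesis using gen[of g] Pair by (cases s) (auto simp: free_gen_word_fun[symmetric])
    qed
    show ?thesis
    proof (induction w)
      case Nil
      then show ?case using F.q_one_le by (simp add: free_one)
    next
      case (Cons l w)
      have "p (word_fun (l # w)) \<le> p (word_fun [l]) * p (word_fun w)"
        using F.q_mult[of "word_fun [l]" "word_fun w"] by (simp add: word_fun_mult)
      also have "\<dots> \<le> 1 * 1" using letter Cons by (intro mult_mono) auto
      finally show ?case by simp
    qed
  qed
  from assms have "\<exists>C. \<forall>p\<in>rot_seminorms \<theta>. p x \<le> C"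
  proof (induction rule: free_induct)
    case zero
    then show ?case using cstar_seminormed.q_zero[OF sn] by (metis order_refl)
  next
    case (add c w x)
    then obtain C where C: "\<And>p. p \<in> rot_seminorms \<theta> \<Longrightarrow> p x \<le> C" by blast
    have "p ((c \<odot>\<^bsub>?F\<^esub> word_fun w) \<oplus>\<^bsub>?F\<^esub> x) \<le> cmod c + C" if p: "p \<in> rot_seminorms \<theta>" for p
    proof -
      interpret F: cstar_seminormed ?F p by (rule sn[OF p])
      have "p ((c \<odot>\<^bsub>?F\<^esub> word_fun w) \<oplus>\<^bsub>?F\<^esub> x) \<le> cmod c * p (word_fun w) + p x"
        using F.q_add[of "c \<odot>\<^bsub>?F\<^esub> word_fun w" x] add by (simp add: F.q_smult)
      also have "\<dots> \<le> cmod c * 1 + C" using word[OF p] C[OF p] by (intro add_mono mult_left_mono) auto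
      finally show ?thesis by simp
    qed
    then show ?case by blast
  qed
  then show ?thesis by (auto simp: bdd_above_def)
qed

section \<open>The rotation algebra as a universal C*-algebra\<close>

locale rotation =
  fixes \<theta> :: real
begin

abbreviation F :: "rot_gen star_poly star_algebra" where "F \<equiv> free_star_algebra"
abbreviation q :: "rot_gen star_poly \<Rightarrow> real" where "q \<equiv> sup_seminorm (rot_seminorms \<theta>)"
abbreviation A :: "rot_elem normed_star_algebra" where "A \<equiv> rotation_algebra \<theta>"
abbreviation u :: rot_elem where "u \<equiv> rot_u \<theta>"
abbreviation v :: rot_elem where "v \<equiv> rot_v \<theta>"

definition embed :: "rot_gen star_poly \<Rightarrow> rot_elem" where
  "embed a = seq_class F q (\<lambda>n. a)"

lemma free_seminormed: "cstar_seminormed F q"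
  by (intro cstar_seminormed.intro free_complex_star_algebra cstar_seminormed_axioms.intro
      sup_seminorm_cstar_seminorm rot_seminorms_nonempty rot_seminorms_bounded)
    (auto simp: rot_seminorms_iff)

lemma algebra_eq: "A = completion F q"
  by (simp add: rotation_algebra_def universal_cstar_def)

sublocale cstar_algebra "rotation_algebra \<theta>"
  unfolding algebra_eq by (rule cstar_seminormed.completion_cstar_algebra[OF free_seminormed])

lemma dense_embed: "dense_hom F A (cnorm A) embed"
  using cstar_seminormed.dense_hom_completion[OF free_seminormed]
  by (simp add: algebra_eq embed_def[abs_def])

lemma embed_hom: "star_hom F A embed"
  using dense_embed by (simp add: dense_hom_def)

lemma norm_embed: "a \<in> carrier F \<Longrightarrow> cnorm A (embed a) = q a"
  using cstar_seminormed.completion_norm_const[OF free_seminormed]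
  by (simp add: algebra_eq embed_def)

lemma u_eq: "u = embed (free_gen Gen_u)" and v_eq: "v = embed (free_gen Gen_v)"
  by (simp_all add: rot_u_def rot_v_def embed_def)

text \<open>The norm of an embedded element is a supremum over \<open>rot_seminorms\<close>, so a
  relation imposed on each seminorm becomes an equation in the algebra.\<close>

lemma embed_eqI:
  assumes "a \<in> carrier F" "b \<in> carrier F" "\<And>p. p \<in> rot_seminorms \<theta> \<Longrightarrow> p (a \<ominus>\<^bsub>F\<^esub> b) = 0"
  shows "embed a = embed b"
proof -
  interpret F: cstar_seminormed F q by (rule free_seminormed)
  have "q (a \<ominus>\<^bsub>F\<^esub> b) \<le> 0"
    by (rule sup_seminorm_least[OF rot_seminorms_nonempty]) (simp only: assms(3) order_refl)
  then have "cnorm A (embed (a \<ominus>\<^bsub>F\<^esub> b)) = 0"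
    using F.q_nonneg[OF F.minus_closed[OF assms(1,2)]]
    by (simp only: norm_embed[OF F.minus_closed[OF assms(1,2)]])
  then show ?thesis
    using assms star_hom_minus[OF free_complex_star_algebra complex_star_algebra_axioms embed_hom]
    by (intro eqI) (auto simp: star_hom_closed[OF embed_hom])
qed

lemma embed_gen_unitary: "unitary (embed (free_gen g))"
proof -
  interpret F: complex_star_algebra F by (rule free_complex_star_algebra)
  have "embed (star F (free_gen g) \<otimes>\<^bsub>F\<^esub> free_gen g) = embed \<one>\<^bsub>F\<^esub>"
    "embed (free_gen g \<otimes>\<^bsub>F\<^esub> star F (free_gen g)) = embed \<one>\<^bsub>F\<^esub>"
    by (rule embed_eqI; simp add: rot_seminorms_iff)+
  then show ?thesis
    unfolding unitary_def
    by (simp add: star_hom_mult[OF embed_hom] star_hom_star[OF embed_hom] star_hom_one[OF embed_hom]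
        star_hom_closed[OF embed_hom])
qed

lemma u_unitary: "unitary u" and v_unitary: "unitary v"
  by (simp_all add: u_eq v_eq embed_gen_unitary)

lemma u_closed [simp]: "u \<in> carrier A" and v_closed [simp]: "v \<in> carrier A"
  using u_unitary v_unitary by auto

lemma vu_commute: "v \<otimes>\<^bsub>A\<^esub> u = cis (2 * pi * \<theta>) \<odot>\<^bsub>A\<^esub> (u \<otimes>\<^bsub>A\<^esub> v)"
proof -
  interpret F: complex_star_algebra F by (rule free_complex_star_algebra)
  have "embed (free_gen Gen_v \<otimes>\<^bsub>F\<^esub> free_gen Gen_u)
      = embed (cis (2 * pi * \<theta>) \<odot>\<^bsub>F\<^esub> (free_gen Gen_u \<otimes>\<^bsub>F\<^esub> free_gen Gen_v))"
    by (rule embed_eqI) (simp_all add: rot_seminorms_iff)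
  then show ?thesis
    by (simp add: u_eq v_eq star_hom_mult[OF embed_hom] star_hom_smult[OF embed_hom])
qed

text \<open>The universal property: evaluation at U and V pulls the norm back to a member of
  \<open>rot_seminorms\<close>. It is therefore bounded by the supremum, and extension by density
  applies.\<close>

lemma ex_hom:
  assumes U: "unitary U" and V: "unitary V" and VU: "V \<otimes>\<^bsub>A\<^esub> U = cis (2 * pi * \<theta>) \<odot>\<^bsub>A\<^esub> (U \<otimes>\<^bsub>A\<^esub> V)"
  obtains \<phi> where "star_hom A A \<phi>" "\<phi> u = U" "\<phi> v = V"
proof -
  interpret F: complex_star_algebra F by (rule free_complex_star_algebra)
  define b where "b = case_rot_gen U V"
  have bu: "unitary (b g)" for g using U V by (cases g) (auto simp: b_def)
  then have b: "b g \<in> carrier A" for g by simp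
  have hom: "star_hom F A (free_eval b)" and gen: "free_eval b (free_gen g) = b g" for g
    using free_eval_hom[of b] b by auto
  have "(\<lambda>x. cnorm A (free_eval b x)) \<in> rot_seminorms \<theta>"
    unfolding rot_seminorms_iff
    using pullback_cstar_seminorm[OF F.star_closed hom seminorm] bu VU
    by (auto simp: star_hom_minus[OF free_complex_star_algebra complex_star_algebra_axioms hom]
        star_hom_mult[OF hom] star_hom_star[OF hom] star_hom_one[OF hom] star_hom_smult[OF hom]
        gen b unitary_def) (use U V in \<open>simp_all add: b_def\<close>)
  then have "cnorm A (free_eval b x) \<le> cnorm A (embed x)" if "x \<in> carrier F" for x
    using sup_seminorm_upper[OF rot_seminorms_bounded[OF that]] that by (auto simp: norm_embed)
  then obtain \<phi> where \<phi>: "star_hom A A \<phi>" "\<And>x. x \<in> carrier F \<Longrightarrow> \<phi> (embed x) = free_eval b x"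
    using dense_hom_extension[OF free_complex_star_algebra cstar_seminormed_axioms cstar_algebra_axioms dense_embed hom]
    by blast
  show thesis
  proof (rule that[OF \<phi>(1)])
    show "\<phi> u = U" "\<phi> v = V"
      unfolding u_eq v_eq by (simp_all add: \<phi>(2) gen) (simp_all add: b_def)
  qed
qed

lemma hom_contractive: "star_hom A A \<phi> \<Longrightarrow> x \<in> carrier A \<Longrightarrow> cnorm A (\<phi> x) \<le> cnorm A x"
  by (rule star_hom_contractive[OF cstar_seminormed_axioms averages_of_unitaries cstar_seminormed_axioms])

lemma hom_eqI:
  assumes \<phi>: "star_hom A A \<phi>" and \<psi>: "star_hom A A \<psi>" and eq: "\<phi> u = \<psi> u" "\<phi> v = \<psi> v"
    and x: "x \<in> carrier A"
  shows "\<phi> x = \<psi> x"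
proof (rule dense_hom_eqI[OF cstar_seminormed_axioms cstar_algebra_axioms dense_embed \<phi> \<psi> _ _ _ x])
  fix a assume "a \<in> carrier F"
  then show "\<phi> (embed a) = \<psi> (embed a)"
  proof (rule free_hom_eqI[OF star_hom_comp[OF embed_hom \<phi>] star_hom_comp[OF embed_hom \<psi>] complex_star_algebra_axioms, rotated])
    show "\<phi> (embed (free_gen g)) = \<psi> (embed (free_gen g))" for g
      using eq by (cases g) (auto simp: u_eq v_eq)
  qed
qed (use hom_contractive \<phi> \<psi> in auto)

end

section \<open>Rotations of the circle and composition with inner automorphisms\<close>

definition circle_rot :: "complex \<Rightarrow> (complex \<Rightarrow> complex) \<Rightarrow> complex \<Rightarrow> complex" where
  "circle_rot c h = (\<lambda>z\<in>unit_circle. h (c * z))"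

lemma circle_rot_closed [simp]:
  assumes "cmod c = 1" "h \<in> carrier circle_algebra"
  shows "circle_rot c h \<in> carrier circle_algebra"
proof -
  have "continuous_on unit_circle (h \<circ> (\<lambda>z. c * z))"
  proof (rule continuous_on_compose)
    show "continuous_on ((\<lambda>z. c * z) ` unit_circle) h"
      using assms by (auto simp: circle_carrier norm_mult intro: continuous_on_subset)
  qed (intro continuous_intros)
  then show ?thesis unfolding circle_rot_def restrict_circle_closed by (simp add: o_def)
qed

lemma circle_rot_hom:
  assumes "cmod c = 1" shows "star_hom circle_algebra circle_algebra (circle_rot c)"
proof (rule star_homI)
  show "circle_rot c x \<in> carrier circle_algebra" if "x \<in> carrier circle_algebra" for x
    using assms that by simp
qed (use assms in \<open>auto simp: circle_rot_def circle_mult circle_add circle_one circle_smult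
      circle_star norm_mult intro!: restrict_ext\<close>)

lemma circle_rot_id: "cmod c = 1 \<Longrightarrow> circle_rot c circle_id = c \<odot>\<^bsub>circle_algebra\<^esub> circle_id"
  by (auto simp: circle_rot_def circle_id_def circle_smult norm_mult intro!: restrict_ext)

lemma Ad_compose_star_aut:
  assumes "complex_star_algebra A" "complex_star_algebra.unitary A w" "\<alpha> \<in> star_aut A"
  shows "compose (carrier A) (Ad A w) \<alpha> \<in> star_aut A"
proof -
  interpret complex_star_algebra A by fact
  have w: "unitary w" "unitary (star A w)" using assms(2) by (simp_all add: unitary_star)
  have \<alpha>: "star_hom A A \<alpha>" "bij_betw \<alpha> (carrier A) (carrier A)"
    using assms(3) by (auto simp: star_aut_def Bij_def)
  have hom: "star_hom A A (\<lambda>a. Ad A w (\<alpha> a))"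
    using star_hom_comp[OF \<alpha>(1) Ad_hom[OF w(1)]] .
  have "star_hom A A (compose (carrier A) (Ad A w) \<alpha>)"
    by (rule star_hom_cong[OF complex_star_algebra_axioms hom]) (simp add: compose_def)
  moreover have "bij_betw (Ad A w) (carrier A) (carrier A)"
  proof (rule bij_betw_byWitness[where f'="Ad A (star A w)"])
    show "\<forall>a\<in>carrier A. Ad A (star A w) (Ad A w a) = a"
      using w by (simp add: Ad_mult[symmetric]) (simp add: unitary_def Ad_def)
    show "\<forall>a\<in>carrier A. Ad A w (Ad A (star A w) a) = a"
      using w by (simp add: Ad_mult[symmetric]) (simp add: unitary_def Ad_def)
  qed (use star_hom_closed[OF Ad_hom[OF w(1)]] star_hom_closed[OF Ad_hom[OF w(2)]] in auto)
  then have "bij_betw (compose (carrier A) (Ad A w) \<alpha>) (carrier A) (carrier A)"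
    using \<alpha>(2) by (simp add: bij_betw_compose)
  ultimately show ?thesis by (simp add: star_aut_def Bij_def)
qed

section \<open>Automorphisms of the rotation algebra given by their values at u and v\<close>

context rotation
begin

abbreviation calc :: "(complex \<Rightarrow> complex) \<Rightarrow> rot_elem" where
  "calc \<equiv> circle_calc (rot_u \<theta>)"

lemmas calc_hom = circle_calc_hom[OF u_unitary]
  and calc_id = circle_calc_id[OF u_unitary]

lemma calc_closed [simp]: "h \<in> carrier circle_algebra \<Longrightarrow> calc h \<in> carrier A"
  by (rule star_hom_closed[OF calc_hom])

lemma calc_unitary: "circle.unitary h \<Longrightarrow> unitary (calc h)"
  by (rule star_hom_unitary[OF circle_complex_star_algebra complex_star_algebra_axioms calc_hom])

text \<open>Both sides are *-homomorphisms in \<open>h\<close> that send the identity function to \<open>c u\<close>.\<close>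

lemma hom_calc:
  assumes \<phi>: "star_hom A A \<phi>" and c: "cmod c = 1" and u: "\<phi> u = c \<odot>\<^bsub>A\<^esub> u"
    and h: "h \<in> carrier circle_algebra"
  shows "\<phi> (calc h) = calc (circle_rot c h)"
  by (rule circle_hom_unique[OF star_hom_comp[OF calc_hom \<phi>] star_hom_comp[OF circle_rot_hom[OF c] calc_hom] _ h])
    (simp add: calc_id u circle_rot_id[OF c] star_hom_smult[OF calc_hom])

lemma Ad_v_u: "Ad A v u = cis (2 * pi * \<theta>) \<odot>\<^bsub>A\<^esub> u"
  using v_unitary vu_commute by (simp add: Ad_eq_iff smult_mult_left)

lemma calc_u_commute:
  assumes "h \<in> carrier circle_algebra" shows "calc h \<otimes>\<^bsub>A\<^esub> u = u \<otimes>\<^bsub>A\<^esub> calc h"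
proof -
  have "h \<otimes>\<^bsub>circle_algebra\<^esub> circle_id = circle_id \<otimes>\<^bsub>circle_algebra\<^esub> h"
    by (simp add: circle_mult mult.commute)
  then have "calc (h \<otimes>\<^bsub>circle_algebra\<^esub> circle_id) = calc (circle_id \<otimes>\<^bsub>circle_algebra\<^esub> h)" by simp
  then show ?thesis using assms by (simp add: star_hom_mult[OF calc_hom] calc_id)
qed

lemma ex_rot_hom:
  assumes c: "cmod c = 1" and h: "circle.unitary h"
  obtains \<phi> where "star_hom A A \<phi>" "\<phi> u = c \<odot>\<^bsub>A\<^esub> u" "\<phi> v = calc h \<otimes>\<^bsub>A\<^esub> v"
proof -
  let ?\<Lambda> = "cis (2 * pi * \<theta>)"
  have hc: "h \<in> carrier circle_algebra" using h by simp
  have "(calc h \<otimes>\<^bsub>A\<^esub> v) \<otimes>\<^bsub>A\<^esub> (c \<odot>\<^bsub>A\<^esub> u) = c \<odot>\<^bsub>A\<^esub> (calc h \<otimes>\<^bsub>A\<^esub> (v \<otimes>\<^bsub>A\<^esub> u))"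
    using hc by (simp add: smult_mult_right m_assoc)
  also have "\<dots> = (c * ?\<Lambda>) \<odot>\<^bsub>A\<^esub> ((calc h \<otimes>\<^bsub>A\<^esub> u) \<otimes>\<^bsub>A\<^esub> v)"
    unfolding vu_commute using hc by (simp add: smult_mult_right smult_smult m_assoc)
  also have "\<dots> = ?\<Lambda> \<odot>\<^bsub>A\<^esub> ((c \<odot>\<^bsub>A\<^esub> u) \<otimes>\<^bsub>A\<^esub> (calc h \<otimes>\<^bsub>A\<^esub> v))"
    unfolding calc_u_commute[OF hc] using hc
    by (simp add: smult_mult_left smult_smult m_assoc mult.commute)
  finally show thesis
    using ex_hom[OF unitary_smult[OF u_unitary c] unitary_mult[OF calc_unitary[OF h] v_unitary]] that by blast
qed

lemma hom_id:
  assumes "star_hom A A \<phi>" "\<phi> u = u" "\<phi> v = v" "x \<in> carrier A"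
  shows "\<phi> x = x"
proof (rule hom_eqI[OF assms(1) _ _ _ assms(4)])
  show "star_hom A A (\<lambda>x. x)" by (rule star_homI) auto
qed (use assms in auto)

lemma ex_rot_aut:
  assumes c: "cmod c = 1" and h: "circle.unitary h"
  shows "\<exists>\<phi>\<in>star_aut A. \<phi> u = c \<odot>\<^bsub>A\<^esub> u \<and> \<phi> v = calc h \<otimes>\<^bsub>A\<^esub> v"
proof -
  obtain \<phi> where \<phi>: "star_hom A A \<phi>" "\<phi> u = c \<odot>\<^bsub>A\<^esub> u" "\<phi> v = calc h \<otimes>\<^bsub>A\<^esub> v"
    using ex_rot_hom[OF c h] .
  have c': "cmod (cnj c) = 1" and cc: "c * cnj c = 1"
    using c by (simp_all add: complex_norm_square[symmetric])
  have hc: "h \<in> carrier circle_algebra" using h by simp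
  \<comment> \<open>The image of v under \<psi> and then \<phi> is k(c u) h(u) v. For this to be v,
    k(c z) must be the inverse of h(z), which is its conjugate; so k(z) is the conjugate of h at
    \<open>cnj c * z\<close>.\<close>
  define k where "k = circle_rot (cnj c) (star circle_algebra h)"
  have k: "circle.unitary k"
    unfolding k_def
    by (rule star_hom_unitary[OF circle_complex_star_algebra circle_complex_star_algebra
          circle_rot_hom[OF c'] circle.unitary_star[OF h]])
  then have kc: "k \<in> carrier circle_algebra" by simp
  obtain \<psi> where \<psi>: "star_hom A A \<psi>" "\<psi> u = cnj c \<odot>\<^bsub>A\<^esub> u" "\<psi> v = calc k \<otimes>\<^bsub>A\<^esub> v"
    using ex_rot_hom[OF c' k] .
  have hz: "cnj (h z) * h z = 1" if "z \<in> unit_circle" for z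
  proof -
    have "star circle_algebra h \<otimes>\<^bsub>circle_algebra\<^esub> h = \<one>\<^bsub>circle_algebra\<^esub>"
      using h by (simp only: circle.unitary_def)
    from fun_cong[OF this, of z] that show ?thesis by (simp add: circle_mult circle_star circle_one)
  qed
  have cz: "cnj c * (c * z) = z" for z using cc by (simp add: mult.assoc[symmetric] mult.commute)
  have 1: "circle_rot c k \<otimes>\<^bsub>circle_algebra\<^esub> h = \<one>\<^bsub>circle_algebra\<^esub>"
    using c hz by (auto simp: cz k_def circle_rot_def circle_star circle_mult circle_one norm_mult intro!: restrict_ext)
  have 2: "circle_rot (cnj c) h \<otimes>\<^bsub>circle_algebra\<^esub> k = \<one>\<^bsub>circle_algebra\<^esub>"
    using c hz by (auto simp: k_def circle_rot_def circle_star circle_mult circle_one norm_mult mult.commute intro!: restrict_ext)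
  have \<phi>\<psi>: "\<phi> (\<psi> x) = x" if "x \<in> carrier A" for x
  proof (rule hom_id[OF star_hom_comp[OF \<psi>(1) \<phi>(1)] _ _ that])
    show "\<phi> (\<psi> u) = u" using cc by (simp add: \<psi> \<phi> star_hom_smult[OF \<phi>(1)] smult_smult mult.commute)
    have "\<phi> (\<psi> v) = calc (circle_rot c k) \<otimes>\<^bsub>A\<^esub> (calc h \<otimes>\<^bsub>A\<^esub> v)"
      using kc by (simp add: \<psi>(3) star_hom_mult[OF \<phi>(1)] hom_calc[OF \<phi>(1) c \<phi>(2) kc] \<phi>(3))
    also have "\<dots> = calc (circle_rot c k \<otimes>\<^bsub>circle_algebra\<^esub> h) \<otimes>\<^bsub>A\<^esub> v"
      using hc kc c by (simp add: star_hom_mult[OF calc_hom] m_assoc)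
    also have "\<dots> = v" by (simp add: 1 star_hom_one[OF calc_hom])
    finally show "\<phi> (\<psi> v) = v" .
  qed
  have \<psi>\<phi>: "\<psi> (\<phi> x) = x" if "x \<in> carrier A" for x
  proof (rule hom_id[OF star_hom_comp[OF \<phi>(1) \<psi>(1)] _ _ that])
    show "\<psi> (\<phi> u) = u" using cc by (simp add: \<psi> \<phi> star_hom_smult[OF \<psi>(1)] smult_smult)
    have "\<psi> (\<phi> v) = calc (circle_rot (cnj c) h) \<otimes>\<^bsub>A\<^esub> (calc k \<otimes>\<^bsub>A\<^esub> v)"
      using hc by (simp add: \<phi>(3) star_hom_mult[OF \<psi>(1)] hom_calc[OF \<psi>(1) c' \<psi>(2) hc] \<psi>(3))
    also have "\<dots> = calc (circle_rot (cnj c) h \<otimes>\<^bsub>circle_algebra\<^esub> k) \<otimes>\<^bsub>A\<^esub> v"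
      using hc kc c' by (simp add: star_hom_mult[OF calc_hom] m_assoc)
    also have "\<dots> = v" by (simp add: 2 star_hom_one[OF calc_hom])
    finally show "\<psi> (\<phi> v) = v" .
  qed
  have "bij_betw \<phi> (carrier A) (carrier A)"
    by (rule bij_betw_byWitness[where f'=\<psi>])
      (use \<phi>\<psi> \<psi>\<phi> star_hom_closed[OF \<phi>(1)] star_hom_closed[OF \<psi>(1)] in auto)
  moreover have "star_hom A A (restrict \<phi> (carrier A))"
    by (rule star_hom_cong[OF complex_star_algebra_axioms \<phi>(1)]) simp
  ultimately have "restrict \<phi> (carrier A) \<in> star_aut A"
    by (simp add: star_aut_def Bij_def cong: bij_betw_cong)
  then show ?thesis using \<phi>(2,3) by (intro bexI[of _ "restrict \<phi> (carrier A)"]) auto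
qed

lemma star_aut_eqI:
  assumes "\<phi> \<in> star_aut A" "\<psi> \<in> star_aut A" "\<phi> u = \<psi> u" "\<phi> v = \<psi> v"
  shows "\<phi> = \<psi>"
  using assms hom_eqI[of \<phi> \<psi>] by (intro extensionalityI[of \<phi> "carrier A" \<psi>])
    (auto simp: star_aut_def Bij_def)

text \<open>With \<open>F = winding d f\<close>, the automorphism in question maps \<open>v\<close> to \<open>F(u) v\<close>.\<close>

definition winding :: "int \<Rightarrow> (complex \<Rightarrow> real) \<Rightarrow> complex \<Rightarrow> complex" where
  "winding d f = (\<lambda>z\<in>unit_circle. exp (2 * pi * \<i> * f z) * z powi d)"

lemma winding_unitary:
  assumes f: "continuous_on unit_circle f" shows "circle.unitary (winding d f)"
proof (rule circle_unitaryI)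
  have "continuous_on unit_circle (\<lambda>z :: complex. z powi d)"
    by (intro continuous_on_power_int continuous_intros) auto
  then show "winding d f \<in> carrier circle_algebra"
    unfolding winding_def restrict_circle_closed using f by (intro continuous_on_mult) (intro continuous_intros)
qed (auto simp: winding_def norm_mult norm_power_int)

lemma calc_winding:
  assumes f: "continuous_on unit_circle f"
  shows "calc (winding d f) = fun_calc A (\<lambda>z. exp (2 * pi * \<i> * f z)) u \<otimes>\<^bsub>A\<^esub> (u [^]\<^bsub>A\<^esub> d)"
proof -
  let ?e = "\<lambda>z\<in>unit_circle. exp (2 * pi * \<i> * f z)"
  have e: "continuous_on unit_circle (\<lambda>z. exp (2 * pi * \<i> * f z))"
    using f by (intro continuous_intros)
  have zc: "circle_id [^]\<^bsub>circle_algebra\<^esub> d \<in> carrier circle_algebra"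
    using circle.unitary_int_pow[OF circle_id_unitary] by simp
  have "winding d f = ?e \<otimes>\<^bsub>circle_algebra\<^esub> circle_id [^]\<^bsub>circle_algebra\<^esub> d"
    by (auto simp: winding_def circle_mult circle_id_int_pow intro!: restrict_ext)
  then have "calc (winding d f) = calc ?e \<otimes>\<^bsub>A\<^esub> calc (circle_id [^]\<^bsub>circle_algebra\<^esub> d)"
    using e zc by (simp add: star_hom_mult[OF calc_hom] restrict_circle_closed)
  also have "calc (circle_id [^]\<^bsub>circle_algebra\<^esub> d) = u [^]\<^bsub>A\<^esub> d"
    by (simp add: star_hom_int_pow[OF circle_complex_star_algebra complex_star_algebra_axioms calc_hom circle_id_unitary] calc_id)
  finally show ?thesis unfolding fun_calc_eq[OF u_unitary e] .
qed

text \<open>Replaces the definite description by a criterion, so that an equation between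
  automorphisms is checked at u and v alone.\<close>

lemma rot_aut_iff:
  assumes f: "continuous_on unit_circle f"
  shows "\<alpha> = rot_aut \<theta> \<gamma> d f \<longleftrightarrow>
    \<alpha> \<in> star_aut A \<and> \<alpha> u = cis (2 * pi * \<gamma>) \<odot>\<^bsub>A\<^esub> u \<and> \<alpha> v = calc (winding d f) \<otimes>\<^bsub>A\<^esub> v"
    (is "_ \<longleftrightarrow> ?P \<alpha>")
proof -
  have "\<exists>!\<alpha>. ?P \<alpha>"
    using ex_rot_aut[OF norm_cis winding_unitary[OF f], of "2 * pi * \<gamma>" d] star_aut_eqI by auto
  moreover have "rot_aut \<theta> \<gamma> d f = (THE \<alpha>. ?P \<alpha>)"
    unfolding rot_aut_def Let_def calc_winding[OF f] ..
  ultimately show ?thesis using theI'[of ?P] by auto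
qed

theorem Ad_compose_rot_aut:
  fixes \<gamma> :: real and d k l :: int and f g :: "complex \<Rightarrow> real"
  assumes f: "continuous_on unit_circle f"
    and g: "\<And>\<zeta>. \<zeta> \<in> unit_circle \<Longrightarrow>
           g \<zeta> = f (cis (2 * pi * (of_int l * \<theta>)) * \<zeta>) + of_int (l * d - k) * \<theta>"
  shows "compose (carrier A) (Ad A ((u [^]\<^bsub>A\<^esub> k) \<otimes>\<^bsub>A\<^esub> (v [^]\<^bsub>A\<^esub> l))) (rot_aut \<theta> \<gamma> d f)
    = rot_aut \<theta> (\<gamma> + of_int l * \<theta>) d g"
proof -
  define \<Lambda> where "\<Lambda> = cis (2 * pi * \<theta>)"
  have \<Lambda>: "cmod \<Lambda> = 1" "cmod (\<Lambda> powi l) = 1" "\<Lambda> \<noteq> 0" by (simp_all add: \<Lambda>_def norm_power_int)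
  have \<Lambda>l: "\<Lambda> powi j = cis (2 * pi * (of_int j * \<theta>))" for j
    by (simp add: \<Lambda>_def cis_power_int mult_ac)
  let ?w = "(u [^]\<^bsub>A\<^esub> k) \<otimes>\<^bsub>A\<^esub> (v [^]\<^bsub>A\<^esub> l)"
  let ?W = "winding d f"
  have uk: "unitary (u [^]\<^bsub>A\<^esub> k)" and vl: "unitary (v [^]\<^bsub>A\<^esub> l)"
    using unitary_int_pow u_unitary v_unitary by auto
  have w: "unitary ?w" using unitary_mult[OF uk vl] .
  have Wc: "?W \<in> carrier circle_algebra" using winding_unitary[OF f] by simp
  have rWc: "circle_rot (\<Lambda> powi l) ?W \<in> carrier circle_algebra" using Wc \<Lambda> by simp
  have "continuous_on unit_circle (\<lambda>\<zeta>. f (cis (2 * pi * (of_int l * \<theta>)) * \<zeta>) + of_int (l * d - k) * \<theta>)"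
    using f by (intro continuous_intros continuous_on_compose2[OF f]) (auto simp: norm_mult)
  then have gc: "continuous_on unit_circle g"
    by (rule continuous_on_eq) (simp add: g)
  have Adv_u: "Ad A (v [^]\<^bsub>A\<^esub> l) u = \<Lambda> powi l \<odot>\<^bsub>A\<^esub> u"
    using Ad_pow_commute[OF v_unitary u_unitary \<Lambda>(1)] Ad_v_u by (simp add: \<Lambda>_def)
  \<comment> \<open>Writing the scalar 1 explicitly brings the trivial conjugation into the form
    that \<open>Ad_pow_commute\<close> expects.\<close>
  have "Ad A u u = 1 \<odot>\<^bsub>A\<^esub> u" using u_unitary by (simp add: Ad_eq_iff)
  from Ad_pow_commute[OF u_unitary u_unitary _ this, of k]
  have Adu_u: "Ad A (u [^]\<^bsub>A\<^esub> k) u = 1 \<odot>\<^bsub>A\<^esub> u" by simp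
  have "Ad A v v = 1 \<odot>\<^bsub>A\<^esub> v" using v_unitary by (simp add: Ad_eq_iff)
  from Ad_pow_commute[OF v_unitary v_unitary _ this, of l]
  have Adv_v: "Ad A (v [^]\<^bsub>A\<^esub> l) v = v" by simp
  have Adu_v: "Ad A (u [^]\<^bsub>A\<^esub> k) v = \<Lambda> powi (- k) \<odot>\<^bsub>A\<^esub> v"
    using Ad_pow_commute[OF u_unitary v_unitary _ Ad_smult_swap[OF v_unitary u_unitary \<Lambda>(1) Ad_v_u[folded \<Lambda>_def]], of k] \<Lambda>(1)
    by (simp add: norm_inverse power_int_minus power_int_inverse)
  have Adw_u: "Ad A ?w u = \<Lambda> powi l \<odot>\<^bsub>A\<^esub> u"
    by (simp add: Ad_mult[OF unitary_closed[OF uk] unitary_closed[OF vl]] Adv_u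
        star_hom_smult[OF Ad_hom[OF uk]] Adu_u)
  have rot1: "circle_rot 1 h = h" if "h \<in> carrier circle_algebra" for h
    using that by (auto simp: circle_rot_def circle_carrier extensional_restrict)
  have Adw_v: "Ad A ?w v = \<Lambda> powi (- k) \<odot>\<^bsub>A\<^esub> v"
    by (simp add: Ad_mult[OF unitary_closed[OF uk] unitary_closed[OF vl]] Adv_v Adu_v)
  have Adw_W: "Ad A ?w (calc ?W) = calc (circle_rot (\<Lambda> powi l) ?W)"
    using hom_calc[OF Ad_hom[OF w] \<Lambda>(2) Adw_u Wc] .
  have wg: "winding d g = \<Lambda> powi (- k) \<odot>\<^bsub>circle_algebra\<^esub> circle_rot (\<Lambda> powi l) ?W"
    unfolding winding_def circle_smult circle_rot_def
  proof (rule restrict_ext)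
    fix z :: complex assume z: "z \<in> unit_circle"
    have lz: "\<Lambda> powi l * z \<in> unit_circle" using z \<Lambda> by (simp add: norm_mult)
    have "2 * pi * \<i> * g z = 2 * pi * \<i> * f (\<Lambda> powi l * z) + \<i> * (2 * pi * (of_int (l * d - k) * \<theta>))"
      unfolding g[OF z] \<Lambda>l[of l] by (simp add: algebra_simps)
    then have "exp (2 * pi * \<i> * g z) = exp (2 * pi * \<i> * f (\<Lambda> powi l * z)) * \<Lambda> powi (l * d - k)"
      unfolding \<Lambda>l[of "l * d - k"] cis_conv_exp by (simp add: exp_add)
    \<comment> \<open>The exponent splits into the scalar acquired by v under conjugation and the
      factor that z^d picks up under the rotation by \<Lambda>^l.\<close>
    also have "\<Lambda> powi (l * d - k) = \<Lambda> powi (- k) * (\<Lambda> powi l) powi d"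
      using \<Lambda>(3) by (simp add: power_int_mult[symmetric] power_int_add[symmetric])
    finally show "exp (2 * pi * \<i> * g z) * z powi d = \<Lambda> powi (- k) *
       (\<lambda>z\<in>unit_circle. (\<lambda>z\<in>unit_circle. exp (2 * pi * \<i> * f z) * z powi d) (\<Lambda> powi l * z)) z"
      using z lz by (simp add: power_int_mult_distrib mult_ac)
  qed
  define \<alpha> where "\<alpha> = rot_aut \<theta> \<gamma> d f"
  then have \<alpha>: "\<alpha> \<in> star_aut A" "\<alpha> u = cis (2 * pi * \<gamma>) \<odot>\<^bsub>A\<^esub> u" "\<alpha> v = calc ?W \<otimes>\<^bsub>A\<^esub> v"
    using rot_aut_iff[OF f, of \<alpha> \<gamma> d] by auto
  let ?\<beta> = "compose (carrier A) (Ad A ?w) \<alpha>"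
  have "?\<beta> u = cis (2 * pi * \<gamma>) \<odot>\<^bsub>A\<^esub> (\<Lambda> powi l \<odot>\<^bsub>A\<^esub> u)"
    by (simp add: compose_def \<alpha> star_hom_smult[OF Ad_hom[OF w]] Adw_u)
  also have "\<dots> = cis (2 * pi * (\<gamma> + of_int l * \<theta>)) \<odot>\<^bsub>A\<^esub> u"
    by (simp add: smult_smult \<Lambda>l cis_mult algebra_simps)
  finally have 1: "?\<beta> u = \<dots>" .
  have "?\<beta> v = calc (circle_rot (\<Lambda> powi l) ?W) \<otimes>\<^bsub>A\<^esub> (\<Lambda> powi (- k) \<odot>\<^bsub>A\<^esub> v)"
    using Wc by (simp add: compose_def \<alpha> star_hom_mult[OF Ad_hom[OF w]] Adw_W Adw_v)
  also have "\<dots> = calc (winding d g) \<otimes>\<^bsub>A\<^esub> v"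
    using rWc by (simp add: wg star_hom_smult[OF calc_hom] smult_mult_left smult_mult_right)
  finally have 2: "?\<beta> v = \<dots>" .
  have "?\<beta> \<in> star_aut A"
    using Ad_compose_star_aut[OF complex_star_algebra_axioms w \<alpha>(1)] .
  then show ?thesis
    using rot_aut_iff[OF gc, of ?\<beta>] 1 2 by (simp add: \<alpha>_def)
qed

end

section \<open>Isometric isomorphisms and completions\<close>

text \<open>Weaker than \<open>complex_star_algebra\<close>, so that the associativity of the twisted convolution
  never has to be checked.\<close>

definition closed_operations :: "('a, 'm) star_algebra_scheme \<Rightarrow> bool" where
  "closed_operations D \<longleftrightarrow>
     \<one>\<^bsub>D\<^esub> \<in> carrier D \<and>
     (\<forall>x\<in>carrier D. \<forall>y\<in>carrier D. x \<otimes>\<^bsub>D\<^esub> y \<in> carrier D \<and> x \<oplus>\<^bsub>D\<^esub> y \<in> carrier D) \<and>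
     (\<forall>c. \<forall>x\<in>carrier D. c \<odot>\<^bsub>D\<^esub> x \<in> carrier D \<and> star D x \<in> carrier D)"

lemma (in complex_star_algebra) closed_operations: "closed_operations A"
  by (simp add: closed_operations_def)

lemma star_hom_inv_into:
  assumes \<Psi>: "star_hom D D' \<Psi>" "bij_betw \<Psi> (carrier D) (carrier D')" and D: "closed_operations D"
  shows "star_hom D' D (inv_into (carrier D) \<Psi>)"
proof -
  let ?I = "inv_into (carrier D) \<Psi>"
  have surj: "\<exists>x\<in>carrier D. y = \<Psi> x" if "y \<in> carrier D'" for y
    using that \<Psi>(2) by (auto simp: bij_betw_def)
  have I: "?I (\<Psi> x) = x" if "x \<in> carrier D" for x
    using that \<Psi>(2) by (simp add: bij_betw_def)
  note D = D[unfolded closed_operations_def]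
  show ?thesis
  proof (rule star_homI)
    fix y z assume "y \<in> carrier D'" "z \<in> carrier D'"
    then obtain a b where "a \<in> carrier D" "b \<in> carrier D" "y = \<Psi> a" "z = \<Psi> b" using surj by blast
    then show "?I (y \<otimes>\<^bsub>D'\<^esub> z) = ?I y \<otimes>\<^bsub>D\<^esub> ?I z" "?I (y \<oplus>\<^bsub>D'\<^esub> z) = ?I y \<oplus>\<^bsub>D\<^esub> ?I z"
      using D by (simp_all add: I flip: star_hom_mult[OF \<Psi>(1)] star_hom_add[OF \<Psi>(1)])
  next
    fix y c assume "y \<in> carrier D'"
    then obtain a where "a \<in> carrier D" "y = \<Psi> a" using surj by blast
    then show "?I y \<in> carrier D" "?I (c \<odot>\<^bsub>D'\<^esub> y) = c \<odot>\<^bsub>D\<^esub> ?I y" "?I (star D' y) = star D (?I y)"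
      using D by (simp_all add: I flip: star_hom_smult[OF \<Psi>(1)] star_hom_star[OF \<Psi>(1)])
  next
    show "?I \<one>\<^bsub>D'\<^esub> = \<one>\<^bsub>D\<^esub>" using D by (simp add: I flip: star_hom_one[OF \<Psi>(1)])
  qed
qed

lemma seq_class_subset: "seq_class D q x \<subseteq> cauchy_seqs D q"
  by (auto simp: seq_class_def null_rel_def)

text \<open>Applied termwise, an isometric bijection carries Cauchy sequences to Cauchy sequences
  and null classes onto null classes, so the isomorphism is the image map on classes. The operations
  of a completion are unions over representatives and hence commute with images.\<close>

lemma completion_isomorphic:
  assumes D: "abelian_group D" "closed_operations D" and D': "abelian_group D'"
    and \<Psi>: "star_hom D D' \<Psi>" and bij: "bij_betw \<Psi> (carrier D) (carrier D')"
    and iso: "\<And>x. x \<in> carrier D \<Longrightarrow> q' (\<Psi> x) = q x"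
  shows "star_isomorphic (completion D q) (completion D' q')"
proof -
  interpret D: abelian_group D by fact
  interpret D': abelian_group D' by fact
  note [simp] = star_hom_closed[OF \<Psi>]
  note closed = D(2)[unfolded closed_operations_def]
  have zero: "\<Psi> \<zero>\<^bsub>D\<^esub> = \<zero>\<^bsub>D'\<^esub>"
  proof -
    have "\<Psi> \<zero>\<^bsub>D\<^esub> \<oplus>\<^bsub>D'\<^esub> \<Psi> \<zero>\<^bsub>D\<^esub> = \<Psi> \<zero>\<^bsub>D\<^esub>"
      using star_hom_add[OF \<Psi>, of "\<zero>\<^bsub>D\<^esub>" "\<zero>\<^bsub>D\<^esub>"] by simp
    then show ?thesis by (metis D'.add.r_cancel_one' D.zero_closed star_hom_closed[OF \<Psi>])
  qed
  have minus: "\<Psi> (x \<ominus>\<^bsub>D\<^esub> y) = \<Psi> x \<ominus>\<^bsub>D'\<^esub> \<Psi> y" if "x \<in> carrier D" "y \<in> carrier D" for x y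
  proof -
    have "\<Psi> (\<ominus>\<^bsub>D\<^esub> y) \<oplus>\<^bsub>D'\<^esub> \<Psi> y = \<zero>\<^bsub>D'\<^esub>"
      using star_hom_add[OF \<Psi>, of "\<ominus>\<^bsub>D\<^esub> y" y] that by (simp add: D.l_neg zero)
    then have "\<ominus>\<^bsub>D'\<^esub> \<Psi> y = \<Psi> (\<ominus>\<^bsub>D\<^esub> y)" using that by (intro D'.minus_equality) auto
    then show ?thesis using that by (simp add: a_minus_def star_hom_add[OF \<Psi>])
  qed
  define T where "T x = (\<lambda>n :: nat. \<Psi> (x n))" for x
  have T_cauchy: "T x \<in> cauchy_seqs D' q' \<longleftrightarrow> x \<in> cauchy_seqs D q" if "\<And>n. x n \<in> carrier D" for x
    using that by (simp add: cauchy_seqs_def T_def iso flip: minus)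
  have T_null: "(T x, T y) \<in> null_rel D' q' \<longleftrightarrow> (x, y) \<in> null_rel D q"
    if "\<And>n. x n \<in> carrier D" "\<And>n. y n \<in> carrier D" for x y
    using that T_cauchy by (simp add: null_rel_def) (simp add: T_def iso flip: minus)
  have cauchy_car: "x n \<in> carrier D" if "x \<in> cauchy_seqs D q" for x n
    using that by (simp add: cauchy_seqs_def)
  have T_surj: "\<exists>x. (\<forall>n. x n \<in> carrier D) \<and> T x = y" if "\<And>n. y n \<in> carrier D'" for y
  proof (intro exI[of _ "\<lambda>n. inv_into (carrier D) \<Psi> (y n)"] conjI allI)
    have "\<Psi> ` carrier D = carrier D'" using bij by (simp add: bij_betw_def)
    then show "inv_into (carrier D) \<Psi> (y n) \<in> carrier D" "T (\<lambda>n. inv_into (carrier D) \<Psi> (y n)) = y" for n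
      using that by (auto simp: T_def fun_eq_iff inv_into_into f_inv_into_f)
  qed
  have T_class: "T ` seq_class D q x = seq_class D' q' (T x)" if x: "\<And>n. x n \<in> carrier D" for x
  proof
    show "T ` seq_class D q x \<subseteq> seq_class D' q' (T x)"
    proof
      fix y assume "y \<in> T ` seq_class D q x"
      then obtain z where z: "y = T z" "(x, z) \<in> null_rel D q" by (auto simp: seq_class_def)
      then have "\<And>n. z n \<in> carrier D" using cauchy_car by (auto simp: null_rel_def)
      then show "y \<in> seq_class D' q' (T x)" using z T_null[of x z] x by (simp add: seq_class_def)
    qed
    show "seq_class D' q' (T x) \<subseteq> T ` seq_class D q x"
    proof
      fix y assume y: "y \<in> seq_class D' q' (T x)"
      then have "y \<in> cauchy_seqs D' q'" using seq_class_subset by blast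
      then have "\<And>n. y n \<in> carrier D'" by (simp add: cauchy_seqs_def)
      then obtain z where z: "\<And>n. z n \<in> carrier D" "T z = y" using T_surj by blast
      then have "z \<in> seq_class D q x" using y T_null[of x z] x by (simp add: seq_class_def)
      then show "y \<in> T ` seq_class D q x" using z by blast
    qed
  qed
  have T_inj: "inj_on T (cauchy_seqs D q)"
  proof (rule inj_onI)
    fix x y assume "x \<in> cauchy_seqs D q" "y \<in> cauchy_seqs D q" "T x = T y"
    then have "x n = y n" for n
      using bij cauchy_car by (auto simp: T_def fun_eq_iff bij_betw_def dest: inj_onD)
    then show "x = y" by blast
  qed
  have sub: "X \<subseteq> cauchy_seqs D q" if "X \<in> carrier (completion D q)" for X
    using that seq_class_subset by (force simp: completion_carrier)
  have car: "x n \<in> carrier D" if "X \<in> carrier (completion D q)" "x \<in> X" for X x n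
    using sub[OF that(1)] that(2) cauchy_car by blast
  define \<Theta> where "\<Theta> X = T ` X" for X
  have "bij_betw \<Theta> (carrier (completion D q)) (carrier (completion D' q'))"
    unfolding bij_betw_def
  proof
    show "inj_on \<Theta> (carrier (completion D q))"
      unfolding \<Theta>_def using sub T_inj by (meson inj_onI inj_on_image_eq_iff)
    show "\<Theta> ` carrier (completion D q) = carrier (completion D' q')"
    proof
      show "\<Theta> ` carrier (completion D q) \<subseteq> carrier (completion D' q')"
        using T_class T_cauchy cauchy_car by (auto simp: completion_carrier \<Theta>_def)
      show "carrier (completion D' q') \<subseteq> \<Theta> ` carrier (completion D q)"
      proof
        fix Y assume "Y \<in> carrier (completion D' q')"
        then obtain y where y: "y \<in> cauchy_seqs D' q'" "Y = seq_class D' q' y"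
          by (auto simp: completion_carrier)
        obtain x where x: "\<And>n. x n \<in> carrier D" "T x = y"
          using T_surj[of y] y(1) by (auto simp: cauchy_seqs_def)
        then have "x \<in> cauchy_seqs D q" "Y = \<Theta> (seq_class D q x)"
          using y T_cauchy[of x] T_class[of x] by (auto simp: \<Theta>_def)
        then show "Y \<in> \<Theta> ` carrier (completion D q)" by (auto simp: completion_carrier)
      qed
    qed
  qed
  moreover have "star_hom (completion D q) (completion D' q') \<Theta>"
  proof (rule star_homI)
    show "\<Theta> X \<in> carrier (completion D' q')" if "X \<in> carrier (completion D q)" for X
      using that \<open>bij_betw \<Theta> _ _\<close> by (auto simp: bij_betw_def)
  next
    fix X Y assume X: "X \<in> carrier (completion D q)" and Y: "Y \<in> carrier (completion D q)"
    have "T ` seq_class D q (\<lambda>n. x n \<otimes>\<^bsub>D\<^esub> y n) = seq_class D' q' (\<lambda>n. T x n \<otimes>\<^bsub>D'\<^esub> T y n)"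
      if "x \<in> X" "y \<in> Y" for x y
      using car[OF X that(1)] car[OF Y that(2)] closed
      by (subst T_class) (simp_all add: T_def star_hom_mult[OF \<Psi>])
    then show "\<Theta> (X \<otimes>\<^bsub>completion D q\<^esub> Y) = \<Theta> X \<otimes>\<^bsub>completion D' q'\<^esub> \<Theta> Y"
      by (simp add: completion_def \<Theta>_def image_UN)
    have "T ` seq_class D q (\<lambda>n. x n \<oplus>\<^bsub>D\<^esub> y n) = seq_class D' q' (\<lambda>n. T x n \<oplus>\<^bsub>D'\<^esub> T y n)"
      if "x \<in> X" "y \<in> Y" for x y
      using car[OF X that(1)] car[OF Y that(2)] closed
      by (subst T_class) (simp_all add: T_def star_hom_add[OF \<Psi>])
    then show "\<Theta> (X \<oplus>\<^bsub>completion D q\<^esub> Y) = \<Theta> X \<oplus>\<^bsub>completion D' q'\<^esub> \<Theta> Y"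
      by (simp add: completion_def \<Theta>_def image_UN)
  next
    fix c X assume X: "X \<in> carrier (completion D q)"
    have "T ` seq_class D q (\<lambda>n. c \<odot>\<^bsub>D\<^esub> x n) = seq_class D' q' (\<lambda>n. c \<odot>\<^bsub>D'\<^esub> T x n)" if "x \<in> X" for x
      using car[OF X that] closed by (subst T_class) (simp_all add: T_def star_hom_smult[OF \<Psi>])
    then show "\<Theta> (c \<odot>\<^bsub>completion D q\<^esub> X) = c \<odot>\<^bsub>completion D' q'\<^esub> \<Theta> X"
      by (simp add: completion_def \<Theta>_def image_UN)
    have "T ` seq_class D q (\<lambda>n. star D (x n)) = seq_class D' q' (\<lambda>n. star D' (T x n))" if "x \<in> X" for x
      using car[OF X that] closed by (subst T_class) (simp_all add: T_def star_hom_star[OF \<Psi>])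
    then show "\<Theta> (star (completion D q) X) = star (completion D' q') (\<Theta> X)"
      by (simp add: completion_def \<Theta>_def image_UN)
  next
    show "\<Theta> \<one>\<^bsub>completion D q\<^esub> = \<one>\<^bsub>completion D' q'\<^esub>"
      using T_class[of "\<lambda>n. \<one>\<^bsub>D\<^esub>"] closed star_hom_one[OF \<Psi>] by (simp add: completion_def \<Theta>_def T_def)
  qed
  ultimately show ?thesis unfolding star_isomorphic_def by blast
qed

section \<open>Cocycles\<close>

context complex_star_algebra
begin

lemma star_aut_hom: "\<phi> \<in> star_aut A \<Longrightarrow> star_hom A A \<phi>"
  and star_aut_Bij: "\<phi> \<in> star_aut A \<Longrightarrow> \<phi> \<in> Bij (carrier A)"
  by (simp_all add: star_aut_def)

lemma star_aut_closed: "\<phi> \<in> star_aut A \<Longrightarrow> a \<in> carrier A \<Longrightarrow> \<phi> a \<in> carrier A"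
  by (rule star_hom_closed[OF star_aut_hom])

lemma star_aut_unitary: "\<phi> \<in> star_aut A \<Longrightarrow> unitary w \<Longrightarrow> unitary (\<phi> w)"
  using star_hom_unitary[OF complex_star_algebra_axioms complex_star_algebra_axioms star_aut_hom] .

lemma star_aut_compose:
  assumes "\<phi> \<in> star_aut A" "\<psi> \<in> star_aut A" shows "compose (carrier A) \<phi> \<psi> \<in> star_aut A"
proof -
  have "star_hom A A (compose (carrier A) \<phi> \<psi>)"
    by (rule star_hom_cong[OF complex_star_algebra_axioms
          star_hom_comp[OF star_aut_hom[OF assms(2)] star_aut_hom[OF assms(1)]]]) (simp add: compose_def)
  then show ?thesis using assms by (simp add: star_aut_def compose_Bij)
qed

lemma star_aut_id: "(\<lambda>x\<in>carrier A. x) \<in> star_aut A"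
proof -
  have "star_hom A A (\<lambda>x\<in>carrier A. x)"
    by (rule star_hom_cong[OF complex_star_algebra_axioms star_homI[of A "\<lambda>x. x" A]]) auto
  then show ?thesis by (simp add: star_aut_def id_Bij)
qed

lemma star_aut_inv:
  assumes "\<phi> \<in> star_aut A" shows "restrict (inv_into (carrier A) \<phi>) (carrier A) \<in> star_aut A"
proof -
  have "bij_betw \<phi> (carrier A) (carrier A)" using star_aut_Bij[OF assms] by (simp add: Bij_def)
  then have "star_hom A A (inv_into (carrier A) \<phi>)"
    using star_hom_inv_into[OF star_aut_hom[OF assms] _ closed_operations] by blast
  then have "star_hom A A (restrict (inv_into (carrier A) \<phi>) (carrier A))"
    by (rule star_hom_cong[OF complex_star_algebra_axioms]) simp
  then show ?thesis using star_aut_Bij[OF assms] restrict_inv_into_Bij by (simp add: star_aut_def)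
qed

text \<open>The semidirect product of the unitary group by the automorphism group. The integer powers
  of \<open>(w, \<alpha>)\<close> in this group have the form \<open>(w\<^sub>n, \<alpha>\<^sup>n)\<close>, where \<open>w\<^sub>n\<close> is the cocycle with
  \<open>(Ad w \<circ> \<alpha>)\<^sup>n = Ad w\<^sub>n \<circ> \<alpha>\<^sup>n\<close>.\<close>

definition unitary_aut_group :: "('a \<times> ('a \<Rightarrow> 'a)) monoid" where
  "unitary_aut_group =
     \<lparr>carrier = {w. unitary w} \<times> star_aut A,
      mult = (\<lambda>(x, \<phi>) (y, \<psi>). (x \<otimes> \<phi> y, compose (carrier A) \<phi> \<psi>)),
      one = (\<one>, \<lambda>x\<in>carrier A. x)\<rparr>"

lemma group_unitary_aut_group: "group unitary_aut_group"
proof (rule groupI)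
  fix a assume "a \<in> carrier unitary_aut_group"
  then obtain x \<phi> where a: "a = (x, \<phi>)" "unitary x" "\<phi> \<in> star_aut A"
    by (auto simp: unitary_aut_group_def)
  \<comment> \<open>A left inverse of (x, \<phi>) is the inverse of \<phi>, paired with the value of
    that inverse at the adjoint of x.\<close>
  let ?\<psi> = "restrict (inv_into (carrier A) \<phi>) (carrier A)"
  have \<psi>: "?\<psi> \<in> star_aut A" using star_aut_inv[OF a(3)] .
  have "?\<psi> (star A x) \<otimes> ?\<psi> x = \<one>"
    using star_hom_mult[OF star_aut_hom[OF \<psi>], of "star A x" x] star_hom_one[OF star_aut_hom[OF \<psi>]] a(2)
    by (simp only: unitary_def star_closed)
  moreover have "compose (carrier A) ?\<psi> \<phi> = (\<lambda>x\<in>carrier A. x)"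
    using star_aut_Bij[OF a(3)] by (rule Bij_compose_restrict_eq)
  moreover have "unitary (?\<psi> (star A x))"
    using star_aut_unitary[OF \<psi>] a(2) unitary_star by blast
  ultimately show "\<exists>b\<in>carrier unitary_aut_group. b \<otimes>\<^bsub>unitary_aut_group\<^esub> a = \<one>\<^bsub>unitary_aut_group\<^esub>"
    using a \<psi> by (intro bexI[of _ "(?\<psi> (star A x), ?\<psi>)"]) (auto simp: unitary_aut_group_def)
next
  fix a b c assume "a \<in> carrier unitary_aut_group" "b \<in> carrier unitary_aut_group" "c \<in> carrier unitary_aut_group"
  then obtain x \<phi> y \<psi> z \<eta> where abc: "a = (x, \<phi>)" "unitary x" "\<phi> \<in> star_aut A"
      "b = (y, \<psi>)" "unitary y" "\<psi> \<in> star_aut A" "c = (z, \<eta>)" "unitary z" "\<eta> \<in> star_aut A"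
    by (auto simp: unitary_aut_group_def)
  have "\<phi> (y \<otimes> \<psi> z) = \<phi> y \<otimes> \<phi> (\<psi> z)"
    using star_hom_mult[OF star_aut_hom[OF abc(3)], of y "\<psi> z"] abc star_aut_closed by simp
  moreover have "compose (carrier A) (compose (carrier A) \<phi> \<psi>) \<eta> = compose (carrier A) \<phi> (compose (carrier A) \<psi> \<eta>)"
    using Bij_imp_funcset[OF star_aut_Bij[OF abc(9)]] by (rule compose_assoc[symmetric])
  ultimately show "a \<otimes>\<^bsub>unitary_aut_group\<^esub> b \<otimes>\<^bsub>unitary_aut_group\<^esub> c
      = a \<otimes>\<^bsub>unitary_aut_group\<^esub> (b \<otimes>\<^bsub>unitary_aut_group\<^esub> c)"
    using abc star_aut_closed by (simp add: unitary_aut_group_def m_assoc compose_eq)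
qed (auto simp: unitary_aut_group_def unitary_one star_aut_id unitary_mult star_aut_unitary
    star_aut_compose Bij_imp_extensional star_aut_Bij Bij_imp_funcset)

text \<open>Two homomorphisms from the semidirect product to the group of bijections are applied to
  the powers of (w, \<alpha>): the second projection, which gives powers of \<alpha>, and (x,
  \<phi>) \<mapsto> Ad x \<circ> \<phi>, which gives powers of Ad w \<circ> \<alpha>. The cocycle
  identity is the first component of the exponent law.\<close>

lemma ex_cocycle:
  assumes \<alpha>: "\<alpha> \<in> star_aut A" and w: "unitary w"
  obtains W :: "int \<Rightarrow> 'a" where "\<And>n. unitary (W n)" "W 0 = \<one>"
    "\<And>n. aut_power A \<alpha> n \<in> star_aut A"
    "\<And>m n. W (m + n) = W m \<otimes> aut_power A \<alpha> m (W n)"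
    "\<And>n a. a \<in> carrier A \<Longrightarrow>
       aut_power A (compose (carrier A) (Ad A w) \<alpha>) n a = Ad A (W n) (aut_power A \<alpha> n a)"
proof -
  let ?G = unitary_aut_group and ?B = "BijGroup (carrier A)"
  interpret G: group ?G by (rule group_unitary_aut_group)
  interpret B: group ?B by (rule group_BijGroup)
  let ?g = "(w, \<alpha>)"
  have g: "?g \<in> carrier ?G" using assms by (simp add: unitary_aut_group_def)
  have snd_hom: "snd \<in> hom ?G ?B"
    by (rule homI) (auto simp: unitary_aut_group_def BijGroup_def star_aut_Bij)
  let ?h = "\<lambda>(x, \<phi>). compose (carrier A) (Ad A x) \<phi>"
  have Ad_hom': "?h \<in> hom ?G ?B"
  proof (rule homI)
    fix a assume "a \<in> carrier ?G"
    then show "?h a \<in> carrier ?B"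
      using star_aut_Bij[OF Ad_compose_star_aut[OF complex_star_algebra_axioms]]
      by (auto simp: unitary_aut_group_def BijGroup_def)
  next
    fix a b assume "a \<in> carrier ?G" "b \<in> carrier ?G"
    then obtain x \<phi> y \<psi> where ab: "a = (x, \<phi>)" "unitary x" "\<phi> \<in> star_aut A"
      "b = (y, \<psi>)" "unitary y" "\<psi> \<in> star_aut A"
      by (auto simp: unitary_aut_group_def)
    have "Ad A (x \<otimes> \<phi> y) (\<phi> (\<psi> c)) = Ad A x (\<phi> (Ad A y (\<psi> c)))" if "c \<in> carrier A" for c
    proof -
      have c: "\<psi> c \<in> carrier A" "\<phi> (\<psi> c) \<in> carrier A" "\<phi> y \<in> carrier A"
        using that ab star_aut_closed by auto
      \<comment> \<open>An automorphism conjugates Ad y into the inner automorphism of its value at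
        y; this is what makes \<open>?h\<close> multiplicative.\<close>
      have "\<phi> (Ad A y (\<psi> c)) = Ad A (\<phi> y) (\<phi> (\<psi> c))"
        using c ab(5) by (simp add: Ad_def star_hom_mult[OF star_aut_hom[OF ab(3)]] star_hom_star[OF star_aut_hom[OF ab(3)]])
      then show ?thesis using c ab(2) by (simp add: Ad_mult)
    qed
    moreover have "compose (carrier A) (Ad A x) \<phi> \<in> Bij (carrier A)" "compose (carrier A) (Ad A y) \<psi> \<in> Bij (carrier A)"
      using star_aut_Bij[OF Ad_compose_star_aut[OF complex_star_algebra_axioms]] ab by auto
    moreover have "Ad A y (\<psi> c) \<in> carrier A" if "c \<in> carrier A" for c
      using star_hom_closed[OF Ad_hom[OF ab(5)] star_aut_closed[OF ab(6) that]] .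
    ultimately show "?h (a \<otimes>\<^bsub>?G\<^esub> b) = ?h a \<otimes>\<^bsub>?B\<^esub> ?h b"
      using ab(1,4) by (simp add: unitary_aut_group_def BijGroup_def compose_def fun_eq_iff)
  qed
  define W where "W n = fst (?g [^]\<^bsub>?G\<^esub> n)" for n :: int
  have pow: "?g [^]\<^bsub>?G\<^esub> n = (W n, aut_power A \<alpha> n)" for n :: int
    using hom_int_pow[OF snd_hom g G.is_group B.is_group, of n]
    by (simp add: W_def aut_power_def prod_eq_iff)
  have mem: "unitary (W n)" "aut_power A \<alpha> n \<in> star_aut A" for n
    using G.int_pow_closed[OF g, of n] unfolding pow by (auto simp: unitary_aut_group_def)
  show thesis
  proof (rule that[of W])
    show "W 0 = \<one>" by (simp add: W_def) (simp add: unitary_aut_group_def)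
    show "W (m + n) = W m \<otimes> aut_power A \<alpha> m (W n)" for m n
      using G.int_pow_mult[OF g, of m n] by (simp add: pow) (simp add: unitary_aut_group_def)
    show "aut_power A (compose (carrier A) (Ad A w) \<alpha>) n a = Ad A (W n) (aut_power A \<alpha> n a)"
      if "a \<in> carrier A" for n a
      using hom_int_pow[OF Ad_hom' g G.is_group B.is_group, of n] that
      by (metis (no_types, lifting) aut_power_def case_prod_conv compose_eq pow)
  qed (use mem in auto)
qed

end

section \<open>Crossed products\<close>

text \<open>Multiplication by w and by its adjoint do not increase the seminorm, and one undoes the
  other. Used coefficientwise, this preserves the l1 norm.\<close>

lemma (in cstar_seminormed) q_mult_unitary:
  assumes "x \<in> carrier A" "unitary w" shows "q (x \<otimes> w) = q x"
proof (rule antisym)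
  have le: "q (y \<otimes> z) \<le> q y" if "y \<in> carrier A" "unitary z" for y z
    using q_mult[of y z] q_unitary_le[OF that(2)] that mult_left_mono[of "q z" 1 "q y"] by simp
  show "q (x \<otimes> w) \<le> q x" using le assms .
  have "(x \<otimes> w) \<otimes> star A w = x" using assms by (simp add: m_assoc unitary_def)
  then show "q x \<le> q (x \<otimes> w)" using le[of "x \<otimes> w" "star A w"] assms by (simp add: unitary_star)
qed

lemma Cc_carrier: "x \<in> carrier (Cc_algebra A \<alpha>) \<longleftrightarrow> (\<forall>n. x n \<in> carrier A) \<and> finite {n. x n \<noteq> \<zero>\<^bsub>A\<^esub>}"
  and Cc_mult: "(x \<otimes>\<^bsub>Cc_algebra A \<alpha>\<^esub> y) n =
    (\<Oplus>\<^bsub>A\<^esub>m\<in>{m. x m \<noteq> \<zero>\<^bsub>A\<^esub>}. x m \<otimes>\<^bsub>A\<^esub> aut_power A \<alpha> m (y (n - m)))"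
  and Cc_one: "\<one>\<^bsub>Cc_algebra A \<alpha>\<^esub> = (\<lambda>n. if n = 0 then \<one>\<^bsub>A\<^esub> else \<zero>\<^bsub>A\<^esub>)"
  and Cc_zero: "\<zero>\<^bsub>Cc_algebra A \<alpha>\<^esub> = (\<lambda>n. \<zero>\<^bsub>A\<^esub>)"
  and Cc_add: "x \<oplus>\<^bsub>Cc_algebra A \<alpha>\<^esub> y = (\<lambda>n. x n \<oplus>\<^bsub>A\<^esub> y n)"
  and Cc_smult: "c \<odot>\<^bsub>Cc_algebra A \<alpha>\<^esub> x = (\<lambda>n. c \<odot>\<^bsub>A\<^esub> x n)"
  and Cc_star: "star (Cc_algebra A \<alpha>) x = (\<lambda>n. aut_power A \<alpha> n (star A (x (- n))))"
  by (simp_all add: Cc_algebra_def)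

section \<open>Closure properties of the twisted convolution algebra\<close>

context complex_star_algebra
begin

lemma star_hom_zero: "star_hom A A \<phi> \<Longrightarrow> \<phi> \<zero> = \<zero>"
  using star_hom_smult[of A A \<phi> \<zero> 0] star_hom_closed[of A A \<phi> \<zero>] by simp

text \<open>Read off from the cocycle construction at w = 1.\<close>

lemma aut_power_star_aut: "\<alpha> \<in> star_aut A \<Longrightarrow> aut_power A \<alpha> n \<in> star_aut A"
  using ex_cocycle[OF _ unitary_one] by metis

lemma Cc_add_closed:
  assumes "x \<in> carrier (Cc_algebra A \<alpha>)" "y \<in> carrier (Cc_algebra A \<alpha>)"
  shows "x \<oplus>\<^bsub>Cc_algebra A \<alpha>\<^esub> y \<in> carrier (Cc_algebra A \<alpha>)"
proof -
  have "{n. x n \<oplus> y n \<noteq> \<zero>} \<subseteq> {n. x n \<noteq> \<zero>} \<union> {n. y n \<noteq> \<zero>}" by auto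
  then show ?thesis using assms unfolding Cc_carrier Cc_add by (auto intro: finite_subset)
qed

lemma Cc_smult_closed:
  assumes "x \<in> carrier (Cc_algebra A \<alpha>)" shows "c \<odot>\<^bsub>Cc_algebra A \<alpha>\<^esub> x \<in> carrier (Cc_algebra A \<alpha>)"
proof -
  have "{n. c \<odot> x n \<noteq> \<zero>} \<subseteq> {n. x n \<noteq> \<zero>}" by auto
  then show ?thesis using assms unfolding Cc_carrier Cc_smult by (auto intro: finite_subset)
qed

lemma Cc_abelian_group: "abelian_group (Cc_algebra A \<alpha>)"
proof (rule abelian_groupI)
  fix x assume x: "x \<in> carrier (Cc_algebra A \<alpha>)"
  then have "((- 1) \<odot>\<^bsub>Cc_algebra A \<alpha>\<^esub> x) \<oplus>\<^bsub>Cc_algebra A \<alpha>\<^esub> x = \<zero>\<^bsub>Cc_algebra A \<alpha>\<^esub>"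
    by (simp add: Cc_carrier Cc_add Cc_smult Cc_zero smult_minus_one l_neg)
  then show "\<exists>y\<in>carrier (Cc_algebra A \<alpha>). y \<oplus>\<^bsub>Cc_algebra A \<alpha>\<^esub> x = \<zero>\<^bsub>Cc_algebra A \<alpha>\<^esub>"
    using Cc_smult_closed[OF x] by blast
qed (simp add: Cc_add_closed, auto simp: Cc_carrier Cc_add Cc_zero a_ac)

lemma Cc_closed_operations:
  assumes \<alpha>: "\<alpha> \<in> star_aut A" shows "closed_operations (Cc_algebra A \<alpha>)"
proof -
  have pow: "star_hom A A (aut_power A \<alpha> n)" for n
    using star_aut_hom[OF aut_power_star_aut[OF \<alpha>]] .
  have mult: "x \<otimes>\<^bsub>Cc_algebra A \<alpha>\<^esub> y \<in> carrier (Cc_algebra A \<alpha>)"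
    if x: "x \<in> carrier (Cc_algebra A \<alpha>)" and y: "y \<in> carrier (Cc_algebra A \<alpha>)" for x y
  proof -
    let ?S = "\<lambda>x. {n. x n \<noteq> \<zero>}"
    have "?S (x \<otimes>\<^bsub>Cc_algebra A \<alpha>\<^esub> y) \<subseteq> (\<lambda>(m, k). m + k) ` (?S x \<times> ?S y)"
    proof
      fix n assume n: "n \<in> ?S (x \<otimes>\<^bsub>Cc_algebra A \<alpha>\<^esub> y)"
      have "\<exists>m\<in>?S x. y (n - m) \<noteq> \<zero>"
      proof (rule ccontr)
        assume "\<not> (\<exists>m\<in>?S x. y (n - m) \<noteq> \<zero>)"
        then have "(x \<otimes>\<^bsub>Cc_algebra A \<alpha>\<^esub> y) n = (\<Oplus>m\<in>?S x. \<zero>)"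
          unfolding Cc_mult using x by (intro finsum_cong') (auto simp: star_hom_zero[OF pow] Cc_carrier)
        then show False using n by simp
      qed
      then show "n \<in> (\<lambda>(m, k). m + k) ` (?S x \<times> ?S y)"
        by (auto intro!: image_eqI[of _ _ "(_, n - _)"])
    qed
    then have "finite (?S (x \<otimes>\<^bsub>Cc_algebra A \<alpha>\<^esub> y))"
      by (rule finite_subset) (use x y in \<open>simp add: Cc_carrier\<close>)
    moreover have "(x \<otimes>\<^bsub>Cc_algebra A \<alpha>\<^esub> y) n \<in> carrier A" for n
      unfolding Cc_mult using x y by (auto simp: Cc_carrier star_hom_closed[OF pow] intro!: finsum_closed)
    ultimately show ?thesis by (simp add: Cc_carrier)
  qed
  have star: "star (Cc_algebra A \<alpha>) x \<in> carrier (Cc_algebra A \<alpha>)"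
    if x: "x \<in> carrier (Cc_algebra A \<alpha>)" for x
  proof -
    have "{n. star (Cc_algebra A \<alpha>) x n \<noteq> \<zero>} \<subseteq> uminus ` {n. x n \<noteq> \<zero>}"
    proof
      fix n assume "n \<in> {n. star (Cc_algebra A \<alpha>) x n \<noteq> \<zero>}"
      then have "x (- n) \<noteq> \<zero>" by (auto simp: Cc_star star_hom_zero[OF pow])
      then show "n \<in> uminus ` {n. x n \<noteq> \<zero>}" by (intro image_eqI[of _ _ "- n"]) auto
    qed
    then show ?thesis using x unfolding Cc_carrier
      by (auto simp: Cc_star star_hom_closed[OF pow] intro: finite_subset)
  qed
  have "\<one>\<^bsub>Cc_algebra A \<alpha>\<^esub> \<in> carrier (Cc_algebra A \<alpha>)"
    unfolding Cc_carrier Cc_one by (auto intro: finite_subset[of _ "{0}"])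
  then show ?thesis
    using mult star Cc_add_closed Cc_smult_closed by (simp add: closed_operations_def)
qed

end

section \<open>Crossed products by automorphisms that differ by an inner one\<close>

context cstar_algebra
begin

theorem crossed_product_Ad_isomorphic:
  assumes \<alpha>: "\<alpha> \<in> star_aut A" and w: "unitary w"
  shows "star_isomorphic (crossed_product A \<alpha>) (crossed_product A (compose (carrier A) (Ad A w) \<alpha>))"
proof -
  define \<beta> where "\<beta> = compose (carrier A) (Ad A w) \<alpha>"
  have \<beta>: "\<beta> \<in> star_aut A"
    unfolding \<beta>_def by (rule Ad_compose_star_aut[OF complex_star_algebra_axioms w \<alpha>])
  let ?C = "Cc_algebra A \<alpha>" and ?C' = "Cc_algebra A \<beta>"
  obtain W where W: "\<And>n. unitary (W n)" "W 0 = \<one>"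
    and pow: "\<And>n. aut_power A \<alpha> n \<in> star_aut A"
    and cocycle: "\<And>m n. W (m + n) = W m \<otimes> aut_power A \<alpha> m (W n)"
    and \<beta>pow: "\<And>n a. a \<in> carrier A \<Longrightarrow> aut_power A \<beta> n a = Ad A (W n) (aut_power A \<alpha> n a)"
    unfolding \<beta>_def using ex_cocycle[OF \<alpha> w] by metis
  have hom: "star_hom A A (aut_power A \<alpha> n)" for n using star_aut_hom[OF pow] .
  have Wc [simp]: "W n \<in> carrier A" for n using W(1) by simp
  note [simp] = star_hom_closed[OF hom]
  have cancel: "x \<otimes> star A (W n) \<otimes> W n = x" "x \<otimes> W n \<otimes> star A (W n) = x" if "x \<in> carrier A" for x n
    using that W(1)[of n] by (simp_all add: m_assoc unitary_def)
  have nz: "x \<otimes> star A (W n) = \<zero> \<longleftrightarrow> x = \<zero>" if "x \<in> carrier A" for x n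
    using cancel(1)[OF that, of n] that by (metis l_null star_closed Wc)
  have nz': "x \<otimes> W n = \<zero> \<longleftrightarrow> x = \<zero>" if "x \<in> carrier A" for x n
    using cancel(2)[OF that, of n] that by (metis l_null star_closed Wc)
  \<comment> \<open>Think of x as the sum of the terms x n U^n with a unitary U implementing
    \<alpha>. Then w U implements Ad w \<circ> \<alpha>, and (w U)^n = W n U^n. Rewriting x n U^n in
    powers of w U produces the coefficient \<open>x n \<otimes> star A (W n)\<close>.\<close>
  define \<Psi> where "\<Psi> x = (\<lambda>n. x n \<otimes> star A (W n))" for x
  have supp: "{n. \<Psi> x n \<noteq> \<zero>} = {n. x n \<noteq> \<zero>}" if "x \<in> carrier ?C" for x
    using that by (auto simp: \<Psi>_def Cc_carrier nz)
  have bij: "bij_betw \<Psi> (carrier ?C) (carrier ?C')"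
  proof (rule bij_betw_byWitness[where f'="\<lambda>x n. x n \<otimes> W n"])
    show "\<Psi> ` carrier ?C \<subseteq> carrier ?C'" using supp by (auto simp: Cc_carrier \<Psi>_def)
    show "(\<lambda>x n. x n \<otimes> W n) ` carrier ?C' \<subseteq> carrier ?C" by (auto simp: Cc_carrier nz')
  qed (auto simp: \<Psi>_def Cc_carrier cancel)
  \<comment> \<open>Conjugation by \<open>W m\<close> contributes a left factor that cancels
    \<open>star A (W m)\<close>. Its right factor combines with the adjoint of the image of
    \<open>W k\<close> into the adjoint of \<open>W (m + k)\<close>, by the cocycle
    identity.\<close>
  have twist: "(a \<otimes> star A (W m)) \<otimes> aut_power A \<beta> m (b \<otimes> star A (W k))
      = (a \<otimes> aut_power A \<alpha> m b) \<otimes> star A (W (m + k))" if "a \<in> carrier A" "b \<in> carrier A" for a b m k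
  proof -
    let ?p = "aut_power A \<alpha> m"
    have "aut_power A \<beta> m (b \<otimes> star A (W k)) = W m \<otimes> (?p b \<otimes> star A (?p (W k))) \<otimes> star A (W m)"
      using that by (simp add: \<beta>pow Ad_def star_hom_mult[OF hom] star_hom_star[OF hom])
    also have "\<dots> = W m \<otimes> (?p b \<otimes> star A (W (m + k)))"
      using that by (simp add: cocycle star_mult m_assoc)
    finally have "(a \<otimes> star A (W m)) \<otimes> aut_power A \<beta> m (b \<otimes> star A (W k))
        = (a \<otimes> star A (W m) \<otimes> W m) \<otimes> (?p b \<otimes> star A (W (m + k)))"
      using that by (simp add: m_assoc)
    then show ?thesis unfolding cancel(1)[OF that(1)] using that by (simp add: m_assoc)
  qed
  have \<Psi>: "star_hom ?C ?C' \<Psi>"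
  proof (rule star_homI)
    show "\<Psi> x \<in> carrier ?C'" if "x \<in> carrier ?C" for x using bij that by (auto simp: bij_betw_def)
  next
    fix x y assume x: "x \<in> carrier ?C" and y: "y \<in> carrier ?C"
    have xc: "x n \<in> carrier A" "y n \<in> carrier A" for n using x y by (auto simp: Cc_carrier)
    have fin: "finite {m. x m \<noteq> \<zero>}" using x by (simp add: Cc_carrier)
    show "\<Psi> (x \<otimes>\<^bsub>?C\<^esub> y) = \<Psi> x \<otimes>\<^bsub>?C'\<^esub> \<Psi> y"
    proof
      fix n
      have "(\<Psi> x \<otimes>\<^bsub>?C'\<^esub> \<Psi> y) n = (\<Oplus>m\<in>{m. x m \<noteq> \<zero>}. (x m \<otimes> aut_power A \<alpha> m (y (n - m))) \<otimes> star A (W n))"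
        unfolding Cc_mult supp[OF x]
        by (rule finsum_cong') (use xc twist[of "x _" "y (n - _)"] in \<open>auto simp: \<Psi>_def\<close>)
      also have "\<dots> = \<Psi> (x \<otimes>\<^bsub>?C\<^esub> y) n"
        unfolding \<Psi>_def Cc_mult by (rule finsum_ldistr[symmetric, OF fin]) (use xc in auto)
      finally show "\<Psi> (x \<otimes>\<^bsub>?C\<^esub> y) n = (\<Psi> x \<otimes>\<^bsub>?C'\<^esub> \<Psi> y) n" ..
    qed
    show "\<Psi> (x \<oplus>\<^bsub>?C\<^esub> y) = \<Psi> x \<oplus>\<^bsub>?C'\<^esub> \<Psi> y"
      using xc by (simp add: \<Psi>_def Cc_add l_distr)
  next
    show "\<Psi> \<one>\<^bsub>?C\<^esub> = \<one>\<^bsub>?C'\<^esub>" using W(2) by (auto simp: \<Psi>_def Cc_one)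
  next
    fix c x assume x: "x \<in> carrier ?C"
    have xc: "x n \<in> carrier A" for n using x by (auto simp: Cc_carrier)
    show "\<Psi> (c \<odot>\<^bsub>?C\<^esub> x) = c \<odot>\<^bsub>?C'\<^esub> \<Psi> x" using xc by (simp add: \<Psi>_def Cc_smult smult_mult_left)
    show "\<Psi> (star ?C x) = star ?C' (\<Psi> x)"
    proof
      fix n
      let ?p = "aut_power A \<alpha> n"
      have "star ?C' (\<Psi> x) n = W n \<otimes> (?p (W (- n)) \<otimes> ?p (star A (x (- n)))) \<otimes> star A (W n)"
        using xc by (simp add: Cc_star \<Psi>_def \<beta>pow Ad_def star_mult star_hom_mult[OF hom])
      \<comment> \<open>The cocycle identity at n and -n merges the two unitaries into
        \<open>W 0\<close>, which is the unit.\<close>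
      also have "\<dots> = W (n + - n) \<otimes> ?p (star A (x (- n))) \<otimes> star A (W n)"
        unfolding cocycle using xc by (simp add: m_assoc)
      also have "\<dots> = \<Psi> (star ?C x) n" using xc W(2) by (simp add: \<Psi>_def Cc_star)
      finally show "\<Psi> (star ?C x) n = star ?C' (\<Psi> x) n" ..
    qed
  qed
  have l1: "l1_norm A (\<Psi> x) = l1_norm A x" if "x \<in> carrier ?C" for x
    unfolding l1_norm_def supp[OF that]
    by (intro sum.cong) (use that in \<open>auto simp: \<Psi>_def Cc_carrier q_mult_unitary unitary_star W\<close>)
  let ?S = "{p. cstar_seminorm ?C p \<and> (\<forall>x\<in>carrier ?C. p x \<le> l1_norm A x)}"
  let ?S' = "{p. cstar_seminorm ?C' p \<and> (\<forall>x\<in>carrier ?C'. p x \<le> l1_norm A x)}"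
  let ?I = "inv_into (carrier ?C) \<Psi>"
  have closed: "closed_operations ?C" "closed_operations ?C'"
    using Cc_closed_operations \<alpha> \<beta> by auto
  have I: "star_hom ?C' ?C ?I" using star_hom_inv_into[OF \<Psi> bij closed(1)] .
  have I\<Psi>: "?I (\<Psi> x) = x" if "x \<in> carrier ?C" for x
    using that bij by (simp add: bij_betw_def)
  have \<Psi>I: "\<Psi> (?I y) = y" if "y \<in> carrier ?C'" for y
    using that bij by (simp add: bij_betw_def f_inv_into_f)
  have pull: "(\<lambda>x. p (\<Psi> x)) \<in> ?S" if "p \<in> ?S'" for p
  proof -
    have "p (\<Psi> x) \<le> l1_norm A x" if x: "x \<in> carrier ?C" for x
      using \<open>p \<in> ?S'\<close> star_hom_closed[OF \<Psi> x] l1[OF x] by fastforce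
    then show ?thesis
      using that pullback_cstar_seminorm[OF _ \<Psi>, of p] closed(1) by (auto simp: closed_operations_def)
  qed
  have push: "(\<lambda>y. p (?I y)) \<in> ?S'" if "p \<in> ?S" for p
  proof -
    have "p (?I y) \<le> l1_norm A y" if y: "y \<in> carrier ?C'" for y
      using \<open>p \<in> ?S\<close> star_hom_closed[OF I y] l1[of "?I y"] \<Psi>I[OF y] by auto
    then show ?thesis
      using that pullback_cstar_seminorm[OF _ I, of p] closed(2) by (auto simp: closed_operations_def)
  qed
  have "sup_seminorm ?S' (\<Psi> x) = sup_seminorm ?S x" if x: "x \<in> carrier ?C" for x
  proof -
    \<comment> \<open>Pulling back along \<Psi> and along its inverse matches the two families of
      seminorms, so both suprema are taken over the same set of reals.\<close>
    have "(\<lambda>p. p (\<Psi> x)) ` ?S' = (\<lambda>p. p x) ` ?S"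
    proof
      show "(\<lambda>p. p (\<Psi> x)) ` ?S' \<subseteq> (\<lambda>p. p x) ` ?S"
      proof (rule image_subsetI)
        fix p assume "p \<in> ?S'"
        then show "p (\<Psi> x) \<in> (\<lambda>p. p x) ` ?S" by (rule image_eqI[OF refl pull])
      qed
      show "(\<lambda>p. p x) ` ?S \<subseteq> (\<lambda>p. p (\<Psi> x)) ` ?S'"
      proof (rule image_subsetI)
        fix p assume "p \<in> ?S"
        then show "p x \<in> (\<lambda>p. p (\<Psi> x)) ` ?S'"
          by (intro image_eqI[OF _ push]) (simp_all add: I\<Psi> x)
      qed
    qed
    then show ?thesis by (simp add: sup_seminorm_def)
  qed
  then have "star_isomorphic (completion ?C (sup_seminorm ?S)) (completion ?C' (sup_seminorm ?S'))"
    using completion_isomorphic[OF Cc_abelian_group closed(1) Cc_abelian_group \<Psi> bij] by blast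
  then show ?thesis by (simp add: crossed_product_def universal_cstar_def \<beta>_def)
qed

end

theorem lemma1p4:
  fixes \<theta> \<gamma> :: real and d k l :: int and f g :: "complex \<Rightarrow> real"
  assumes "continuous_on unit_circle f"
    and "\<And>\<zeta>. \<zeta> \<in> unit_circle \<Longrightarrow>
           g \<zeta> = f (cis (2 * pi * (of_int l * \<theta>)) * \<zeta>) + of_int (l * d - k) * \<theta>"
  shows "compose (carrier (rotation_algebra \<theta>))
           (Ad (rotation_algebra \<theta>)
              ((rot_u \<theta> [^]\<^bsub>rotation_algebra \<theta>\<^esub> k) \<otimes>\<^bsub>rotation_algebra \<theta>\<^esub>
               (rot_v \<theta> [^]\<^bsub>rotation_algebra \<theta>\<^esub> l)))
           (rot_aut \<theta> \<gamma> d f)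
         = rot_aut \<theta> (\<gamma> + of_int l * \<theta>) d g \<and>
         star_isomorphic
           (crossed_product (rotation_algebra \<theta>) (rot_aut \<theta> \<gamma> d f))
           (crossed_product (rotation_algebra \<theta>) (rot_aut \<theta> (\<gamma> + of_int l * \<theta>) d g))"
proof -
  interpret rotation \<theta> .
  let ?w = "(u [^]\<^bsub>A\<^esub> k) \<otimes>\<^bsub>A\<^esub> (v [^]\<^bsub>A\<^esub> l)"
  have eq: "compose (carrier A) (Ad A ?w) (rot_aut \<theta> \<gamma> d f) = rot_aut \<theta> (\<gamma> + of_int l * \<theta>) d g"
    using Ad_compose_rot_aut[OF assms] .
  have "unitary ?w"
    using unitary_mult unitary_int_pow u_unitary v_unitary by blast
  moreover have "rot_aut \<theta> \<gamma> d f \<in> star_aut A"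
    using rot_aut_iff[OF assms(1)] by blast
  ultimately show ?thesis
    using crossed_product_Ad_isomorphic eq by metis
qed

end
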